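(* Let $N\to M$ be a Frobenius extension of rings of depth 2, with a fixed Frobenius homomorphism $\psi:M\to N$ and quasibasis $\sum_i u_i\otimes v_i$. Let $A=\mathrm{End}({}_NM_N)$, $L=C_M(N)$, $R=L^{op}$, let $S_A:A\to A$ be $S_A(\alpha)=\sum_i u_i\,\psi(\alpha(v_i)\,\cdot\,)$, and let $\iota:R\to L^{op}$ be the identity map and $\theta:L\to R^{op}$ the inverse $\nu^{-1}$ of the Nakayama automorphism. Then, with the structure maps $s_L,t_L,\gamma_L,\pi_L$ and $s_R,t_R,\gamma_R,\pi_R$ given in the context, $(A,L,s_L,t_L,\gamma_L,\pi_L)$ is a left bialgebroid, $(A,R,s_R,t_R,\gamma_R,\pi_R)$ is a right bialgebroid, and the pairs $(S_A,\iota)$ and $(S_A,\theta)$ are isomorphisms of bialgebroids $$(A,R,s_R,t_R,\gamma_R,\pi_R)\xrightarrow{(S_A,\iota)}(A,L,s_L,t_L,\gamma_L,\pi_L)^{op}_{cop},\qquad (A,L,s_L,t_L,\gamma_L,\pi_L)\xrightarrow{(S_A,\theta)}(A,R,s_R,t_R,\gamma_R,\pi_R)^{op}_{cop}.$$ That is: $S_A:A\to A^{op}$ is a ring isomorphism; $$S_A\circ s_R=s_L\circ\iota,\quad S_A\circ t_R=t_L\circ\iota,\quad S_A\circ s_L=s_R\circ\theta,\quad S_A\circ t_L=t_R\circ\theta;$$ $$\gamma_L\circ S_A=S_{A\otimes_R A}\circ\gamma_R,\qquad \gamma_R\circ S_A=S_{A\otimes_L A}\circ\gamma_L;$$ $$\pi_L\circ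 S_A=\iota\circ\pi_R,\qquad \pi_R\circ S_A=\theta\circ\pi_L ,$$ where $S_{A\otimes_L A}:A\otimes_LA\to A\otimes_RA$ and $S_{A\otimes_R A}:A\otimes_RA\to A\otimes_LA$ are both the (well defined) maps $\alpha\otimes\beta\mapsto S_A(\beta)\otimes S_A(\alpha)$.
   Context: All rings are associative and unital. A ring extension $N\to M$ is Frobenius if there is an $N$-$N$-bimodule map $\psi:M\to N$ (a Frobenius homomorphism) possessing a quasibasis, i.e. an element $\sum_i u_i\otimes v_i\in M\otimes_NM$ with $\sum_i\psi(mu_i)v_i=m=\sum_iu_i\psi(v_im)$ for all $m\in M$. Put $A=\mathrm{End}({}_NM_N)$ (the ring of $N$-$N$-bimodule endomorphisms under composition) and $B=(M\otimes_NM)^N=\{X\in M\otimes_N M: nX=Xn\ \forall n\in N\}$. The extension has depth 2 (is D2) if there are finitely many $b_i,c_i\in B$ and $\beta_i,\gamma_i\in A$ with $\sum_i b_i^1\otimes b_i^2\beta_i(m)=m\otimes1_M$ and $\sum_i\gamma_i(m)c_i^1\otimes c_i^2=1_M\otimes m$ for all $m\in M$; for a Frobenius extension this is equivalent to the existence of finitely many $\beta_i,\gamma_i\in A$ with $\sum_i\gamma_i(m)\beta_i(m')=\psi(mm')$ for all $m,m'\in M$. $C_M(N)=\{c\in M: cn=nc\ \forall n\in N\}$ is the centralizer. The Nakayama automorphism is $\nu:C_M(N)\to C_M(N)$, $\nu(c)=\sum_i\psi(u_ic)v_i$. Put $L=C_M(N)$, $R=C_M(N)^{op}$, and let $\lambda:L\to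 A$, $\lambda(l)(m)=lm$, $\rho:R\to A$, $\rho(r)(m)=mr$. Structure maps: $s_L=\lambda$; $t_L=\rho$ (as a map $L^{op}=R\to A$); $s_R=\rho$; $t_R=\lambda\circ\nu$ (as a map $R^{op}=L\to A$). The $L$-$L$-bimodule structure on $A$ is $l_1\cdot\alpha\cdot l_2=s_L(l_1)t_L(l_2)\alpha$ and the $R$-$R$-bimodule structure is $r_1\cdot\alpha\cdot r_2=\alpha\,t_R(r_1)s_R(r_2)$; $A\otimes_LA$ and $A\otimes_RA$ are formed with these. For D2 extensions the map $A\otimes_LA\to\mathrm{Hom}_{N-N}(M\otimes_NM,M)$, $\alpha\otimes\beta\mapsto(m\otimes m'\mapsto\alpha(m)\beta(m'))$ is an isomorphism, and for D2 Frobenius extensions so is $A\otimes_RA\to\mathrm{Hom}_{N-N}(M,M\otimes_NM)$, $\alpha\otimes\beta\mapsto\sum_i\alpha(\,\cdot\,u_i)\otimes\beta(v_i)$. The coproduct $\gamma_L(\alpha)=\alpha_{(1)}\otimes\alpha_{(2)}\in A\otimes_LA$ is the unique element with $\alpha(mm')=\alpha_{(1)}(m)\alpha_{(2)}(m')$ for all $m,m'\in M$, and $\gamma_R(\alpha)=\alpha^{(1)}\otimes\alpha^{(2)}\in A\otimes_RA$ is the unique element with $\sum_i\alpha(m)u_i\otimes v_i=\sum_i\alpha^{(1)}(mu_i)\otimes\alpha^{(2)}(v_i)$ for all $m\in M$. The counits are $\pi_L(\alpha)=\alpha(1_M)$ and $\pi_R(\alpha)=\sum_iu_i\psi(\alpha(v_i))$.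 Left bialgebroid $(A,L,s_L,t_L,\gamma_L,\pi_L)$: $s_L:L\to A$, $t_L:L^{op}\to A$ are ring homomorphisms with commuting images, $(A,\gamma_L,\pi_L)$ is a comonoid in $L$-$L$-bimodules for $l\cdot a\cdot l'=s_L(l)t_L(l')a$, and, with $\gamma_L(a)=a_{(1)}\otimes a_{(2)}$: $a_{(1)}t_L(l)\otimes a_{(2)}=a_{(1)}\otimes a_{(2)}s_L(l)$, $\gamma_L(1)=1\otimes1$, $\gamma_L(ab)=\gamma_L(a)\gamma_L(b)$, $\pi_L(1)=1$, $\pi_L(as_L(\pi_L(b)))=\pi_L(ab)=\pi_L(at_L(\pi_L(b)))$. Right bialgebroid $(A,R,s_R,t_R,\gamma_R,\pi_R)$: $s_R:R\to A$, $t_R:R^{op}\to A$ are ring homomorphisms with commuting images, $(A,\gamma_R,\pi_R)$ is a comonoid in $R$-$R$-bimodules for $r\cdot a\cdot r'=as_R(r')t_R(r)$, and, with $\gamma_R(a)=a^{(1)}\otimes a^{(2)}$: $s_R(r)a^{(1)}\otimes a^{(2)}=a^{(1)}\otimes t_R(r)a^{(2)}$, $\gamma_R(1)=1\otimes 1$, $\gamma_R$ multiplicative, $\pi_R(1)=1$, $\pi_R(s_R(\pi_R(a))b)=\pi_R(ab)=\pi_R(t_R(\pi_R(a))b)$. The operation $(\ )^{op}_{cop}$ sends $(A,K,s,t,\gamma,\pi)$ to $(A^{op},K^{op},s,t,\gamma^{op},\pi)$ and exchanges left and right bialgebroids. An isomorphism of bialgebroids is a pair of ring isomorphisms (of total and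 base rings) compatible with source, target, coproduct and counit. *)

theory Defs
  imports "HOL-Algebra.Free_Abelian_Groups" "HOL-Algebra.QuotRing"
begin

section \<open>Bimodules and their tensor squares\<close>

definition op_ring :: "'a ring \<Rightarrow> 'a ring" where
  "op_ring A = A\<lparr>mult := \<lambda>x y. y \<otimes>\<^bsub>A\<^esub> x\<rparr>"

text \<open>A bimodule over one ring on both sides. Of \<open>bm_grp\<close> only the additive structure is used.\<close>

record ('k, 'x) bimod =
  bm_scal :: "'k ring"
  bm_grp  :: "'x ring"
  bm_l    :: "'k \<Rightarrow> 'x \<Rightarrow> 'x"
  bm_r    :: "'x \<Rightarrow> 'k \<Rightarrow> 'x"

definition bimodule :: "('k, 'x) bimod \<Rightarrow> bool" where
  "bimodule V \<longleftrightarrow>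
     (let K = bm_scal V; X = bm_grp V; l = bm_l V; r = bm_r V in
      ring K \<and> abelian_group X \<and>
      (\<forall>k \<in> carrier K. \<forall>x \<in> carrier X. l k x \<in> carrier X \<and> r x k \<in> carrier X) \<and>
      (\<forall>x \<in> carrier X. l \<one>\<^bsub>K\<^esub> x = x \<and> r x \<one>\<^bsub>K\<^esub> = x) \<and>
      (\<forall>k \<in> carrier K. \<forall>k' \<in> carrier K. \<forall>x \<in> carrier X.
         l (k \<otimes>\<^bsub>K\<^esub> k') x = l k (l k' x) \<and> r x (k \<otimes>\<^bsub>K\<^esub> k') = r (r x k) k' \<and>
         r (l k x) k' = l k (r x k') \<and>
         l (k \<oplus>\<^bsub>K\<^esub> k') x = l k x \<oplus>\<^bsub>X\<^esub> l k' x \<and> r x (k \<oplus>\<^bsub>K\<^esub> k') = r x k \<oplus>\<^bsub>X\<^esub> r x k') \<and>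
      (\<forall>k \<in> carrier K. \<forall>x \<in> carrier X. \<forall>y \<in> carrier X.
         l k (x \<oplus>\<^bsub>X\<^esub> y) = l k x \<oplus>\<^bsub>X\<^esub> l k y \<and> r (x \<oplus>\<^bsub>X\<^esub> y) k = r x k \<oplus>\<^bsub>X\<^esub> r y k))"

definition bimod_homs :: "('k, 'x) bimod \<Rightarrow> ('k, 'y) bimod \<Rightarrow> ('x \<Rightarrow> 'y) set" where
  "bimod_homs V W =
     {f \<in> hom (add_monoid (bm_grp V)) (add_monoid (bm_grp W)).
        \<forall>k \<in> carrier (bm_scal V). \<forall>x \<in> carrier (bm_grp V).
          f (bm_l V k x) = bm_l W k (f x) \<and> f (bm_r V x k) = bm_r W (f x) k}"

definition regular_bimod :: "'k ring \<Rightarrow> ('k, 'k) bimod" where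
  "regular_bimod K = \<lparr>bm_scal = K, bm_grp = K, bm_l = mult K, bm_r = mult K\<rparr>"

text \<open>
  The tensor square of a \<open>K\<close>-\<open>K\<close>-bimodule \<open>X\<close> over \<open>K\<close> is the free abelian group on pairs modulo
  biadditivity and \<open>x k \<otimes> y = x \<otimes> k y\<close>. Its elements are cosets, i.e. sets of formal sums of
  pairs; \<open>c \<in> X\<close> thus says that the formal sum \<open>c\<close> represents the tensor \<open>X\<close>.
\<close>

definition tensor_gens :: "('k, 'x) bimod \<Rightarrow> ('x \<times> 'x \<Rightarrow>\<^sub>0 int) set" where
  "tensor_gens V =
     (let K = bm_scal V; X = bm_grp V in
       {frag_of (x \<oplus>\<^bsub>X\<^esub> x', y) - frag_of (x, y) - frag_of (x', y) | x x' y.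
          x \<in> carrier X \<and> x' \<in> carrier X \<and> y \<in> carrier X} \<union>
       {frag_of (x, y \<oplus>\<^bsub>X\<^esub> y') - frag_of (x, y) - frag_of (x, y') | x y y'.
          x \<in> carrier X \<and> y \<in> carrier X \<and> y' \<in> carrier X} \<union>
       {frag_of (bm_r V x k, y) - frag_of (x, bm_l V k y) | x k y.
          x \<in> carrier X \<and> k \<in> carrier K \<and> y \<in> carrier X})"

definition pair_group :: "('k, 'x) bimod \<Rightarrow> ('x \<times> 'x \<Rightarrow>\<^sub>0 int) monoid" where
  "pair_group V = free_Abelian_group (carrier (bm_grp V) \<times> carrier (bm_grp V))"

definition tensor :: "('k, 'x) bimod \<Rightarrow> ('x \<times> 'x \<Rightarrow>\<^sub>0 int) set monoid" where
  "tensor V = pair_group V Mod generate (pair_group V) (tensor_gens V)"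

definition tensor_class :: "('k, 'x) bimod \<Rightarrow> ('x \<times> 'x \<Rightarrow>\<^sub>0 int) \<Rightarrow> ('x \<times> 'x \<Rightarrow>\<^sub>0 int) set" where
  "tensor_class V c = generate (pair_group V) (tensor_gens V) #>\<^bsub>pair_group V\<^esub> c"

definition pure_tensor :: "('k, 'x) bimod \<Rightarrow> 'x \<Rightarrow> 'x \<Rightarrow> ('x \<times> 'x \<Rightarrow>\<^sub>0 int) set" where
  "pure_tensor V x y = tensor_class V (frag_of (x, y))"

text \<open>The threefold tensor power is formed directly from triples, so that no associator is needed.\<close>

definition tensor3_gens :: "('k, 'x) bimod \<Rightarrow> ('x \<times> 'x \<times> 'x \<Rightarrow>\<^sub>0 int) set" where
  "tensor3_gens V =
     (let K = bm_scal V; X = bm_grp V in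
       {frag_of (x \<oplus>\<^bsub>X\<^esub> x', y, z) - frag_of (x, y, z) - frag_of (x', y, z) | x x' y z.
          x \<in> carrier X \<and> x' \<in> carrier X \<and> y \<in> carrier X \<and> z \<in> carrier X} \<union>
       {frag_of (x, y \<oplus>\<^bsub>X\<^esub> y', z) - frag_of (x, y, z) - frag_of (x, y', z) | x y y' z.
          x \<in> carrier X \<and> y \<in> carrier X \<and> y' \<in> carrier X \<and> z \<in> carrier X} \<union>
       {frag_of (x, y, z \<oplus>\<^bsub>X\<^esub> z') - frag_of (x, y, z) - frag_of (x, y, z') | x y z z'.
          x \<in> carrier X \<and> y \<in> carrier X \<and> z \<in> carrier X \<and> z' \<in> carrier X} \<union>
       {frag_of (bm_r V x k, y, z) - frag_of (x, bm_l V k y, z) | x k y z.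
          x \<in> carrier X \<and> k \<in> carrier K \<and> y \<in> carrier X \<and> z \<in> carrier X} \<union>
       {frag_of (x, bm_r V y k, z) - frag_of (x, y, bm_l V k z) | x y k z.
          x \<in> carrier X \<and> k \<in> carrier K \<and> y \<in> carrier X \<and> z \<in> carrier X})"

definition triple_group :: "('k, 'x) bimod \<Rightarrow> ('x \<times> 'x \<times> 'x \<Rightarrow>\<^sub>0 int) monoid" where
  "triple_group V =
     free_Abelian_group (carrier (bm_grp V) \<times> carrier (bm_grp V) \<times> carrier (bm_grp V))"

definition tensor3_class ::
    "('k, 'x) bimod \<Rightarrow> ('x \<times> 'x \<times> 'x \<Rightarrow>\<^sub>0 int) \<Rightarrow> ('x \<times> 'x \<times> 'x \<Rightarrow>\<^sub>0 int) set" where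
  "tensor3_class V c = generate (triple_group V) (tensor3_gens V) #>\<^bsub>triple_group V\<^esub> c"

definition frag_map :: "('a \<Rightarrow> 'b) \<Rightarrow> ('a \<Rightarrow>\<^sub>0 int) \<Rightarrow> ('b \<Rightarrow>\<^sub>0 int)" where
  "frag_map f = frag_extend (\<lambda>p. frag_of (f p))"

text \<open>The value of a formal sum under the additive extension of \<open>f\<close> to an abelian group \<open>X\<close>.\<close>

definition frag_eval :: "'x ring \<Rightarrow> ('p \<Rightarrow> 'x) \<Rightarrow> ('p \<Rightarrow>\<^sub>0 int) \<Rightarrow> 'x" where
  "frag_eval X f c =
     (\<Oplus>\<^bsub>X\<^esub>p \<in> Poly_Mapping.keys c. [Poly_Mapping.lookup c p] \<cdot>\<^bsub>X\<^esub> f p)"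

text \<open>
  The map of tensor squares induced by a map of pairs. If the latter respects the relations, all the
  classes in the union coincide; otherwise the union is not a single class, hence not a tensor.
\<close>

definition induced_map ::
    "('k, 'x) bimod \<Rightarrow> ('y \<times> 'y \<Rightarrow> 'x \<times> 'x) \<Rightarrow> ('y \<times> 'y \<Rightarrow>\<^sub>0 int) set \<Rightarrow> ('x \<times> 'x \<Rightarrow>\<^sub>0 int) set" where
  "induced_map V f T = (\<Union>c \<in> T. tensor_class V (frag_map f c))"

section \<open>Bialgebroids\<close>

text \<open>
  Sweedler notation \<open>\<gamma> a = a\<^sub>1 \<otimes> a\<^sub>2\<close> is rendered by quantifying over all formal sums \<open>c \<in> \<gamma> a\<close>
  representing the tensor \<open>\<gamma> a\<close>. In the coassociativity law, \<open>g\<close> chooses such a representative for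
  every element.
\<close>

definition comonoid_bimod ::
    "('k, 'x) bimod \<Rightarrow> ('x \<Rightarrow> ('x \<times> 'x \<Rightarrow>\<^sub>0 int) set) \<Rightarrow> ('x \<Rightarrow> 'k) \<Rightarrow> bool" where
  "comonoid_bimod V \<gamma> \<pi> \<longleftrightarrow>
     (let K = bm_scal V; X = bm_grp V; l = bm_l V; r = bm_r V in
      bimodule V \<and>
      \<gamma> \<in> hom (add_monoid X) (tensor V) \<and>
      (\<forall>k \<in> carrier K. \<forall>a \<in> carrier X. \<forall>c \<in> \<gamma> a.
         frag_map (\<lambda>(x, y). (l k x, y)) c \<in> \<gamma> (l k a) \<and>
         frag_map (\<lambda>(x, y). (x, r y k)) c \<in> \<gamma> (r a k)) \<and>
      \<pi> \<in> bimod_homs V (regular_bimod K) \<and>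
      (\<forall>g. (\<forall>a \<in> carrier X. g a \<in> \<gamma> a) \<longrightarrow>
         (\<forall>a \<in> carrier X. \<forall>c \<in> \<gamma> a.
            tensor3_class V (frag_extend (\<lambda>(x, y). frag_map (\<lambda>(p, q). (p, q, y)) (g x)) c) =
            tensor3_class V (frag_extend (\<lambda>(x, y). frag_map (\<lambda>(p, q). (x, p, q)) (g y)) c))) \<and>
      (\<forall>a \<in> carrier X. \<forall>c \<in> \<gamma> a.
         frag_eval X (\<lambda>(x, y). l (\<pi> x) y) c = a \<and>
         frag_eval X (\<lambda>(x, y). r x (\<pi> y)) c = a))"

record ('a, 'k) bialgebroid =
  total :: "'a ring"
  base  :: "'k ring"
  src   :: "'k \<Rightarrow> 'a"
  tgt   :: "'k \<Rightarrow> 'a"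
  cop   :: "'a \<Rightarrow> ('a \<times> 'a \<Rightarrow>\<^sub>0 int) set"
  cou   :: "'a \<Rightarrow> 'k"

definition left_bimod :: "'a ring \<Rightarrow> 'k ring \<Rightarrow> ('k \<Rightarrow> 'a) \<Rightarrow> ('k \<Rightarrow> 'a) \<Rightarrow> ('k, 'a) bimod" where
  "left_bimod A K s t =
     \<lparr>bm_scal = K, bm_grp = A, bm_l = \<lambda>k a. s k \<otimes>\<^bsub>A\<^esub> a, bm_r = \<lambda>a k. t k \<otimes>\<^bsub>A\<^esub> a\<rparr>"

definition right_bimod :: "'a ring \<Rightarrow> 'k ring \<Rightarrow> ('k \<Rightarrow> 'a) \<Rightarrow> ('k \<Rightarrow> 'a) \<Rightarrow> ('k, 'a) bimod" where
  "right_bimod A K s t =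
     \<lparr>bm_scal = K, bm_grp = A, bm_l = \<lambda>k a. a \<otimes>\<^bsub>A\<^esub> t k, bm_r = \<lambda>a k. a \<otimes>\<^bsub>A\<^esub> s k\<rparr>"

text \<open>The axioms that left and right bialgebroids share verbatim.\<close>

definition bialgebroid_core :: "('a, 'k) bialgebroid \<Rightarrow> bool" where
  "bialgebroid_core B \<longleftrightarrow>
     (let A = total B; K = base B; s = src B; t = tgt B; \<gamma> = cop B; \<pi> = cou B in
      ring A \<and> ring K \<and>
      s \<in> ring_hom K A \<and> t \<in> ring_hom (op_ring K) A \<and>
      (\<forall>k \<in> carrier K. \<forall>k' \<in> carrier K. s k \<otimes>\<^bsub>A\<^esub> t k' = t k' \<otimes>\<^bsub>A\<^esub> s k) \<and>
      frag_of (\<one>\<^bsub>A\<^esub>, \<one>\<^bsub>A\<^esub>) \<in> \<gamma> \<one>\<^bsub>A\<^esub> \<and>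
      (\<forall>a \<in> carrier A. \<forall>b \<in> carrier A. \<forall>c \<in> \<gamma> a. \<forall>d \<in> \<gamma> b.
         frag_extend (\<lambda>(x, y). frag_map (\<lambda>(x', y'). (x \<otimes>\<^bsub>A\<^esub> x', y \<otimes>\<^bsub>A\<^esub> y')) d) c \<in> \<gamma> (a \<otimes>\<^bsub>A\<^esub> b)) \<and>
      \<pi> \<one>\<^bsub>A\<^esub> = \<one>\<^bsub>K\<^esub>)"

definition left_bialgebroid :: "('a, 'k) bialgebroid \<Rightarrow> bool" where
  "left_bialgebroid B \<longleftrightarrow>
     (let A = total B; K = base B; s = src B; t = tgt B; \<gamma> = cop B; \<pi> = cou B;
          V = left_bimod A K s t in
      bialgebroid_core B \<and>
      comonoid_bimod V \<gamma> \<pi> \<and>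
      (\<forall>k \<in> carrier K. \<forall>a \<in> carrier A. \<forall>c \<in> \<gamma> a.
         tensor_class V (frag_map (\<lambda>(x, y). (x \<otimes>\<^bsub>A\<^esub> t k, y)) c) =
         tensor_class V (frag_map (\<lambda>(x, y). (x, y \<otimes>\<^bsub>A\<^esub> s k)) c)) \<and>
      (\<forall>a \<in> carrier A. \<forall>b \<in> carrier A.
         \<pi> (a \<otimes>\<^bsub>A\<^esub> s (\<pi> b)) = \<pi> (a \<otimes>\<^bsub>A\<^esub> b) \<and> \<pi> (a \<otimes>\<^bsub>A\<^esub> t (\<pi> b)) = \<pi> (a \<otimes>\<^bsub>A\<^esub> b)))"

definition right_bialgebroid :: "('a, 'k) bialgebroid \<Rightarrow> bool" where
  "right_bialgebroid B \<longleftrightarrow>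
     (let A = total B; K = base B; s = src B; t = tgt B; \<gamma> = cop B; \<pi> = cou B;
          V = right_bimod A K s t in
      bialgebroid_core B \<and>
      comonoid_bimod V \<gamma> \<pi> \<and>
      (\<forall>k \<in> carrier K. \<forall>a \<in> carrier A. \<forall>c \<in> \<gamma> a.
         tensor_class V (frag_map (\<lambda>(x, y). (s k \<otimes>\<^bsub>A\<^esub> x, y)) c) =
         tensor_class V (frag_map (\<lambda>(x, y). (x, t k \<otimes>\<^bsub>A\<^esub> y)) c)) \<and>
      (\<forall>a \<in> carrier A. \<forall>b \<in> carrier A.
         \<pi> (s (\<pi> a) \<otimes>\<^bsub>A\<^esub> b) = \<pi> (a \<otimes>\<^bsub>A\<^esub> b) \<and> \<pi> (t (\<pi> a) \<otimes>\<^bsub>A\<^esub> b) = \<pi> (a \<otimes>\<^bsub>A\<^esub> b)))"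

text \<open>
  Passing to the opposite rings exchanges the two actions of the base, so the flip carries the
  relations of the old tensor square onto those of the new one, and cosets onto cosets.
\<close>

definition op_cop :: "('a, 'k) bialgebroid \<Rightarrow> ('a, 'k) bialgebroid" where
  "op_cop B =
     \<lparr>total = op_ring (total B), base = op_ring (base B), src = src B, tgt = tgt B,
      cop = \<lambda>a. frag_map prod.swap ` cop B a, cou = cou B\<rparr>"

text \<open>
  Source and target are to be of the same handedness. The fifth condition is
  \<open>\<gamma>' \<circ> f = (f \<otimes> f) \<circ> \<gamma>\<close>.
\<close>

definition bialgebroid_iso ::
    "('a, 'k) bialgebroid \<Rightarrow> ('b, 'l) bialgebroid \<Rightarrow> ('a \<Rightarrow> 'b) \<Rightarrow> ('k \<Rightarrow> 'l) \<Rightarrow> bool" where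
  "bialgebroid_iso B B' f g \<longleftrightarrow>
     f \<in> ring_iso (total B) (total B') \<and>
     g \<in> ring_iso (base B) (base B') \<and>
     (\<forall>k \<in> carrier (base B). f (src B k) = src B' (g k)) \<and>
     (\<forall>k \<in> carrier (base B). f (tgt B k) = tgt B' (g k)) \<and>
     (\<forall>a \<in> carrier (total B). \<forall>c \<in> cop B a. frag_map (map_prod f f) c \<in> cop B' (f a)) \<and>
     (\<forall>a \<in> carrier (total B). cou B' (f a) = g (cou B a))"

section \<open>Frobenius extensions of depth two\<close>

text \<open>A ring extension is a unital ring homomorphism \<open>h\<close> from \<open>N\<close> to \<open>M\<close>, not assumed injective.\<close>

definition ext_bimod :: "'n ring \<Rightarrow> 'm ring \<Rightarrow> ('n \<Rightarrow> 'm) \<Rightarrow> ('n, 'm) bimod" where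
  "ext_bimod N M h =
     \<lparr>bm_scal = N, bm_grp = M, bm_l = \<lambda>n m. h n \<otimes>\<^bsub>M\<^esub> m, bm_r = \<lambda>m n. m \<otimes>\<^bsub>M\<^esub> h n\<rparr>"

text \<open>
  A Frobenius homomorphism \<open>\<psi>\<close> together with a quasibasis \<open>\<Sum>i\<in>I. u i \<otimes> v i\<close>.
\<close>

definition frobenius_system ::
    "'n ring \<Rightarrow> 'm ring \<Rightarrow> ('n \<Rightarrow> 'm) \<Rightarrow> ('m \<Rightarrow> 'n) \<Rightarrow> 'i set \<Rightarrow> ('i \<Rightarrow> 'm) \<Rightarrow> ('i \<Rightarrow> 'm) \<Rightarrow> bool" where
  "frobenius_system N M h \<psi> I u v \<longleftrightarrow>
     \<psi> \<in> bimod_homs (ext_bimod N M h) (regular_bimod N) \<and>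
     finite I \<and> u \<in> I \<rightarrow> carrier M \<and> v \<in> I \<rightarrow> carrier M \<and>
     (\<forall>m \<in> carrier M.
        (\<Oplus>\<^bsub>M\<^esub>i\<in>I. h (\<psi> (m \<otimes>\<^bsub>M\<^esub> u i)) \<otimes>\<^bsub>M\<^esub> v i) = m \<and>
        (\<Oplus>\<^bsub>M\<^esub>i\<in>I. u i \<otimes>\<^bsub>M\<^esub> h (\<psi> (v i \<otimes>\<^bsub>M\<^esub> m))) = m)"

definition end_ring :: "'n ring \<Rightarrow> 'm ring \<Rightarrow> ('n \<Rightarrow> 'm) \<Rightarrow> ('m \<Rightarrow> 'm) ring" where
  "end_ring N M h =
     \<lparr>carrier = bimod_homs (ext_bimod N M h) (ext_bimod N M h) \<inter> extensional (carrier M),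
      mult = compose (carrier M), one = (\<lambda>m \<in> carrier M. m),
      zero = (\<lambda>m \<in> carrier M. \<zero>\<^bsub>M\<^esub>), add = (\<lambda>\<alpha> \<beta>. \<lambda>m \<in> carrier M. \<alpha> m \<oplus>\<^bsub>M\<^esub> \<beta> m)\<rparr>"

text \<open>The \<open>N\<close>-central elements \<open>(M \<otimes>\<^sub>N M)\<^sup>N\<close>.\<close>

definition central_tensors ::
    "'n ring \<Rightarrow> 'm ring \<Rightarrow> ('n \<Rightarrow> 'm) \<Rightarrow> ('m \<times> 'm \<Rightarrow>\<^sub>0 int) set set" where
  "central_tensors N M h =
     {X \<in> carrier (tensor (ext_bimod N M h)). \<forall>n \<in> carrier N.
        induced_map (ext_bimod N M h) (\<lambda>(p, q). (h n \<otimes>\<^bsub>M\<^esub> p, q)) X =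
        induced_map (ext_bimod N M h) (\<lambda>(p, q). (p, q \<otimes>\<^bsub>M\<^esub> h n)) X}"

text \<open>\<open>finprod\<close> is summation in the multiplicatively written abelian group \<open>M \<otimes>\<^sub>N M\<close>.\<close>

definition depth_two :: "'n ring \<Rightarrow> 'm ring \<Rightarrow> ('n \<Rightarrow> 'm) \<Rightarrow> bool" where
  "depth_two N M h \<longleftrightarrow>
     (let V = ext_bimod N M h in
      (\<exists>(k::nat) b \<beta>. (\<forall>i<k. b i \<in> central_tensors N M h \<and> \<beta> i \<in> carrier (end_ring N M h)) \<and>
         (\<forall>m \<in> carrier M.
            finprod (tensor V) (\<lambda>i. induced_map V (\<lambda>(p, q). (p, q \<otimes>\<^bsub>M\<^esub> \<beta> i m)) (b i)) {..<k} =
            pure_tensor V m \<one>\<^bsub>M\<^esub>)) \<and>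
      (\<exists>(k::nat) c \<gamma>. (\<forall>i<k. c i \<in> central_tensors N M h \<and> \<gamma> i \<in> carrier (end_ring N M h)) \<and>
         (\<forall>m \<in> carrier M.
            finprod (tensor V) (\<lambda>i. induced_map V (\<lambda>(p, q). (\<gamma> i m \<otimes>\<^bsub>M\<^esub> p, q)) (c i)) {..<k} =
            pure_tensor V \<one>\<^bsub>M\<^esub> m)))"

definition centralizer_ring :: "'n ring \<Rightarrow> 'm ring \<Rightarrow> ('n \<Rightarrow> 'm) \<Rightarrow> 'm ring" where
  "centralizer_ring N M h =
     M\<lparr>carrier := {c \<in> carrier M. \<forall>n \<in> carrier N. c \<otimes>\<^bsub>M\<^esub> h n = h n \<otimes>\<^bsub>M\<^esub> c}\<rparr>"

definition nakayama ::
    "'m ring \<Rightarrow> ('n \<Rightarrow> 'm) \<Rightarrow> ('m \<Rightarrow> 'n) \<Rightarrow> 'i set \<Rightarrow> ('i \<Rightarrow> 'm) \<Rightarrow> ('i \<Rightarrow> 'm) \<Rightarrow> 'm \<Rightarrow> 'm" where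
  "nakayama M h \<psi> I u v c = (\<Oplus>\<^bsub>M\<^esub>i\<in>I. h (\<psi> (u i \<otimes>\<^bsub>M\<^esub> c)) \<otimes>\<^bsub>M\<^esub> v i)"

definition nakayama_inv ::
    "'n ring \<Rightarrow> 'm ring \<Rightarrow> ('n \<Rightarrow> 'm) \<Rightarrow> ('m \<Rightarrow> 'n) \<Rightarrow> 'i set \<Rightarrow> ('i \<Rightarrow> 'm) \<Rightarrow> ('i \<Rightarrow> 'm) \<Rightarrow> 'm \<Rightarrow> 'm" where
  "nakayama_inv N M h \<psi> I u v =
     inv_into (carrier (centralizer_ring N M h)) (nakayama M h \<psi> I u v)"

definition lmul :: "'m ring \<Rightarrow> 'm \<Rightarrow> 'm \<Rightarrow> 'm" where
  "lmul M l = (\<lambda>m \<in> carrier M. l \<otimes>\<^bsub>M\<^esub> m)"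

definition rmul :: "'m ring \<Rightarrow> 'm \<Rightarrow> 'm \<Rightarrow> 'm" where
  "rmul M r = (\<lambda>m \<in> carrier M. m \<otimes>\<^bsub>M\<^esub> r)"

definition bimod_L :: "'n ring \<Rightarrow> 'm ring \<Rightarrow> ('n \<Rightarrow> 'm) \<Rightarrow> ('m, 'm \<Rightarrow> 'm) bimod" where
  "bimod_L N M h = left_bimod (end_ring N M h) (centralizer_ring N M h) (lmul M) (rmul M)"

definition bimod_R ::
    "'n ring \<Rightarrow> 'm ring \<Rightarrow> ('n \<Rightarrow> 'm) \<Rightarrow> ('m \<Rightarrow> 'n) \<Rightarrow> 'i set \<Rightarrow> ('i \<Rightarrow> 'm) \<Rightarrow> ('i \<Rightarrow> 'm) \<Rightarrow>
      ('m, 'm \<Rightarrow> 'm) bimod" where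
  "bimod_R N M h \<psi> I u v =
     right_bimod (end_ring N M h) (op_ring (centralizer_ring N M h))
       (rmul M) (\<lambda>r. lmul M (nakayama M h \<psi> I u v r))"

definition coproduct_L ::
    "'n ring \<Rightarrow> 'm ring \<Rightarrow> ('n \<Rightarrow> 'm) \<Rightarrow> ('m \<Rightarrow> 'm) \<Rightarrow> (('m \<Rightarrow> 'm) \<times> ('m \<Rightarrow> 'm) \<Rightarrow>\<^sub>0 int) set" where
  "coproduct_L N M h \<alpha> =
     (THE X. X \<in> carrier (tensor (bimod_L N M h)) \<and>
        (\<forall>c \<in> X. \<forall>m \<in> carrier M. \<forall>m' \<in> carrier M.
           \<alpha> (m \<otimes>\<^bsub>M\<^esub> m') = frag_eval M (\<lambda>(\<beta>, \<delta>). \<beta> m \<otimes>\<^bsub>M\<^esub> \<delta> m') c))"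

definition coproduct_R ::
    "'n ring \<Rightarrow> 'm ring \<Rightarrow> ('n \<Rightarrow> 'm) \<Rightarrow> ('m \<Rightarrow> 'n) \<Rightarrow> 'i set \<Rightarrow> ('i \<Rightarrow> 'm) \<Rightarrow> ('i \<Rightarrow> 'm) \<Rightarrow>
      ('m \<Rightarrow> 'm) \<Rightarrow> (('m \<Rightarrow> 'm) \<times> ('m \<Rightarrow> 'm) \<Rightarrow>\<^sub>0 int) set" where
  "coproduct_R N M h \<psi> I u v \<alpha> =
     (THE X. X \<in> carrier (tensor (bimod_R N M h \<psi> I u v)) \<and>
        (\<forall>c \<in> X. \<forall>m \<in> carrier M.
           tensor_class (ext_bimod N M h) (\<Sum>i\<in>I. frag_of (\<alpha> m \<otimes>\<^bsub>M\<^esub> u i, v i)) =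
           tensor_class (ext_bimod N M h)
             (\<Sum>i\<in>I. frag_map (\<lambda>(\<beta>, \<delta>). (\<beta> (m \<otimes>\<^bsub>M\<^esub> u i), \<delta> (v i))) c)))"

definition left_bialgebroid_of ::
    "'n ring \<Rightarrow> 'm ring \<Rightarrow> ('n \<Rightarrow> 'm) \<Rightarrow> ('m \<Rightarrow> 'm, 'm) bialgebroid" where
  "left_bialgebroid_of N M h =
     \<lparr>total = end_ring N M h, base = centralizer_ring N M h, src = lmul M, tgt = rmul M,
      cop = coproduct_L N M h, cou = (\<lambda>\<alpha>. \<alpha> \<one>\<^bsub>M\<^esub>)\<rparr>"

definition right_bialgebroid_of ::
    "'n ring \<Rightarrow> 'm ring \<Rightarrow> ('n \<Rightarrow> 'm) \<Rightarrow> ('m \<Rightarrow> 'n) \<Rightarrow> 'i set \<Rightarrow> ('i \<Rightarrow> 'm) \<Rightarrow> ('i \<Rightarrow> 'm) \<Rightarrow>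
      ('m \<Rightarrow> 'm, 'm) bialgebroid" where
  "right_bialgebroid_of N M h \<psi> I u v =
     \<lparr>total = end_ring N M h, base = op_ring (centralizer_ring N M h), src = rmul M,
      tgt = (\<lambda>r. lmul M (nakayama M h \<psi> I u v r)),
      cop = coproduct_R N M h \<psi> I u v,
      cou = (\<lambda>\<alpha>. \<Oplus>\<^bsub>M\<^esub>i\<in>I. u i \<otimes>\<^bsub>M\<^esub> h (\<psi> (\<alpha> (v i))))\<rparr>"

definition antipode ::
    "'m ring \<Rightarrow> ('n \<Rightarrow> 'm) \<Rightarrow> ('m \<Rightarrow> 'n) \<Rightarrow> 'i set \<Rightarrow> ('i \<Rightarrow> 'm) \<Rightarrow> ('i \<Rightarrow> 'm) \<Rightarrow>
      ('m \<Rightarrow> 'm) \<Rightarrow> ('m \<Rightarrow> 'm)" where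
  "antipode M h \<psi> I u v \<alpha> =
     (\<lambda>m \<in> carrier M. \<Oplus>\<^bsub>M\<^esub>i\<in>I. u i \<otimes>\<^bsub>M\<^esub> h (\<psi> (\<alpha> (v i) \<otimes>\<^bsub>M\<^esub> m)))"

end

(*
  Write E for psi composed with N -> M. The form (m, m') |-> E(m m') is nondegenerate, and S is the
  adjoint with respect to it: E(w S(a)(m)) = E(a(w) m). Hence S is an anti-automorphism of A that
  sends rho(r) to lambda(r) and lambda(l) to rho(theta(l)).

  Depth two provides gam_j, bet_j in A with sum_j gam_j(m) bet_j(m') = E(m m'). Every y in A is then
  sum_j l_j(y) bet_j with l_j(y) = sum_i y(u_i) gam_j(v_i) in L, so a tensor over L is determined by
  the map (m, m') |-> sum x(m) y(m'), and likewise for threefold tensors. All axioms of the left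
  bialgebroid thus become identities between such maps.

  Taking adjoints shows that the flip x (x) y |-> S(y) (x) S(x) turns the condition defining
  gamma_R(a) into the one defining gamma_L(S(a)). The right bialgebroid axioms are the left ones
  carried over by this flip, and the isomorphisms follow.
*)
theory Submission
  imports Defs
begin

section \<open>Formal sums\<close>

abbreviation "keys \<equiv> Poly_Mapping.keys"

lemma frag_map_0 [simp]: "frag_map f 0 = 0"
  and frag_map_of [simp]: "frag_map f (frag_of p) = frag_of (f p)"
  and frag_map_diff: "frag_map f (c - d) = frag_map f c - frag_map f d"
  and frag_map_add: "frag_map f (c + d) = frag_map f c + frag_map f d"
  by (simp_all add: frag_map_def frag_extend_diff frag_extend_add)

lemma frag_map_map: "frag_map f (frag_map g c) = frag_map (\<lambda>p. f (g p)) c"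
  unfolding frag_map_def using frag_extend_compose[of "\<lambda>p. frag_of (f p)" g c]
  by (simp add: o_def)

lemma frag_map_cong: "(\<And>p. p \<in> keys c \<Longrightarrow> f p = g p) \<Longrightarrow> frag_map f c = frag_map g c"
  unfolding frag_map_def by (rule frag_extend_eq) simp

lemma frag_map_ident: "(\<And>p. p \<in> keys c \<Longrightarrow> f p = p) \<Longrightarrow> frag_map f c = c"
  using frag_map_cong[of c f "\<lambda>p. p"] frag_expansion[of c] by (simp add: frag_map_def)

lemma keys_frag_map: "keys (frag_map f c) \<subseteq> f ` keys c"
  unfolding frag_map_def using keys_frag_extend[of "\<lambda>p. frag_of (f p)" c] by auto

lemma keys_map_subset:
  "keys c \<subseteq> S \<Longrightarrow> f \<in> S \<rightarrow> T \<Longrightarrow> keys (frag_map f c) \<subseteq> T"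
  using keys_frag_map[of f c] by blast

lemma keys_extend_subset:
  "keys c \<subseteq> S \<Longrightarrow> (\<And>p. p \<in> S \<Longrightarrow> keys (f p) \<subseteq> T) \<Longrightarrow>
    keys (frag_extend f c) \<subseteq> T"
  using keys_frag_extend[of f c] by blast

lemma frag_map_frag_extend: "frag_map f (frag_extend g c) = frag_extend (\<lambda>p. frag_map f (g p)) c"
  using subset_UNIV by (induction c rule: frag_induction) (auto simp: frag_map_diff frag_extend_diff)

lemma frag_extend_frag_map: "frag_extend f (frag_map g c) = frag_extend (\<lambda>p. f (g p)) c"
  using subset_UNIV by (induction c rule: frag_induction) (auto simp: frag_map_diff frag_extend_diff)

lemma keys_diff_subset:
  "keys c \<subseteq> S \<Longrightarrow> keys d \<subseteq> S \<Longrightarrow> keys (c - d) \<subseteq> S"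
  for c d :: "'a \<Rightarrow>\<^sub>0 int"
  using keys_diff[of c d] by blast

lemma keys_add_subset:
  "keys c \<subseteq> S \<Longrightarrow> keys d \<subseteq> S \<Longrightarrow> keys (c + d) \<subseteq> S"
  for c d :: "'a \<Rightarrow>\<^sub>0 int"
  using keys_add[of c d] by blast

lemma keys_sum_subset:
  "(\<And>j. j \<in> J \<Longrightarrow> keys (c j) \<subseteq> S) \<Longrightarrow> keys (\<Sum>j\<in>J. c j :: 'a \<Rightarrow>\<^sub>0 int) \<subseteq> S"
  by (induction J rule: infinite_finite_induct) (simp_all add: keys_add_subset)

locale additive_group = abelian_group G for G :: "'a ring" (structure)
begin

lemma uminus_zero: "\<ominus> \<zero> = \<zero>"
  by (simp add: minus_equality)

lemma zero_int_pow: "[(0::int)] \<cdot> x = \<zero>"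
  by (simp add: add_pow_def int_pow_def nat_pow_def)

lemma diff_add_diff:
  assumes "a \<in> carrier G" "b \<in> carrier G" "c \<in> carrier G" "d \<in> carrier G"
  shows "(a \<ominus> b) \<oplus> (c \<ominus> d) = (a \<oplus> c) \<ominus> (b \<oplus> d)"
  using assms by (simp add: a_minus_def minus_add a_ac)

lemma add_int_pow_diff:
  "x \<in> carrier G \<Longrightarrow> [(j - k :: int)] \<cdot> x = [j] \<cdot> x \<ominus> [k] \<cdot> x"
  by (simp add: add.int_pow_diff a_minus_def)

lemma finsum_uminus:
  "f \<in> K \<rightarrow> carrier G \<Longrightarrow> finsum G (\<lambda>p. \<ominus> f p) K = \<ominus> finsum G f K"
  by (induction K rule: infinite_finite_induct) (auto simp: Pi_iff minus_add uminus_zero)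

lemma finsum_minus:
  assumes "f \<in> K \<rightarrow> carrier G" "g \<in> K \<rightarrow> carrier G"
  shows "finsum G (\<lambda>p. f p \<ominus> g p) K = finsum G f K \<ominus> finsum G g K"
proof -
  have "finsum G (\<lambda>p. f p \<ominus> g p) K = finsum G f K \<oplus> finsum G (\<lambda>p. \<ominus> g p) K"
    using assms by (subst finsum_addf[symmetric]) (auto simp: a_minus_def Pi_iff)
  with assms show ?thesis by (simp add: finsum_uminus a_minus_def)
qed

lemma frag_eval_superset:
  assumes "finite K" "keys c \<subseteq> K" "f \<in> K \<rightarrow> carrier G"
  shows "frag_eval G f c = (\<Oplus>p\<in>K. [Poly_Mapping.lookup c p] \<cdot> f p)"
  unfolding frag_eval_def using assms
  by (intro add.finprod_mono_neutral_cong_left) (auto simp: in_keys_iff Pi_iff zero_int_pow)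

lemma frag_eval_closed:
  "keys c \<subseteq> S \<Longrightarrow> f \<in> S \<rightarrow> carrier G \<Longrightarrow> frag_eval G f c \<in> carrier G"
  unfolding frag_eval_def by (intro finsum_closed) (auto simp: Pi_iff)

lemma frag_eval_0 [simp]: "frag_eval G f 0 = \<zero>"
  by (simp add: frag_eval_def)

lemma frag_eval_of: "f p \<in> carrier G \<Longrightarrow> frag_eval G f (frag_of p) = f p"
  by (simp add: frag_eval_def)

lemma frag_eval_diff:
  assumes "keys c \<subseteq> S" "keys d \<subseteq> S" "f \<in> S \<rightarrow> carrier G"
  shows "frag_eval G f (c - d) = frag_eval G f c \<ominus> frag_eval G f d"
proof -
  let ?K = "keys c \<union> keys d"
  have f: "f \<in> ?K \<rightarrow> carrier G" and K: "finite ?K" using assms by auto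
  have "frag_eval G f (c - d) = (\<Oplus>p\<in>?K. [(Poly_Mapping.lookup c p - Poly_Mapping.lookup d p)] \<cdot> f p)"
    using frag_eval_superset[OF K keys_diff f] by (simp add: lookup_minus)
  also have "\<dots> = (\<Oplus>p\<in>?K. ([Poly_Mapping.lookup c p] \<cdot> f p) \<ominus> ([Poly_Mapping.lookup d p] \<cdot> f p))"
    using f by (intro finsum_cong') (auto simp: add_int_pow_diff Pi_iff)
  also have "\<dots> = frag_eval G f c \<ominus> frag_eval G f d"
    using f frag_eval_superset[OF K _ f, of c] frag_eval_superset[OF K _ f, of d]
    by (subst finsum_minus) (auto simp: Pi_iff)
  finally show ?thesis .
qed

lemma frag_eval_add:
  assumes "keys c \<subseteq> S" "keys d \<subseteq> S" "f \<in> S \<rightarrow> carrier G"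
  shows "frag_eval G f (c + d) = frag_eval G f c \<oplus> frag_eval G f d"
proof -
  have "frag_eval G f (c + d) = frag_eval G f (c - (0 - d))" by simp
  also have "\<dots> = frag_eval G f c \<ominus> (\<zero> \<ominus> frag_eval G f d)"
    using assms keys_diff_subset[of 0 S d]
    by (simp add: frag_eval_diff[where S = S] del: diff_0)
  finally show ?thesis
    using frag_eval_closed[OF assms(1,3)] frag_eval_closed[OF assms(2,3)]
    by (simp add: a_minus_def)
qed

lemma frag_eval_sum:
  assumes "\<And>j. j \<in> J \<Longrightarrow> keys (c j) \<subseteq> S" "f \<in> S \<rightarrow> carrier G" "finite J"
  shows "frag_eval G f (\<Sum>j\<in>J. c j) = (\<Oplus>j\<in>J. frag_eval G f (c j))"
  using assms(3,1)
proof (induction J rule: finite_induct)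
  case (insert j J)
  then show ?case
    using assms(2) frag_eval_closed[of _ S f]
    by (simp add: frag_eval_add[where S = S] keys_sum_subset finsum_insert Pi_iff)
qed simp

lemma frag_eval_cong:
  "(\<And>p. p \<in> keys c \<Longrightarrow> f p = g p) \<Longrightarrow> g \<in> keys c \<rightarrow> carrier G \<Longrightarrow>
    frag_eval G f c = frag_eval G g c"
  unfolding frag_eval_def by (intro finsum_cong') (auto simp: Pi_iff)

lemma frag_eval_unique:
  assumes c: "keys c \<subseteq> S" and f: "f \<in> S \<rightarrow> carrier G"
    and "F 0 = \<zero>" and "\<And>p. p \<in> S \<Longrightarrow> F (frag_of p) = f p"
    and "\<And>c d. keys c \<subseteq> S \<Longrightarrow> keys d \<subseteq> S \<Longrightarrow> F (c - d) = F c \<ominus> F d"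
  shows "F c = frag_eval G f c"
  using c
proof (induction c rule: free_Abelian_group_induct[consumes 1, case_names zero diff one])
  case (diff x y)
  then show ?case using assms by (simp add: frag_eval_diff[where S = S])
next
  case (one p)
  then show ?case using assms(4)[of p] f by (simp add: frag_eval_of Pi_iff)
qed (use assms in auto)

lemma frag_eval_extend:
  assumes "keys c \<subseteq> S" "\<And>p. p \<in> S \<Longrightarrow> keys (g p) \<subseteq> T" "f \<in> T \<rightarrow> carrier G"
  shows "frag_eval G f (frag_extend g c) = frag_eval G (\<lambda>p. frag_eval G f (g p)) c"
  by (rule frag_eval_unique[where S = S])
    (use assms in \<open>simp_all add: frag_extend_diff frag_eval_diff[where S = T] Pi_iff
      frag_eval_closed[where S = T] keys_extend_subset[where S = S]\<close>)

lemma frag_eval_map: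
  assumes "keys c \<subseteq> S" "g \<in> S \<rightarrow> T" "f \<in> T \<rightarrow> carrier G"
  shows "frag_eval G f (frag_map g c) = frag_eval G (\<lambda>p. f (g p)) c"
  by (rule frag_eval_unique[where S = S])
    (use assms in \<open>simp_all add: frag_map_diff Pi_iff frag_eval_diff[where S = T]
      frag_eval_of keys_map_subset[where S = S and T = T]\<close>)

end

lemma hom_frag_eval:
  assumes X: "abelian_group X" and Y: "abelian_group Y"
    and F: "\<And>x. x \<in> carrier X \<Longrightarrow> F x \<in> carrier Y"
    and add: "\<And>x y. x \<in> carrier X \<Longrightarrow> y \<in> carrier X \<Longrightarrow> F (x \<oplus>\<^bsub>X\<^esub> y) = F x \<oplus>\<^bsub>Y\<^esub> F y"
    and c: "keys c \<subseteq> S" and f: "f \<in> S \<rightarrow> carrier X"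
  shows "F (frag_eval X f c) = frag_eval Y (\<lambda>p. F (f p)) c"
proof -
  interpret X: additive_group X using X by (rule additive_group.intro)
  interpret Y: additive_group Y using Y by (rule additive_group.intro)
  interpret F: group_hom "add_monoid X" "add_monoid Y" F
    by unfold_locales (use F add in \<open>auto simp: hom_def\<close>)
  have inv: "F (\<ominus>\<^bsub>X\<^esub> x) = \<ominus>\<^bsub>Y\<^esub> F x" if "x \<in> carrier X" for x
    using F.hom_inv[of x] that by (simp add: a_inv_def)
  show ?thesis
  proof (rule Y.frag_eval_unique[where S = S])
    show "F (frag_eval X f 0) = \<zero>\<^bsub>Y\<^esub>" using F.hom_one by simp
  qed (use assms in \<open>auto simp: X.frag_eval_diff[where S = S] a_minus_def inv Pi_iff X.frag_eval_of
      X.frag_eval_closed[where S = S]\<close>)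
qed

section \<open>Quotients of groups of formal sums\<close>

locale frag_quotient =
  fixes S :: "'p set" and gens :: "('p \<Rightarrow>\<^sub>0 int) set"
  assumes gens: "\<And>g. g \<in> gens \<Longrightarrow> keys g \<subseteq> S"
begin

lemma gens_carrier: "gens \<subseteq> carrier (free_Abelian_group S)"
  using gens by auto

definition "rel = generate (free_Abelian_group S) gens"

lemma rel_keys: "c \<in> rel \<Longrightarrow> keys c \<subseteq> S"
  using group.generate_incl[OF group_free_Abelian_group gens_carrier]
  unfolding rel_def carrier_free_Abelian_group_iff[symmetric] by (rule subsetD)

lemma rel_0 [simp]: "0 \<in> rel"
  unfolding rel_def using generate.one[of "free_Abelian_group S" gens] by simp

lemma rel_gens: "g \<in> gens \<Longrightarrow> g \<in> rel"
  unfolding rel_def by (rule generate.incl)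

lemma rel_add: "c \<in> rel \<Longrightarrow> d \<in> rel \<Longrightarrow> c + d \<in> rel"
  unfolding rel_def using generate.eng[of c "free_Abelian_group S" gens d] by simp

lemma rel_uminus: "c \<in> rel \<Longrightarrow> - c \<in> rel"
  using group.generate_m_inv_closed[OF group_free_Abelian_group gens_carrier, of c]
    inv_free_Abelian_group[OF rel_keys, of c] unfolding rel_def by simp

lemma rel_diff: "c \<in> rel \<Longrightarrow> d \<in> rel \<Longrightarrow> c - d \<in> rel"
  using rel_add[OF _ rel_uminus] by (metis diff_conv_add_uminus)

lemma rel_sum: "(\<And>j. j \<in> J \<Longrightarrow> c j \<in> rel) \<Longrightarrow> sum c J \<in> rel"
  by (induction J rule: infinite_finite_induct) (auto intro: rel_add)

lemma rel_induct [consumes 1, case_names gen zero diff]: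
  assumes "c \<in> rel" and "\<And>g. g \<in> gens \<Longrightarrow> P g" and "P 0"
    and "\<And>c d. c \<in> rel \<Longrightarrow> d \<in> rel \<Longrightarrow> P c \<Longrightarrow> P d \<Longrightarrow> P (c - d)"
  shows "P c"
proof -
  have inv: "P (- d)" if "d \<in> rel" "P d" for d
    using assms(4)[of 0 d] that assms(3) by simp
  have "c \<in> generate (free_Abelian_group S) gens" using assms(1) by (simp add: rel_def)
  then show ?thesis
  proof induction
    case (inv g)
    then show ?case using assms(2) gens rel_gens \<open>\<And>d. d \<in> rel \<Longrightarrow> P d \<Longrightarrow> P (- d)\<close> by simp
  next
    case (eng c d)
    then have "P (c - (- d))"
      using assms(4)[of c "- d"] inv[of d] rel_uminus[of d] by (simp add: rel_def)
    then show ?case by simp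
  qed (use assms in auto)
qed

abbreviation "coset c \<equiv> rel #>\<^bsub>free_Abelian_group S\<^esub> c"

lemma rel_coset_eq_iff: "coset c = coset d \<longleftrightarrow> c - d \<in> rel"
proof
  assume "coset c = coset d"
  then have "0 + c \<in> coset d"
    unfolding r_coset_def by (metis (no_types, lifting) UN_iff mult_free_Abelian_group rel_0 singletonI)
  then show "c - d \<in> rel" by (auto simp: r_coset_def)
next
  assume *: "c - d \<in> rel"
  have "z + c \<in> coset d" if "z \<in> rel" for z
    using rel_add[OF that *] by (auto simp: r_coset_def intro!: bexI[of _ "z + (c - d)"])
  moreover have "z + d \<in> coset c" if "z \<in> rel" for z
    using rel_diff[OF that *] by (auto simp: r_coset_def intro!: bexI[of _ "z - (c - d)"])
  ultimately show "coset c = coset d"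
    by (auto simp: r_coset_def)
qed

lemma mem_rel_coset_iff: "d \<in> coset c \<longleftrightarrow> d - c \<in> rel"
  by (auto simp: r_coset_def intro!: bexI[of _ "d - c"])

lemma rel_subgroup: "subgroup rel (free_Abelian_group S)"
  unfolding rel_def using gens by (intro group.generate_is_subgroup) auto

lemma rel_eval_0:
  assumes X: "abelian_group X" and f: "f \<in> S \<rightarrow> carrier X"
    and "\<And>g. g \<in> gens \<Longrightarrow> frag_eval X f g = \<zero>\<^bsub>X\<^esub>" and "c \<in> rel"
  shows "frag_eval X f c = \<zero>\<^bsub>X\<^esub>"
proof -
  interpret additive_group X using X by (rule additive_group.intro)
  show ?thesis
    using assms(4)
  proof (induction rule: rel_induct)
    case (diff c d)
    then show ?case
      using f by (simp add: frag_eval_diff[where S = S] rel_keys a_minus_def)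
  qed (use assms in auto)
qed

end

lemma rel_frag_map:
  assumes "frag_quotient S gens" "frag_quotient T gens'"
    and "\<And>g. g \<in> gens \<Longrightarrow> frag_map f g \<in> frag_quotient.rel T gens'"
    and "c \<in> frag_quotient.rel S gens"
  shows "frag_map f c \<in> frag_quotient.rel T gens'"
proof -
  interpret S: frag_quotient S gens by fact
  interpret T: frag_quotient T gens' by fact
  show ?thesis using assms(4)
    by (induction rule: S.rel_induct) (auto simp: assms(3) frag_map_diff T.rel_diff)
qed

lemma (in frag_quotient) additive_mod_rel:
  assumes X: "abelian_group X"
    and add: "\<And>x y. x \<in> carrier X \<Longrightarrow> y \<in> carrier X \<Longrightarrow> \<phi> (x \<oplus>\<^bsub>X\<^esub> y) - \<phi> x - \<phi> y \<in> rel"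
  shows additive_zero: "\<phi> \<zero>\<^bsub>X\<^esub> \<in> rel"
    and additive_diff: "x \<in> carrier X \<Longrightarrow> y \<in> carrier X \<Longrightarrow> \<phi> (x \<ominus>\<^bsub>X\<^esub> y) - (\<phi> x - \<phi> y) \<in> rel"
    and additive_finsum: "f \<in> J \<rightarrow> carrier X \<Longrightarrow> finite J \<Longrightarrow> \<phi> (finsum X f J) - (\<Sum>j\<in>J. \<phi> (f j)) \<in> rel"
    and additive_frag_eval: "keys c \<subseteq> U \<Longrightarrow> g \<in> U \<rightarrow> carrier X \<Longrightarrow>
      \<phi> (frag_eval X g c) - frag_extend (\<lambda>p. \<phi> (g p)) c \<in> rel"
proof -
  interpret additive_group X using X by (rule additive_group.intro)
  show zero: "\<phi> \<zero>\<^bsub>X\<^esub> \<in> rel"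
    using rel_uminus[OF add[of "\<zero>\<^bsub>X\<^esub>" "\<zero>\<^bsub>X\<^esub>"]] by simp
  have diff: "\<phi> (x \<ominus>\<^bsub>X\<^esub> y) - (\<phi> x - \<phi> y) \<in> rel" if "x \<in> carrier X" "y \<in> carrier X" for x y
  proof -
    have "x \<ominus>\<^bsub>X\<^esub> y \<oplus>\<^bsub>X\<^esub> y = x" using that by (simp add: a_minus_def a_assoc l_neg)
    then show ?thesis
      using rel_uminus[OF add[of "x \<ominus>\<^bsub>X\<^esub> y" y]] that by (simp add: algebra_simps)
  qed
  then show "x \<in> carrier X \<Longrightarrow> y \<in> carrier X \<Longrightarrow> \<phi> (x \<ominus>\<^bsub>X\<^esub> y) - (\<phi> x - \<phi> y) \<in> rel" for x y .
  show "\<phi> (finsum X f J) - (\<Sum>j\<in>J. \<phi> (f j)) \<in> rel" if "finite J" "f \<in> J \<rightarrow> carrier X" for f J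
    using that
  proof (induction J rule: finite_induct)
    case empty
    then show ?case using zero by simp
  next
    case (insert j J)
    then show ?case
      using rel_add[OF add[of "f j" "finsum X f J"] insert.IH]
      by (simp add: Pi_iff finsum_closed algebra_simps)
  qed
  show "\<phi> (frag_eval X g c) - frag_extend (\<lambda>p. \<phi> (g p)) c \<in> rel"
    if "keys c \<subseteq> U" "g \<in> U \<rightarrow> carrier X" for c U g
    using that(1)
  proof (induction c rule: free_Abelian_group_induct[consumes 1, case_names zero diff one])
    case zero
    then show ?case using \<open>\<phi> \<zero>\<^bsub>X\<^esub> \<in> rel\<close> by simp
  next
    case (diff c d)
    have "\<phi> (frag_eval X g c \<ominus>\<^bsub>X\<^esub> frag_eval X g d) - (\<phi> (frag_eval X g c) - \<phi> (frag_eval X g d)) \<in> rel"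
      using diff that(2) frag_eval_closed[of _ U g]
      by (intro \<open>\<And>x y. x \<in> carrier X \<Longrightarrow> y \<in> carrier X \<Longrightarrow> \<phi> (x \<ominus>\<^bsub>X\<^esub> y) - (\<phi> x - \<phi> y) \<in> rel\<close>) auto
    from rel_add[OF this rel_diff[OF diff(3,4)]] show ?case
      using diff that(2) by (simp add: frag_eval_diff[where S = U] frag_extend_diff algebra_simps)
  next
    case (one p)
    then show ?case using that(2) by (simp add: frag_eval_of Pi_iff)
  qed
qed

section \<open>Tensor powers of a bimodule\<close>

locale bimod =
  fixes V :: "('k, 'x) bimod"
  assumes bimodule: "bimodule V"
begin

abbreviation "K \<equiv> bm_scal V"
abbreviation "X \<equiv> bm_grp V"

lemma abelian: "abelian_group X"
  and bm_closed:
    "k \<in> carrier K \<Longrightarrow> x \<in> carrier X \<Longrightarrow> bm_l V k x \<in> carrier X"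
    "k \<in> carrier K \<Longrightarrow> x \<in> carrier X \<Longrightarrow> bm_r V x k \<in> carrier X"
  using bimodule by (auto simp: bimodule_def Let_def)

sublocale additive_group X
  using abelian by (rule additive_group.intro)

sublocale T2: frag_quotient "carrier X \<times> carrier X" "tensor_gens V"
proof
  fix g assume "g \<in> tensor_gens V"
  then show "keys g \<subseteq> carrier X \<times> carrier X"
    unfolding tensor_gens_def Let_def
    by (elim UnE CollectE exE conjE; simp only:; intro keys_diff_subset; simp add: bm_closed)
qed

sublocale T3: frag_quotient "carrier X \<times> carrier X \<times> carrier X" "tensor3_gens V"
proof
  fix g assume "g \<in> tensor3_gens V"
  then show "keys g \<subseteq> carrier X \<times> carrier X \<times> carrier X"
    unfolding tensor3_gens_def Let_def
    by (elim UnE CollectE exE conjE; simp only:; intro keys_diff_subset; simp add: bm_closed)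
qed

lemma tensor_class_eq_iff: "tensor_class V c = tensor_class V d \<longleftrightarrow> c - d \<in> T2.rel"
  and mem_tensor_class_iff: "d \<in> tensor_class V c \<longleftrightarrow> d - c \<in> T2.rel"
  using T2.rel_coset_eq_iff T2.mem_rel_coset_iff
  by (simp_all add: tensor_class_def pair_group_def T2.rel_def)

lemma tensor3_class_eq_iff: "tensor3_class V c = tensor3_class V d \<longleftrightarrow> c - d \<in> T3.rel"
  using T3.rel_coset_eq_iff by (simp add: tensor3_class_def triple_group_def T3.rel_def)

lemma carrier_tensor:
  "carrier (tensor V) = {tensor_class V c |c. keys c \<subseteq> carrier X \<times> carrier X}"
  by (auto simp: tensor_def FactGroup_def RCOSETS_def tensor_class_def pair_group_def)

lemma rel_normal: "T2.rel \<lhd> pair_group V"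
  unfolding pair_group_def
  by (intro comm_group.subgroup_imp_normal abelian_free_Abelian_group T2.rel_subgroup)

lemma tensor_mult:
  assumes "keys c \<subseteq> carrier X \<times> carrier X" "keys d \<subseteq> carrier X \<times> carrier X"
  shows "tensor_class V c \<otimes>\<^bsub>tensor V\<^esub> tensor_class V d = tensor_class V (c + d)"
  using normal.rcos_sum[OF rel_normal, of c d] assms
  by (simp add: tensor_def FactGroup_def tensor_class_def pair_group_def T2.rel_def)

lemma tensor_one: "\<one>\<^bsub>tensor V\<^esub> = tensor_class V 0"
proof -
  have "\<one>\<^bsub>tensor V\<^esub> = T2.rel" by (simp add: tensor_def FactGroup_def T2.rel_def pair_group_def)
  also have "\<dots> = tensor_class V 0" by (auto simp: mem_tensor_class_iff)
  finally show ?thesis .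
qed

lemma comm_group_tensor: "comm_group (tensor V)"
  unfolding tensor_def
  using comm_group.abelian_FactGroup[OF abelian_free_Abelian_group T2.rel_subgroup]
  by (simp add: pair_group_def T2.rel_def)

lemma tensor_finprod:
  assumes "\<And>j. j \<in> J \<Longrightarrow> keys (c j) \<subseteq> carrier X \<times> carrier X" "finite J"
  shows "finprod (tensor V) (\<lambda>j. tensor_class V (c j)) J = tensor_class V (\<Sum>j\<in>J. c j)"
  using assms(2,1)
proof (induction J rule: finite_induct)
  case empty
  interpret comm_group "tensor V" by (rule comm_group_tensor)
  show ?case by (simp add: tensor_one)
next
  case (insert j J)
  interpret T: comm_group "tensor V" by (rule comm_group_tensor)
  have "(\<lambda>j. tensor_class V (c j)) \<in> insert j J \<rightarrow> carrier (tensor V)"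
    using insert.prems by (auto simp: carrier_tensor)
  with insert show ?case
    by (simp add: T.finprod_insert Pi_iff tensor_mult keys_sum_subset)
qed

lemma rel_add_left: "x \<in> carrier X \<Longrightarrow> x' \<in> carrier X \<Longrightarrow> y \<in> carrier X \<Longrightarrow>
    frag_of (x \<oplus>\<^bsub>X\<^esub> x', y) - frag_of (x, y) - frag_of (x', y) \<in> T2.rel"
  and rel_add_right: "x \<in> carrier X \<Longrightarrow> y \<in> carrier X \<Longrightarrow> y' \<in> carrier X \<Longrightarrow>
    frag_of (x, y \<oplus>\<^bsub>X\<^esub> y') - frag_of (x, y) - frag_of (x, y') \<in> T2.rel"
  and rel_middle: "x \<in> carrier X \<Longrightarrow> k \<in> carrier K \<Longrightarrow> y \<in> carrier X \<Longrightarrow>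
    frag_of (bm_r V x k, y) - frag_of (x, bm_l V k y) \<in> T2.rel"
  by (rule T2.rel_gens, simp only: tensor_gens_def Let_def, blast)+

lemma rel3_add_1: "x \<in> carrier X \<Longrightarrow> x' \<in> carrier X \<Longrightarrow> y \<in> carrier X \<Longrightarrow> z \<in> carrier X \<Longrightarrow>
    frag_of (x \<oplus>\<^bsub>X\<^esub> x', y, z) - frag_of (x, y, z) - frag_of (x', y, z) \<in> T3.rel"
  and rel3_add_2: "x \<in> carrier X \<Longrightarrow> y \<in> carrier X \<Longrightarrow> y' \<in> carrier X \<Longrightarrow> z \<in> carrier X \<Longrightarrow>
    frag_of (x, y \<oplus>\<^bsub>X\<^esub> y', z) - frag_of (x, y, z) - frag_of (x, y', z) \<in> T3.rel"
  and rel3_add_3: "x \<in> carrier X \<Longrightarrow> y \<in> carrier X \<Longrightarrow> z \<in> carrier X \<Longrightarrow> z' \<in> carrier X \<Longrightarrow>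
    frag_of (x, y, z \<oplus>\<^bsub>X\<^esub> z') - frag_of (x, y, z) - frag_of (x, y, z') \<in> T3.rel"
  and rel3_middle_1: "x \<in> carrier X \<Longrightarrow> k \<in> carrier K \<Longrightarrow> y \<in> carrier X \<Longrightarrow> z \<in> carrier X \<Longrightarrow>
    frag_of (bm_r V x k, y, z) - frag_of (x, bm_l V k y, z) \<in> T3.rel"
  and rel3_middle_2: "x \<in> carrier X \<Longrightarrow> k \<in> carrier K \<Longrightarrow> y \<in> carrier X \<Longrightarrow> z \<in> carrier X \<Longrightarrow>
    frag_of (x, bm_r V y k, z) - frag_of (x, y, bm_l V k z) \<in> T3.rel"
  by (rule T3.rel_gens, simp only: tensor3_gens_def Let_def, blast)+

lemma tensor_gens_elim [consumes 1, case_names add_left add_right middle]: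
  assumes "g \<in> tensor_gens V"
    and "\<And>x x' y. x \<in> carrier X \<Longrightarrow> x' \<in> carrier X \<Longrightarrow> y \<in> carrier X \<Longrightarrow>
      P (frag_of (x \<oplus>\<^bsub>X\<^esub> x', y) - frag_of (x, y) - frag_of (x', y))"
    and "\<And>x y y'. x \<in> carrier X \<Longrightarrow> y \<in> carrier X \<Longrightarrow> y' \<in> carrier X \<Longrightarrow>
      P (frag_of (x, y \<oplus>\<^bsub>X\<^esub> y') - frag_of (x, y) - frag_of (x, y'))"
    and "\<And>x k y. x \<in> carrier X \<Longrightarrow> k \<in> carrier K \<Longrightarrow> y \<in> carrier X \<Longrightarrow>
      P (frag_of (bm_r V x k, y) - frag_of (x, bm_l V k y))"
  shows "P g"
  using assms(1) unfolding tensor_gens_def Let_def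
  by (elim UnE CollectE exE conjE; simp only: assms(2-))

lemma tensor3_gens_elim [consumes 1, case_names add_1 add_2 add_3 middle_1 middle_2]:
  assumes "g \<in> tensor3_gens V"
    and "\<And>x x' y z. x \<in> carrier X \<Longrightarrow> x' \<in> carrier X \<Longrightarrow> y \<in> carrier X \<Longrightarrow> z \<in> carrier X \<Longrightarrow>
      P (frag_of (x \<oplus>\<^bsub>X\<^esub> x', y, z) - frag_of (x, y, z) - frag_of (x', y, z))"
    and "\<And>x y y' z. x \<in> carrier X \<Longrightarrow> y \<in> carrier X \<Longrightarrow> y' \<in> carrier X \<Longrightarrow> z \<in> carrier X \<Longrightarrow>
      P (frag_of (x, y \<oplus>\<^bsub>X\<^esub> y', z) - frag_of (x, y, z) - frag_of (x, y', z))"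
    and "\<And>x y z z'. x \<in> carrier X \<Longrightarrow> y \<in> carrier X \<Longrightarrow> z \<in> carrier X \<Longrightarrow> z' \<in> carrier X \<Longrightarrow>
      P (frag_of (x, y, z \<oplus>\<^bsub>X\<^esub> z') - frag_of (x, y, z) - frag_of (x, y, z'))"
    and "\<And>x k y z. x \<in> carrier X \<Longrightarrow> k \<in> carrier K \<Longrightarrow> y \<in> carrier X \<Longrightarrow> z \<in> carrier X \<Longrightarrow>
      P (frag_of (bm_r V x k, y, z) - frag_of (x, bm_l V k y, z))"
    and "\<And>x k y z. x \<in> carrier X \<Longrightarrow> k \<in> carrier K \<Longrightarrow> y \<in> carrier X \<Longrightarrow> z \<in> carrier X \<Longrightarrow>
      P (frag_of (x, bm_r V y k, z) - frag_of (x, y, bm_l V k z))"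
  shows "P g"
  using assms(1) unfolding tensor3_gens_def Let_def
  by (elim UnE CollectE exE conjE; simp only: assms(2-))

end

lemma induced_map_tensor_class:
  assumes "bimod V" "bimod W"
    and resp: "\<And>g. g \<in> tensor_gens V \<Longrightarrow> tensor_class W (frag_map f g) = tensor_class W 0"
  shows "induced_map W f (tensor_class V c) = tensor_class W (frag_map f c)"
proof -
  interpret V: bimod V by fact
  interpret W: bimod W by fact
  have rel: "frag_map f d \<in> W.T2.rel" if "d \<in> V.T2.rel" for d
  proof (rule rel_frag_map[OF V.T2.frag_quotient_axioms W.T2.frag_quotient_axioms _ that])
    show "frag_map f g \<in> W.T2.rel" if "g \<in> tensor_gens V" for g
      using resp[OF that] W.tensor_class_eq_iff[of "frag_map f g" 0] by simp
  qed
  have "tensor_class W (frag_map f d) = tensor_class W (frag_map f c)" if "d \<in> tensor_class V c" for d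
    using rel[of "d - c"] that
    by (simp add: W.tensor_class_eq_iff V.mem_tensor_class_iff frag_map_diff)
  moreover have "c \<in> tensor_class V c" by (simp add: V.mem_tensor_class_iff)
  ultimately show ?thesis unfolding induced_map_def by blast
qed

lemma induced_map_hom:
  assumes "bimod V" "bimod W"
    and resp: "\<And>g. g \<in> tensor_gens V \<Longrightarrow> tensor_class W (frag_map f g) = tensor_class W 0"
    and f: "f \<in> carrier (bm_grp V) \<times> carrier (bm_grp V) \<rightarrow> carrier (bm_grp W) \<times> carrier (bm_grp W)"
  shows "induced_map W f \<in> hom (tensor V) (tensor W)"
proof -
  interpret V: bimod V by fact
  interpret W: bimod W by fact
  note cls = induced_map_tensor_class[OF assms(1,2) resp]
  have keys: "keys (frag_map f c) \<subseteq> carrier (bm_grp W) \<times> carrier (bm_grp W)"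
    if "keys c \<subseteq> carrier (bm_grp V) \<times> carrier (bm_grp V)" for c
    using that f by (rule keys_map_subset)
  show ?thesis
  proof (rule homI)
    fix T assume "T \<in> carrier (tensor V)"
    then obtain c where c: "T = tensor_class V c"
        "keys c \<subseteq> carrier (bm_grp V) \<times> carrier (bm_grp V)"
      unfolding V.carrier_tensor by blast
    then show "induced_map W f T \<in> carrier (tensor W)"
      using cls keys unfolding W.carrier_tensor by blast
    fix U assume "U \<in> carrier (tensor V)"
    then obtain d where d: "U = tensor_class V d"
        "keys d \<subseteq> carrier (bm_grp V) \<times> carrier (bm_grp V)"
      unfolding V.carrier_tensor by blast
    show "induced_map W f (T \<otimes>\<^bsub>tensor V\<^esub> U) = induced_map W f T \<otimes>\<^bsub>tensor W\<^esub> induced_map W f U"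
      using c d keys[of c] keys[of d] by (simp add: V.tensor_mult W.tensor_mult cls frag_map_add)
  qed
qed

lemma op_ring_simps [simp]:
  "carrier (op_ring A) = carrier A" "\<one>\<^bsub>op_ring A\<^esub> = \<one>\<^bsub>A\<^esub>" "\<zero>\<^bsub>op_ring A\<^esub> = \<zero>\<^bsub>A\<^esub>"
  "x \<oplus>\<^bsub>op_ring A\<^esub> y = x \<oplus>\<^bsub>A\<^esub> y" "x \<otimes>\<^bsub>op_ring A\<^esub> y = y \<otimes>\<^bsub>A\<^esub> x"
  by (simp_all add: op_ring_def)

lemma op_ring_op_ring [simp]: "op_ring (op_ring A) = A"
  by (simp add: op_ring_def)

lemma ring_op_ring:
  assumes "ring A" shows "ring (op_ring A)"
proof -
  interpret ring A by fact
  show ?thesis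
  proof (rule ringI)
    show "abelian_group (op_ring A)"
      using abelian_group_axioms
      unfolding abelian_group_def abelian_monoid_def abelian_group_axioms_def by (simp add: op_ring_def)
    show "Group.monoid (op_ring A)"
      by (rule monoidI) (simp_all add: m_assoc)
  qed (simp_all add: l_distr r_distr)
qed

lemma bimod_left_bimod:
  assumes "ring A" "ring K" "s \<in> ring_hom K A" "t \<in> ring_hom (op_ring K) A"
    and comm: "\<And>k k'. k \<in> carrier K \<Longrightarrow> k' \<in> carrier K \<Longrightarrow> s k \<otimes>\<^bsub>A\<^esub> t k' = t k' \<otimes>\<^bsub>A\<^esub> s k"
  shows "bimod (left_bimod A K s t)"
proof -
  interpret A: ring A by fact
  note s = ring_hom_memE[OF assms(3)] and t = ring_hom_memE[OF assms(4), unfolded op_ring_simps]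
  have "t k' \<otimes>\<^bsub>A\<^esub> (s k \<otimes>\<^bsub>A\<^esub> x) = s k \<otimes>\<^bsub>A\<^esub> (t k' \<otimes>\<^bsub>A\<^esub> x)"
    if "k \<in> carrier K" "k' \<in> carrier K" "x \<in> carrier A" for k k' x
    using comm[OF that(1,2)] A.m_assoc[of "t k'" "s k" x] A.m_assoc[of "s k" "t k'" x]
      s(1)[OF that(1)] t(1)[OF that(2)] that(3) by simp
  then have "bimodule (left_bimod A K s t)"
    unfolding bimodule_def left_bimod_def Let_def bimod.simps
    using assms(2) A.abelian_group_axioms s t
    by (intro conjI ballI; simp add: A.m_assoc A.l_distr A.r_distr)
  then show ?thesis by (rule bimod.intro)
qed

lemma bimod_right_bimod:
  assumes "ring A" "ring K" "s \<in> ring_hom K A" "t \<in> ring_hom (op_ring K) A"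
    and comm: "\<And>k k'. k \<in> carrier K \<Longrightarrow> k' \<in> carrier K \<Longrightarrow> s k \<otimes>\<^bsub>A\<^esub> t k' = t k' \<otimes>\<^bsub>A\<^esub> s k"
  shows "bimod (right_bimod A K s t)"
proof -
  interpret A: ring A by fact
  note s = ring_hom_memE[OF assms(3)] and t = ring_hom_memE[OF assms(4), unfolded op_ring_simps]
  have "bimodule (right_bimod A K s t)"
    unfolding bimodule_def right_bimod_def Let_def bimod.simps
    using assms(2) A.abelian_group_axioms s t comm
    by (intro conjI ballI; simp add: A.m_assoc A.l_distr A.r_distr)
  then show ?thesis by (rule bimod.intro)
qed

section \<open>Frobenius extensions\<close>

locale frobenius_extension =
  fixes N :: "'n ring" and M :: "'m ring" (structure) and h :: "'n \<Rightarrow> 'm" and \<psi> :: "'m \<Rightarrow> 'n"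
    and I :: "'i set" and u v :: "'i \<Rightarrow> 'm"
  assumes ring_N: "ring N" and ring_M: "ring M" and hom_h: "h \<in> ring_hom N M"
    and frobenius: "frobenius_system N M h \<psi> I u v"
begin

sublocale N: ring N by (rule ring_N)
sublocale ring M by (rule ring_M)
sublocale additive_group M by (intro additive_group.intro is_abelian_group)

abbreviation "A \<equiv> end_ring N M h"
abbreviation "L \<equiv> centralizer_ring N M h"
abbreviation "E m \<equiv> h (\<psi> m)"

lemmas h_closed [simp] = ring_hom_closed[OF hom_h]
lemmas h_simps = ring_hom_mult[OF hom_h] ring_hom_add[OF hom_h] ring_hom_one[OF hom_h]

lemma psi_closed [simp]: "m \<in> carrier M \<Longrightarrow> \<psi> m \<in> carrier N"
  and psi_add: "m \<in> carrier M \<Longrightarrow> m' \<in> carrier M \<Longrightarrow> \<psi> (m \<oplus> m') = \<psi> m \<oplus>\<^bsub>N\<^esub> \<psi> m'"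
  and psi_left: "n \<in> carrier N \<Longrightarrow> m \<in> carrier M \<Longrightarrow> \<psi> (h n \<otimes> m) = n \<otimes>\<^bsub>N\<^esub> \<psi> m"
  and psi_right: "n \<in> carrier N \<Longrightarrow> m \<in> carrier M \<Longrightarrow> \<psi> (m \<otimes> h n) = \<psi> m \<otimes>\<^bsub>N\<^esub> n"
  using frobenius
  by (auto simp: frobenius_system_def bimod_homs_def ext_bimod_def regular_bimod_def hom_def)

lemma finite_I [simp]: "finite I"
  and u_closed [simp]: "i \<in> I \<Longrightarrow> u i \<in> carrier M"
  and v_closed [simp]: "i \<in> I \<Longrightarrow> v i \<in> carrier M"
  and quasibasis_left: "m \<in> carrier M \<Longrightarrow> (\<Oplus>i\<in>I. E (m \<otimes> u i) \<otimes> v i) = m"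
  and quasibasis_right: "m \<in> carrier M \<Longrightarrow> (\<Oplus>i\<in>I. u i \<otimes> E (v i \<otimes> m)) = m"
  using frobenius by (auto simp: frobenius_system_def)

lemma E_add: "m \<in> carrier M \<Longrightarrow> m' \<in> carrier M \<Longrightarrow> E (m \<oplus> m') = E m \<oplus> E m'"
  and E_left: "n \<in> carrier N \<Longrightarrow> m \<in> carrier M \<Longrightarrow> E (h n \<otimes> m) = h n \<otimes> E m"
  and E_right: "n \<in> carrier N \<Longrightarrow> m \<in> carrier M \<Longrightarrow> E (m \<otimes> h n) = E m \<otimes> h n"
  by (simp_all add: psi_add psi_left psi_right h_simps)

lemma additive_finsum_map:
  assumes F: "\<And>x. x \<in> carrier M \<Longrightarrow> F x \<in> carrier M"
    and add: "\<And>x y. x \<in> carrier M \<Longrightarrow> y \<in> carrier M \<Longrightarrow> F (x \<oplus> y) = F x \<oplus> F y"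
    and f: "\<And>j. j \<in> J \<Longrightarrow> f j \<in> carrier M" and J: "finite J"
  shows "F (\<Oplus>j\<in>J. f j) = (\<Oplus>j\<in>J. F (f j))"
proof -
  have "F \<zero> \<oplus> F \<zero> = F \<zero> \<oplus> \<zero>" using add[of \<zero> \<zero>] F[of \<zero>] by simp
  then have zero: "F \<zero> = \<zero>" using F[of \<zero>] by (simp add: add.l_cancel_one')
  show ?thesis
    using J f by (induction J rule: finite_induct) (simp_all add: zero F add Pi_iff finsum_closed)
qed

lemmas hom_eval_M = hom_frag_eval[OF is_abelian_group is_abelian_group]

lemmas E_finsum = additive_finsum_map[of E, OF _ E_add]

lemma E_nondeg_right:
  assumes "x \<in> carrier M" "y \<in> carrier M" "\<And>w. w \<in> carrier M \<Longrightarrow> E (w \<otimes> x) = E (w \<otimes> y)"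
  shows "x = y"
proof -
  have "(\<Oplus>i\<in>I. u i \<otimes> E (v i \<otimes> x)) = (\<Oplus>i\<in>I. u i \<otimes> E (v i \<otimes> y))"
    using assms by (intro finsum_cong') auto
  with assms(1,2) show ?thesis by (simp add: quasibasis_right)
qed

lemma E_nondeg_left:
  assumes "x \<in> carrier M" "y \<in> carrier M" "\<And>w. w \<in> carrier M \<Longrightarrow> E (x \<otimes> w) = E (y \<otimes> w)"
  shows "x = y"
proof -
  have "(\<Oplus>i\<in>I. E (x \<otimes> u i) \<otimes> v i) = (\<Oplus>i\<in>I. E (y \<otimes> u i) \<otimes> v i)"
    using assms by (intro finsum_cong') auto
  with assms(1,2) show ?thesis by (simp add: quasibasis_left)
qed

lemma finsum_swap:
  assumes "finite J" "finite J'" "\<And>i j. i \<in> J \<Longrightarrow> j \<in> J' \<Longrightarrow> f i j \<in> carrier M"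
  shows "(\<Oplus>i\<in>J. \<Oplus>j\<in>J'. f i j) = (\<Oplus>j\<in>J'. \<Oplus>i\<in>J. f i j)"
  using assms(1,3)
proof (induction J rule: finite_induct)
  case (insert i J)
  have "(\<Oplus>i'\<in>insert i J. \<Oplus>j\<in>J'. f i' j) = (\<Oplus>j\<in>J'. f i j) \<oplus> (\<Oplus>j\<in>J'. \<Oplus>i\<in>J. f i j)"
    using insert by (simp add: Pi_iff finsum_closed)
  also have "\<dots> = (\<Oplus>j\<in>J'. f i j \<oplus> (\<Oplus>i\<in>J. f i j))"
    using insert.prems by (intro finsum_addf[symmetric]) (simp_all add: Pi_iff finsum_closed)
  also have "\<dots> = (\<Oplus>j\<in>J'. \<Oplus>i'\<in>insert i J. f i' j)"
    using insert by (intro finsum_cong') (simp_all add: Pi_iff finsum_closed)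
  finally show ?case .
qed simp

text \<open>
  The Casimir property of \<open>\<Sum>i. u i \<otimes> v i\<close>: expand \<open>x u\<^sub>i = \<Sum>\<^sub>k u\<^sub>k E(v\<^sub>k x u\<^sub>i)\<close> and move the
  coefficients, which come from \<open>N\<close>, across.
\<close>

lemma quasibasis_central:
  assumes F: "\<And>p q. p \<in> carrier M \<Longrightarrow> q \<in> carrier M \<Longrightarrow> F p q \<in> carrier M"
    and add_left: "\<And>p p' q. p \<in> carrier M \<Longrightarrow> p' \<in> carrier M \<Longrightarrow> q \<in> carrier M \<Longrightarrow>
      F (p \<oplus> p') q = F p q \<oplus> F p' q"
    and add_right: "\<And>p q q'. p \<in> carrier M \<Longrightarrow> q \<in> carrier M \<Longrightarrow> q' \<in> carrier M \<Longrightarrow>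
      F p (q \<oplus> q') = F p q \<oplus> F p q'"
    and bal: "\<And>p n q. p \<in> carrier M \<Longrightarrow> n \<in> carrier N \<Longrightarrow> q \<in> carrier M \<Longrightarrow>
      F (p \<otimes> h n) q = F p (h n \<otimes> q)"
    and x: "x \<in> carrier M"
  shows "(\<Oplus>i\<in>I. F (x \<otimes> u i) (v i)) = (\<Oplus>i\<in>I. F (u i) (v i \<otimes> x))"
proof -
  have "(\<Oplus>i\<in>I. F (x \<otimes> u i) (v i)) = (\<Oplus>i\<in>I. F (\<Oplus>k\<in>I. u k \<otimes> E (v k \<otimes> (x \<otimes> u i))) (v i))"
    using x by (intro finsum_cong') (simp_all add: quasibasis_right Pi_iff F)
  also have "\<dots> = (\<Oplus>i\<in>I. \<Oplus>k\<in>I. F (u k) (E (v k \<otimes> x \<otimes> u i) \<otimes> v i))"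
  proof (rule finsum_cong'; clarsimp?)
    show "F (\<Oplus>k\<in>I. u k \<otimes> E (v k \<otimes> (x \<otimes> u i))) (v i) = (\<Oplus>k\<in>I. F (u k) (E (v k \<otimes> x \<otimes> u i) \<otimes> v i))"
      if i: "i \<in> I" for i
    proof -
      have "F (\<Oplus>k\<in>I. u k \<otimes> E (v k \<otimes> (x \<otimes> u i))) (v i) =
          (\<Oplus>k\<in>I. F (u k \<otimes> E (v k \<otimes> (x \<otimes> u i))) (v i))"
        using i x F add_left
        by (intro additive_finsum_map[where F = "\<lambda>p. F p (v i)"]) simp_all
      also have "\<dots> = (\<Oplus>k\<in>I. F (u k) (E (v k \<otimes> x \<otimes> u i) \<otimes> v i))"
        using i x F bal by (intro finsum_cong') (simp_all add: Pi_iff m_assoc)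
      finally show ?thesis .
    qed
    show "(\<Oplus>k\<in>I. F (u k) (E (v k \<otimes> x \<otimes> u i) \<otimes> v i)) \<in> carrier M" if "i \<in> I" for i
      using that x F by (intro finsum_closed) simp
  qed
  also have "\<dots> = (\<Oplus>k\<in>I. \<Oplus>i\<in>I. F (u k) (E (v k \<otimes> x \<otimes> u i) \<otimes> v i))"
    using x F by (intro finsum_swap) simp_all
  also have "\<dots> = (\<Oplus>k\<in>I. F (u k) (v k \<otimes> x))"
  proof (rule finsum_cong'; clarsimp?)
    show "F (u k) (v k \<otimes> x) \<in> carrier M" if "k \<in> I" for k using that x F by simp
    show "(\<Oplus>i\<in>I. F (u k) (E (v k \<otimes> x \<otimes> u i) \<otimes> v i)) = F (u k) (v k \<otimes> x)" if k: "k \<in> I" for k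
    proof -
      have "(\<Oplus>i\<in>I. F (u k) (E (v k \<otimes> x \<otimes> u i) \<otimes> v i)) =
          F (u k) (\<Oplus>i\<in>I. E (v k \<otimes> x \<otimes> u i) \<otimes> v i)"
        using k x F add_right
        by (intro additive_finsum_map[where F = "F (u k)", symmetric]) simp_all
      with k x show ?thesis by (simp add: quasibasis_left)
    qed
  qed
  finally show ?thesis .
qed

lemma carrier_A: "a \<in> carrier A \<longleftrightarrow> a \<in> extensional (carrier M) \<and> (\<forall>m\<in>carrier M. a m \<in> carrier M) \<and>
    (\<forall>m\<in>carrier M. \<forall>m'\<in>carrier M. a (m \<oplus> m') = a m \<oplus> a m') \<and>
    (\<forall>n\<in>carrier N. \<forall>m\<in>carrier M. a (h n \<otimes> m) = h n \<otimes> a m \<and> a (m \<otimes> h n) = a m \<otimes> h n)"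
  by (auto simp: end_ring_def bimod_homs_def hom_def ext_bimod_def)

lemma A_closed [simp]: "a \<in> carrier A \<Longrightarrow> m \<in> carrier M \<Longrightarrow> a m \<in> carrier M"
  and A_add: "a \<in> carrier A \<Longrightarrow> m \<in> carrier M \<Longrightarrow> m' \<in> carrier M \<Longrightarrow> a (m \<oplus> m') = a m \<oplus> a m'"
  and A_left: "a \<in> carrier A \<Longrightarrow> n \<in> carrier N \<Longrightarrow> m \<in> carrier M \<Longrightarrow> a (h n \<otimes> m) = h n \<otimes> a m"
  and A_right: "a \<in> carrier A \<Longrightarrow> n \<in> carrier N \<Longrightarrow> m \<in> carrier M \<Longrightarrow> a (m \<otimes> h n) = a m \<otimes> h n"
  by (simp_all add: carrier_A)

lemma A_eqI:
  assumes "a \<in> carrier A" "b \<in> carrier A" "\<And>m. m \<in> carrier M \<Longrightarrow> a m = b m" shows "a = b"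
  using assms by (intro extensionalityI[of _ "carrier M"]) (simp_all add: carrier_A)

lemma A_I:
  assumes "\<And>m. m \<in> carrier M \<Longrightarrow> f m \<in> carrier M"
    and "\<And>m m'. m \<in> carrier M \<Longrightarrow> m' \<in> carrier M \<Longrightarrow> f (m \<oplus> m') = f m \<oplus> f m'"
    and "\<And>n m. n \<in> carrier N \<Longrightarrow> m \<in> carrier M \<Longrightarrow> f (h n \<otimes> m) = h n \<otimes> f m"
    and "\<And>n m. n \<in> carrier N \<Longrightarrow> m \<in> carrier M \<Longrightarrow> f (m \<otimes> h n) = f m \<otimes> h n"
  shows "restrict f (carrier M) \<in> carrier A"
  using assms by (simp add: carrier_A)

lemma A_apply [simp]:
  "m \<in> carrier M \<Longrightarrow> (a \<otimes>\<^bsub>A\<^esub> b) m = a (b m)"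
  "m \<in> carrier M \<Longrightarrow> (a \<oplus>\<^bsub>A\<^esub> b) m = a m \<oplus> b m"
  "m \<in> carrier M \<Longrightarrow> \<one>\<^bsub>A\<^esub> m = m"
  "m \<in> carrier M \<Longrightarrow> \<zero>\<^bsub>A\<^esub> m = \<zero>"
  by (simp_all add: end_ring_def compose_def)

lemma ring_A: "ring A"
proof -
  have clos: "a \<otimes>\<^bsub>A\<^esub> b \<in> carrier A" "a \<oplus>\<^bsub>A\<^esub> b \<in> carrier A" if "a \<in> carrier A" "b \<in> carrier A" for a b
  proof -
    have "restrict (\<lambda>m. a (b m)) (carrier M) \<in> carrier A"
      using that by (intro A_I) (simp_all add: A_add A_left A_right)
    then show "a \<otimes>\<^bsub>A\<^esub> b \<in> carrier A" by (simp add: end_ring_def compose_def)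
    have "restrict (\<lambda>m. a m \<oplus> b m) (carrier M) \<in> carrier A"
      using that by (intro A_I) (simp_all add: A_add A_left A_right a_ac l_distr r_distr)
    then show "a \<oplus>\<^bsub>A\<^esub> b \<in> carrier A" by (simp add: end_ring_def)
  qed
  have one: "\<one>\<^bsub>A\<^esub> \<in> carrier A" and zero: "\<zero>\<^bsub>A\<^esub> \<in> carrier A"
    using A_I[of "\<lambda>m. m"] A_I[of "\<lambda>m. \<zero>"] by (simp_all add: end_ring_def)
  show ?thesis
  proof (rule ringI)
    show "abelian_group A"
    proof (rule abelian_groupI)
      fix a assume a: "a \<in> carrier A"
      let ?b = "restrict (\<lambda>m. \<ominus> a m) (carrier M)"
      have "?b \<in> carrier A"
        using a by (intro A_I) (simp_all add: A_add A_left A_right minus_add r_minus l_minus)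
      moreover have "?b \<oplus>\<^bsub>A\<^esub> a = \<zero>\<^bsub>A\<^esub>"
        by (intro A_eqI clos zero a \<open>?b \<in> carrier A\<close>) (use a in \<open>simp add: l_neg\<close>)
      ultimately show "\<exists>b\<in>carrier A. b \<oplus>\<^bsub>A\<^esub> a = \<zero>\<^bsub>A\<^esub>" by blast
    qed ((intro A_eqI clos zero; simp add: a_ac) | (simp add: clos zero))+
    show "Group.monoid A"
      by (rule monoidI) ((intro A_eqI clos one; simp) | (simp add: clos one))+
  qed (intro A_eqI clos; simp add: A_add)+
qed

sublocale A: ring A by (rule ring_A)

lemma carrier_L: "l \<in> carrier L \<longleftrightarrow> l \<in> carrier M \<and> (\<forall>n\<in>carrier N. l \<otimes> h n = h n \<otimes> l)"
  and L_simps [simp]: "x \<otimes>\<^bsub>L\<^esub> y = x \<otimes> y" "x \<oplus>\<^bsub>L\<^esub> y = x \<oplus> y" "\<one>\<^bsub>L\<^esub> = \<one>" "\<zero>\<^bsub>L\<^esub> = \<zero>"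
  by (auto simp: centralizer_ring_def)

lemma L_closed [simp]: "l \<in> carrier L \<Longrightarrow> l \<in> carrier M"
  and L_central: "l \<in> carrier L \<Longrightarrow> n \<in> carrier N \<Longrightarrow> l \<otimes> h n = h n \<otimes> l"
  by (simp_all add: carrier_L)

lemma L_I: "l \<in> carrier M \<Longrightarrow> (\<And>n. n \<in> carrier N \<Longrightarrow> l \<otimes> h n = h n \<otimes> l) \<Longrightarrow> l \<in> carrier L"
  by (simp add: carrier_L)

lemma L_central_left:
  assumes "l \<in> carrier L" "n \<in> carrier N" "m \<in> carrier M"
  shows "l \<otimes> (h n \<otimes> m) = h n \<otimes> (l \<otimes> m)"
  using assms L_central[of l n] by (metis L_closed h_closed m_assoc)

lemma L_ops [simp]:
  assumes "x \<in> carrier L" "y \<in> carrier L"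
  shows "x \<otimes> y \<in> carrier L" "x \<oplus> y \<in> carrier L"
proof -
  show "x \<otimes> y \<in> carrier L"
    using assms by (intro L_I) (simp_all add: m_assoc L_central L_central_left)
  show "x \<oplus> y \<in> carrier L"
    using assms by (intro L_I) (simp_all add: l_distr r_distr L_central)
qed

lemma ring_L: "ring L"
proof (rule ringI)
  have one: "\<one> \<in> carrier L" and zero: "\<zero> \<in> carrier L" by (auto intro: L_I)
  show "abelian_group L"
  proof (rule abelian_groupI)
    fix x assume x: "x \<in> carrier L"
    then have "\<ominus> x \<in> carrier L" by (intro L_I) (simp_all add: l_minus r_minus L_central)
    with x show "\<exists>y\<in>carrier L. y \<oplus>\<^bsub>L\<^esub> x = \<zero>\<^bsub>L\<^esub>" by (auto intro!: bexI[of _ "\<ominus> x"] simp: l_neg)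
  qed (simp_all add: zero a_ac)
  show "Group.monoid L"
    by (rule monoidI) (simp_all add: one m_assoc)
qed (simp_all add: l_distr r_distr)

sublocale L: ring L by (rule ring_L)

lemma lmul_A [simp]: "l \<in> carrier L \<Longrightarrow> lmul M l \<in> carrier A"
  and rmul_A [simp]: "l \<in> carrier L \<Longrightarrow> rmul M l \<in> carrier A"
  unfolding lmul_def rmul_def
  by (intro A_I; simp add: l_distr r_distr m_assoc L_central_left L_central)+

lemma lmul_apply [simp]: "m \<in> carrier M \<Longrightarrow> lmul M l m = l \<otimes> m"
  and rmul_apply [simp]: "m \<in> carrier M \<Longrightarrow> rmul M l m = m \<otimes> l"
  by (simp_all add: lmul_def rmul_def)

lemma finsum_congI:
  "(\<And>j. j \<in> J \<Longrightarrow> f j = g j) \<Longrightarrow> (\<And>j. j \<in> J \<Longrightarrow> g j \<in> carrier M) \<Longrightarrow>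
    (\<Oplus>j\<in>J. f j) = (\<Oplus>j\<in>J. g j)"
  by (rule finsum_cong') auto

lemma E_finsum_cong:
  assumes "\<And>j. j \<in> J \<Longrightarrow> f j \<in> carrier M" "\<And>j. j \<in> J \<Longrightarrow> E (f j) = g j" "finite J"
  shows "E (\<Oplus>j\<in>J. f j) = (\<Oplus>j\<in>J. g j)"
proof -
  have "(\<Oplus>j\<in>J. E (f j)) = (\<Oplus>j\<in>J. g j)"
  proof (rule finsum_congI)
    show "g j \<in> carrier M" if "j \<in> J" for j
      using assms(1,2)[OF that] h_closed[OF psi_closed, of "f j"] by simp
  qed (rule assms(2))
  with assms(1,3) show ?thesis by (simp add: E_finsum)
qed

lemma adjoint_right_in_A:
  assumes a: "a \<in> carrier A" and f: "\<And>m. m \<in> carrier M \<Longrightarrow> f m \<in> carrier M"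
    and adj: "\<And>w m. w \<in> carrier M \<Longrightarrow> m \<in> carrier M \<Longrightarrow> E (w \<otimes> f m) = E (a w \<otimes> m)"
  shows "restrict f (carrier M) \<in> carrier A"
proof (rule A_I)
  fix m m' n assume m: "m \<in> carrier M" "m' \<in> carrier M"
  show "f (m \<oplus> m') = f m \<oplus> f m'"
    by (rule E_nondeg_right) (use m a f in \<open>simp_all add: adj r_distr E_add\<close>)
next
  fix n m assume m: "n \<in> carrier N" "m \<in> carrier M"
  have *: "E (w \<otimes> (h n \<otimes> f m)) = E (a w \<otimes> (h n \<otimes> m))" if w: "w \<in> carrier M" for w
  proof -
    have "E (w \<otimes> (h n \<otimes> f m)) = E ((w \<otimes> h n) \<otimes> f m)" using w m f by (simp add: m_assoc)
    also have "\<dots> = E (a (w \<otimes> h n) \<otimes> m)" using w m by (intro adj) simp_all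
    also have "\<dots> = E (a w \<otimes> (h n \<otimes> m))" using w m a by (simp add: A_right m_assoc)
    finally show ?thesis .
  qed
  show "f (h n \<otimes> m) = h n \<otimes> f m"
    by (rule E_nondeg_right) (use m f * in \<open>simp_all add: adj\<close>)
  have *: "E (w \<otimes> (f m \<otimes> h n)) = E (a w \<otimes> (m \<otimes> h n))" if w: "w \<in> carrier M" for w
  proof -
    have "E (w \<otimes> (f m \<otimes> h n)) = E (w \<otimes> f m) \<otimes> h n" using w m f by (simp add: m_assoc[symmetric] E_right)
    also have "\<dots> = E (a w \<otimes> (m \<otimes> h n))" using w m a by (simp add: adj m_assoc[symmetric] E_right)
    finally show ?thesis .
  qed
  show "f (m \<otimes> h n) = f m \<otimes> h n"
    by (rule E_nondeg_right) (use m f * in \<open>simp_all add: adj\<close>)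
qed (rule f)

lemma adjoint_left_in_A:
  assumes b: "b \<in> carrier A" and f: "\<And>m. m \<in> carrier M \<Longrightarrow> f m \<in> carrier M"
    and adj: "\<And>w m. w \<in> carrier M \<Longrightarrow> m \<in> carrier M \<Longrightarrow> E (f w \<otimes> m) = E (w \<otimes> b m)"
  shows "restrict f (carrier M) \<in> carrier A"
proof (rule A_I)
  fix m m' n assume m: "m \<in> carrier M" "m' \<in> carrier M"
  show "f (m \<oplus> m') = f m \<oplus> f m'"
    by (rule E_nondeg_left) (use m b f in \<open>simp_all add: adj l_distr E_add\<close>)
next
  fix n m assume m: "n \<in> carrier N" "m \<in> carrier M"
  have *: "E ((h n \<otimes> f m) \<otimes> w) = E ((h n \<otimes> m) \<otimes> b w)" if w: "w \<in> carrier M" for w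
    using w m b f by (simp add: m_assoc E_left adj)
  show "f (h n \<otimes> m) = h n \<otimes> f m"
    by (rule E_nondeg_left) (use m f * in \<open>simp_all add: adj\<close>)
  have *: "E ((f m \<otimes> h n) \<otimes> w) = E ((m \<otimes> h n) \<otimes> b w)" if w: "w \<in> carrier M" for w
  proof -
    have "E ((f m \<otimes> h n) \<otimes> w) = E (f m \<otimes> (h n \<otimes> w))" using w m f by (simp add: m_assoc)
    also have "\<dots> = E (m \<otimes> b (h n \<otimes> w))" using w m by (intro adj) simp_all
    also have "\<dots> = E ((m \<otimes> h n) \<otimes> b w)" using w m b by (simp add: A_left m_assoc)
    finally show ?thesis .
  qed
  show "f (m \<otimes> h n) = f m \<otimes> h n"
    by (rule E_nondeg_left) (use m f * in \<open>simp_all add: adj\<close>)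
qed (rule f)

abbreviation "S \<equiv> antipode M h \<psi> I u v"
abbreviation "\<nu> \<equiv> nakayama M h \<psi> I u v"
abbreviation "\<theta> \<equiv> nakayama_inv N M h \<psi> I u v"

lemma S_apply: "m \<in> carrier M \<Longrightarrow> S a m = (\<Oplus>i\<in>I. u i \<otimes> E (a (v i) \<otimes> m))"
  by (simp add: antipode_def)

lemma E_quasibasis_right:
  assumes a: "\<And>x. x \<in> carrier M \<Longrightarrow> a x \<in> carrier M" and m: "m \<in> carrier M" and w: "w \<in> carrier M"
    and add: "\<And>x y. x \<in> carrier M \<Longrightarrow> y \<in> carrier M \<Longrightarrow> a (x \<oplus> y) = a x \<oplus> a y"
    and left: "\<And>n x. n \<in> carrier N \<Longrightarrow> x \<in> carrier M \<Longrightarrow> E (a (h n \<otimes> x) \<otimes> m) = h n \<otimes> E (a x \<otimes> m)"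
  shows "E (w \<otimes> (\<Oplus>i\<in>I. u i \<otimes> E (a (v i) \<otimes> m))) = E (a w \<otimes> m)"
proof -
  have "E (w \<otimes> (\<Oplus>i\<in>I. u i \<otimes> E (a (v i) \<otimes> m))) = E (\<Oplus>i\<in>I. w \<otimes> (u i \<otimes> E (a (v i) \<otimes> m)))"
    using a m w by (simp add: finsum_rdistr Pi_iff)
  also have "\<dots> = (\<Oplus>i\<in>I. E ((w \<otimes> u i) \<otimes> E (a (v i) \<otimes> m)))"
    using a m w by (intro E_finsum_cong) (simp_all add: m_assoc)
  also have "\<dots> = (\<Oplus>i\<in>I. E (a (E (w \<otimes> u i) \<otimes> v i) \<otimes> m))"
    using a m w by (intro finsum_cong') (simp_all add: E_right left)
  also have "\<dots> = E (a (\<Oplus>i\<in>I. E (w \<otimes> u i) \<otimes> v i) \<otimes> m)"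
    using a m w by (intro additive_finsum_map[where F = "\<lambda>x. E (a x \<otimes> m)", symmetric])
      (simp_all add: add l_distr E_add)
  finally show ?thesis using w by (simp add: quasibasis_left)
qed

lemma S_closed: "a \<in> carrier A \<Longrightarrow> m \<in> carrier M \<Longrightarrow> S a m \<in> carrier M"
  by (simp add: S_apply finsum_closed)

lemma S_adjoint:
  assumes "a \<in> carrier A" "w \<in> carrier M" "m \<in> carrier M"
  shows "E (w \<otimes> S a m) = E (a w \<otimes> m)"
  unfolding S_apply[OF assms(3)]
  by (rule E_quasibasis_right) (use assms in \<open>simp_all add: A_add A_left m_assoc E_left\<close>)

lemma S_in_A [simp]:
  assumes a: "a \<in> carrier A" shows "S a \<in> carrier A"
proof -
  have "restrict (S a) (carrier M) \<in> carrier A"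
    using a by (intro adjoint_right_in_A[OF a]) (simp_all add: S_adjoint S_closed)
  then show ?thesis by (simp add: antipode_def)
qed

lemma S_unique:
  assumes "a \<in> carrier A" "b \<in> carrier A"
    and "\<And>w m. w \<in> carrier M \<Longrightarrow> m \<in> carrier M \<Longrightarrow> E (w \<otimes> b m) = E (a w \<otimes> m)"
  shows "S a = b"
  by (rule A_eqI[OF S_in_A[OF assms(1)] assms(2)], rule E_nondeg_right)
    (use assms in \<open>simp_all add: S_adjoint\<close>)

lemma S_add: "a \<in> carrier A \<Longrightarrow> b \<in> carrier A \<Longrightarrow> S (a \<oplus>\<^bsub>A\<^esub> b) = S a \<oplus>\<^bsub>A\<^esub> S b"
  by (intro S_unique) (simp_all add: r_distr l_distr E_add S_adjoint)

lemma S_mult: "a \<in> carrier A \<Longrightarrow> b \<in> carrier A \<Longrightarrow> S (a \<otimes>\<^bsub>A\<^esub> b) = S b \<otimes>\<^bsub>A\<^esub> S a"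
  by (intro S_unique) (simp_all add: S_adjoint)

lemma S_one: "S \<one>\<^bsub>A\<^esub> = \<one>\<^bsub>A\<^esub>"
  by (intro S_unique) simp_all

lemma S_inj: "inj_on S (carrier A)"
proof (rule inj_onI)
  fix a b assume ab: "a \<in> carrier A" "b \<in> carrier A" "S a = S b"
  have *: "E (a w \<otimes> m) = E (b w \<otimes> m)" if "w \<in> carrier M" "m \<in> carrier M" for w m
    using S_adjoint[OF ab(1) that] S_adjoint[OF ab(2) that] ab(3) by simp
  show "a = b"
  proof (rule A_eqI[OF ab(1,2)])
    fix m assume "m \<in> carrier M"
    with ab(1,2) * show "a m = b m" using E_nondeg_left[of "a m" "b m"] by simp
  qed
qed

lemma S_surj: "S ` carrier A = carrier A"
proof
  show "carrier A \<subseteq> S ` carrier A"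
  proof
    fix b assume b: "b \<in> carrier A"
    define f where "f w = (\<Oplus>i\<in>I. E (w \<otimes> b (u i)) \<otimes> v i)" for w
    have f: "f w \<in> carrier M" if "w \<in> carrier M" for w
      using that b by (simp add: f_def finsum_closed)
    have adj: "E (f w \<otimes> m) = E (w \<otimes> b m)" if wm: "w \<in> carrier M" "m \<in> carrier M" for w m
    proof -
      have "E (f w \<otimes> m) = E (\<Oplus>i\<in>I. (E (w \<otimes> b (u i)) \<otimes> v i) \<otimes> m)"
        using wm b unfolding f_def by (subst finsum_ldistr) (simp_all add: Pi_iff)
      also have "\<dots> = (\<Oplus>i\<in>I. E (E (w \<otimes> b (u i)) \<otimes> (v i \<otimes> m)))"
        using wm b by (intro E_finsum_cong) (simp_all add: m_assoc)
      also have "\<dots> = (\<Oplus>i\<in>I. E (w \<otimes> b (u i \<otimes> E (v i \<otimes> m))))"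
      proof (rule finsum_congI)
        fix i assume i: "i \<in> I"
        have "E (E (w \<otimes> b (u i)) \<otimes> (v i \<otimes> m)) = E (w \<otimes> b (u i) \<otimes> E (v i \<otimes> m))"
          using i wm b by (simp add: E_left E_right)
        also have "\<dots> = E (w \<otimes> b (u i \<otimes> E (v i \<otimes> m)))"
          using i wm b by (simp add: A_right m_assoc)
        finally show "E (E (w \<otimes> b (u i)) \<otimes> (v i \<otimes> m)) = E (w \<otimes> b (u i \<otimes> E (v i \<otimes> m)))" .
      qed (use wm b in simp)
      also have "\<dots> = E (w \<otimes> b (\<Oplus>i\<in>I. u i \<otimes> E (v i \<otimes> m)))"
        using wm b by (intro additive_finsum_map[where F = "\<lambda>x. E (w \<otimes> b x)", symmetric])
          (simp_all add: A_add r_distr E_add)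
      finally show ?thesis using wm by (simp add: quasibasis_right)
    qed
    have a: "restrict f (carrier M) \<in> carrier A" using b f adj by (rule adjoint_left_in_A)
    then have "S (restrict f (carrier M)) = b"
      using b by (intro S_unique) (simp_all add: adj)
    with a show "b \<in> S ` carrier A" by blast
  qed
qed auto

lemma S_iso: "S \<in> ring_iso A (op_ring A)"
  by (rule ring_iso_memI) (simp_all add: S_mult S_add S_one bij_betw_def S_inj S_surj)

lemma one_L [simp]: "\<one> \<in> carrier L"
  using L.one_closed by simp

lemma nakayama_closed: "c \<in> carrier L \<Longrightarrow> \<nu> c \<in> carrier M"
  by (simp add: nakayama_def finsum_closed)

lemma nakayama_adjoint:
  assumes c: "c \<in> carrier L" and m: "m \<in> carrier M"
  shows "E (\<nu> c \<otimes> m) = E (m \<otimes> c)"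
proof -
  have "E (\<nu> c \<otimes> m) = E (\<Oplus>i\<in>I. (E (u i \<otimes> c) \<otimes> v i) \<otimes> m)"
    using c m unfolding nakayama_def by (subst finsum_ldistr) (simp_all add: Pi_iff)
  also have "\<dots> = (\<Oplus>i\<in>I. E (E (u i \<otimes> c) \<otimes> (v i \<otimes> m)))"
    using c m by (intro E_finsum_cong) (simp_all add: m_assoc)
  also have "\<dots> = (\<Oplus>i\<in>I. E ((u i \<otimes> E (v i \<otimes> m)) \<otimes> c))"
  proof (rule finsum_cong'; clarsimp?)
    fix i assume i: "i \<in> I"
    have "E (E (u i \<otimes> c) \<otimes> (v i \<otimes> m)) = E ((u i \<otimes> c) \<otimes> E (v i \<otimes> m))"
      using i c m by (simp add: E_left E_right)
    also have "(u i \<otimes> c) \<otimes> E (v i \<otimes> m) = (u i \<otimes> E (v i \<otimes> m)) \<otimes> c"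
      using i c m by (simp add: m_assoc L_central)
    finally show "E (E (u i \<otimes> c) \<otimes> (v i \<otimes> m)) = E ((u i \<otimes> E (v i \<otimes> m)) \<otimes> c)" .
    show "E ((u i \<otimes> E (v i \<otimes> m)) \<otimes> c) \<in> carrier M" using i c m by simp
  qed
  also have "\<dots> = E ((\<Oplus>i\<in>I. u i \<otimes> E (v i \<otimes> m)) \<otimes> c)"
    using c m by (intro additive_finsum_map[where F = "\<lambda>x. E (x \<otimes> c)", symmetric])
      (simp_all add: l_distr E_add)
  finally show "E (\<nu> c \<otimes> m) = E (m \<otimes> c)" using m by (simp add: quasibasis_right)
qed

lemma adjoint_in_L:
  assumes c: "c \<in> carrier L" and d: "d \<in> carrier M"
    and adj: "\<And>m. m \<in> carrier M \<Longrightarrow> E (d \<otimes> m) = E (m \<otimes> c)"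
  shows "d \<in> carrier L"
proof (rule L_I[OF d])
  fix n assume n: "n \<in> carrier N"
  show "d \<otimes> h n = h n \<otimes> d"
    by (rule E_nondeg_left) (use n d c in \<open>simp_all add: m_assoc adj E_left\<close>)
qed

lemma nakayama_in_L [simp]: "c \<in> carrier L \<Longrightarrow> \<nu> c \<in> carrier L"
  by (rule adjoint_in_L) (simp_all add: nakayama_adjoint nakayama_closed)

lemma nakayama_unique:
  assumes "c \<in> carrier L" "d \<in> carrier M" "\<And>m. m \<in> carrier M \<Longrightarrow> E (d \<otimes> m) = E (m \<otimes> c)"
  shows "\<nu> c = d"
  by (rule E_nondeg_left) (use assms in \<open>simp_all add: nakayama_adjoint nakayama_closed\<close>)

lemma nakayama_hom: "\<nu> \<in> ring_hom L L"
proof (rule ring_hom_memI)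
  fix x y assume xy: "x \<in> carrier L" "y \<in> carrier L"
  have "\<nu> (x \<otimes> y) = \<nu> x \<otimes> \<nu> y"
  proof (rule nakayama_unique)
    show "E (\<nu> x \<otimes> \<nu> y \<otimes> m) = E (m \<otimes> (x \<otimes> y))" if "m \<in> carrier M" for m
      using nakayama_adjoint[OF xy(1), of "\<nu> y \<otimes> m"] nakayama_adjoint[OF xy(2), of "m \<otimes> x"] that xy
      by (simp add: m_assoc)
  qed (use xy in simp_all)
  then show "\<nu> (x \<otimes>\<^bsub>L\<^esub> y) = \<nu> x \<otimes>\<^bsub>L\<^esub> \<nu> y" by simp
  have "\<nu> (x \<oplus> y) = \<nu> x \<oplus> \<nu> y"
    by (rule nakayama_unique) (use xy in \<open>simp_all add: l_distr r_distr E_add nakayama_adjoint\<close>)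
  then show "\<nu> (x \<oplus>\<^bsub>L\<^esub> y) = \<nu> x \<oplus>\<^bsub>L\<^esub> \<nu> y" by simp
next
  show "\<nu> \<one>\<^bsub>L\<^esub> = \<one>\<^bsub>L\<^esub>" by simp (rule nakayama_unique; simp)
qed simp

lemma nakayama_bij: "bij_betw \<nu> (carrier L) (carrier L)"
  unfolding bij_betw_def
proof (intro conjI inj_onI equalityI subsetI)
  fix x y assume xy: "x \<in> carrier L" "y \<in> carrier L" "\<nu> x = \<nu> y"
  have "E (m \<otimes> x) = E (m \<otimes> y)" if "m \<in> carrier M" for m
    using nakayama_adjoint[OF xy(1) that] nakayama_adjoint[OF xy(2) that] xy(3) by simp
  with xy(1,2) show "x = y" using E_nondeg_right[of x y] by simp
next
  fix d assume d: "d \<in> carrier L"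
  define c where "c = (\<Oplus>i\<in>I. u i \<otimes> E (d \<otimes> v i))"
  have c: "c \<in> carrier M" using d by (simp add: c_def finsum_closed)
  have adj: "E (m \<otimes> c) = E (d \<otimes> m)" if m: "m \<in> carrier M" for m
  proof -
    have "c = (\<Oplus>i\<in>I. u i \<otimes> E (d \<otimes> v i \<otimes> \<one>))"
      using d unfolding c_def by (intro finsum_congI) simp_all
    then show ?thesis
      using E_quasibasis_right[of "\<lambda>x. d \<otimes> x" \<one> m] m d
      by (simp add: r_distr L_central_left E_left)
  qed
  have "c \<in> carrier L"
  proof (rule L_I[OF c])
    fix n assume n: "n \<in> carrier N"
    have "E (w \<otimes> (c \<otimes> h n)) = E (w \<otimes> (h n \<otimes> c))" if w: "w \<in> carrier M" for w
    proof -
      have "E (w \<otimes> (c \<otimes> h n)) = E (d \<otimes> w) \<otimes> h n"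
        using w n c by (simp add: m_assoc[symmetric] E_right adj)
      also have "\<dots> = E (d \<otimes> (w \<otimes> h n))" using w n d by (simp add: m_assoc[symmetric] E_right)
      also have "\<dots> = E ((w \<otimes> h n) \<otimes> c)" using w n by (simp add: adj)
      finally show ?thesis using w n c by (simp add: m_assoc)
    qed
    then show "c \<otimes> h n = h n \<otimes> c"
      using n c E_nondeg_right[of "c \<otimes> h n" "h n \<otimes> c"] by simp
  qed
  moreover have "\<nu> c = d" using \<open>c \<in> carrier L\<close> d by (intro nakayama_unique) (simp_all add: adj)
  ultimately show "d \<in> \<nu> ` carrier L" by blast
qed auto

lemma theta_in_L [simp]: "l \<in> carrier L \<Longrightarrow> \<theta> l \<in> carrier L"
  and nakayama_theta [simp]: "l \<in> carrier L \<Longrightarrow> \<nu> (\<theta> l) = l"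
  and theta_nakayama [simp]: "l \<in> carrier L \<Longrightarrow> \<theta> (\<nu> l) = l"
  using nakayama_bij unfolding nakayama_inv_def
  by (simp_all add: bij_betw_def f_inv_into_f inv_into_into)

lemma theta_iso: "\<theta> \<in> ring_iso L L"
  using ring_iso_set_sym[OF ring_L, of \<nu> L] nakayama_hom nakayama_bij
  unfolding nakayama_inv_def by (simp add: ring_iso_def)

lemma theta_adjoint:
  "l \<in> carrier L \<Longrightarrow> m \<in> carrier M \<Longrightarrow> E (m \<otimes> \<theta> l) = E (l \<otimes> m)"
  using nakayama_adjoint[of "\<theta> l" m] by simp

lemma S_lmul: "l \<in> carrier L \<Longrightarrow> S (lmul M l) = rmul M (\<theta> l)"
  by (rule S_unique) (simp_all add: m_assoc[symmetric] theta_adjoint[of l "_ \<otimes> _"])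

lemma S_rmul: "l \<in> carrier L \<Longrightarrow> S (rmul M l) = lmul M l"
  by (rule S_unique) (simp_all add: m_assoc)

lemma S_lmul_nakayama: "l \<in> carrier L \<Longrightarrow> S (lmul M (\<nu> l)) = rmul M l"
  by (simp add: S_lmul)

lemma lmul_hom: "lmul M \<in> ring_hom L A"
  by (rule ring_hom_memI; simp?; intro A_eqI; simp add: m_assoc l_distr)

lemma rmul_hom: "rmul M \<in> ring_hom (op_ring L) A"
  by (rule ring_hom_memI; simp?; intro A_eqI; simp add: m_assoc r_distr)

lemma lmul_rmul_commute:
  "l \<in> carrier L \<Longrightarrow> r \<in> carrier L \<Longrightarrow> lmul M l \<otimes>\<^bsub>A\<^esub> rmul M r = rmul M r \<otimes>\<^bsub>A\<^esub> lmul M l"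
  by (intro A_eqI) (simp_all add: m_assoc)

lemma lmul_nakayama_hom: "(\<lambda>r. lmul M (\<nu> r)) \<in> ring_hom L A"
  using ring_hom_trans[OF nakayama_hom lmul_hom] by (simp add: o_def)

end

section \<open>Separation of tensors\<close>

lemma (in additive_group) frag_eval_finsum:
  assumes c: "keys c \<subseteq> S" and J: "finite J"
    and f: "\<And>j p. j \<in> J \<Longrightarrow> p \<in> S \<Longrightarrow> f j p \<in> carrier G"
  shows "frag_eval G (\<lambda>p. \<Oplus>j\<in>J. f j p) c = (\<Oplus>j\<in>J. frag_eval G (f j) c)"
  by (rule frag_eval_unique[OF c, symmetric])
    (use J f in \<open>simp_all add: Pi_iff finsum_closed frag_eval_of frag_eval_diff[where S = S]
      finsum_minus frag_eval_closed[where S = S] cong: finsum_cong\<close>)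

context frag_quotient
begin

lemma rel_trans: "a - b \<in> rel \<Longrightarrow> b - c \<in> rel \<Longrightarrow> a - c \<in> rel"
  using rel_add[of "a - b" "b - c"] by simp

lemma rel_sym: "a - b \<in> rel \<Longrightarrow> b - a \<in> rel"
  using rel_uminus[of "a - b"] by simp

lemma rel_diff_cong: "a - b \<in> rel \<Longrightarrow> c - d \<in> rel \<Longrightarrow> (a - c) - (b - d) \<in> rel"
  using rel_diff[of "a - b" "c - d"] by (simp add: algebra_simps)

lemma rel_sum_cong: "(\<And>j. j \<in> J \<Longrightarrow> f j - g j \<in> rel) \<Longrightarrow> sum f J - sum g J \<in> rel"
  using rel_sum[of J "\<lambda>j. f j - g j"] by (simp add: sum_subtractf)

end

context bimod
begin

context
  fixes J :: "'j set" and e :: "'j \<Rightarrow> 'x" and l :: "'j \<Rightarrow> 'x \<Rightarrow> 'k"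
  assumes J: "finite J" and e: "\<And>j. j \<in> J \<Longrightarrow> e j \<in> carrier X"
    and l: "\<And>j y. j \<in> J \<Longrightarrow> y \<in> carrier X \<Longrightarrow> l j y \<in> carrier K"
    and expand: "\<And>y. y \<in> carrier X \<Longrightarrow> (\<Oplus>\<^bsub>X\<^esub>j\<in>J. bm_l V (l j y) (e j)) = y"
begin

lemma tensor_expand:
  assumes x: "x \<in> carrier X" and y: "y \<in> carrier X"
  shows "frag_of (x, y) - (\<Sum>j\<in>J. frag_of (bm_r V x (l j y), e j)) \<in> T2.rel"
proof -
  have "frag_of (x, \<Oplus>\<^bsub>X\<^esub>j\<in>J. bm_l V (l j y) (e j)) - (\<Sum>j\<in>J. frag_of (x, bm_l V (l j y) (e j))) \<in> T2.rel"
    using J x y l e by (intro T2.additive_finsum[OF abelian]) (auto simp: rel_add_right bm_closed)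
  moreover have "(\<Sum>j\<in>J. frag_of (bm_r V x (l j y), e j)) - (\<Sum>j\<in>J. frag_of (x, bm_l V (l j y) (e j))) \<in> T2.rel"
    using x y l e by (intro T2.rel_sum_cong rel_middle) auto
  ultimately show ?thesis
    unfolding expand[OF y] by (rule T2.rel_trans[OF _ T2.rel_sym])
qed

lemma tensor_normal_form:
  assumes c: "keys c \<subseteq> carrier X \<times> carrier X"
  shows "c - (\<Sum>j\<in>J. frag_of (frag_eval X (\<lambda>(x, y). bm_r V x (l j y)) c, e j)) \<in> T2.rel"
proof -
  let ?g = "\<lambda>j (x, y). bm_r V x (l j y)"
  have "frag_of (frag_eval X (?g j) c, e j) - frag_extend (\<lambda>p. frag_of (?g j p, e j)) c \<in> T2.rel"
    if "j \<in> J" for j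
    by (rule T2.additive_frag_eval[OF abelian, where \<phi> = "\<lambda>x. frag_of (x, e j)", OF _ c])
      (use that e l in \<open>auto simp: rel_add_left bm_closed\<close>)
  then have "(\<Sum>j\<in>J. frag_of (frag_eval X (?g j) c, e j)) -
      (\<Sum>j\<in>J. frag_extend (\<lambda>p. frag_of (?g j p, e j)) c) \<in> T2.rel"
    by (rule T2.rel_sum_cong)
  moreover have "c - (\<Sum>j\<in>J. frag_extend (\<lambda>p. frag_of (?g j p, e j)) c) \<in> T2.rel"
    using c
  proof (induction c rule: free_Abelian_group_induct[consumes 1, case_names zero diff one])
    case (diff c d)
    from T2.rel_diff_cong[OF diff(3,4)] show ?case
      by (simp add: frag_extend_diff sum_subtractf)
  next
    case (one p)
    then show ?case using tensor_expand[of "fst p" "snd p"] by (auto simp: split_beta)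
  qed simp
  ultimately show ?thesis by (rule T2.rel_trans[OF _ T2.rel_sym, rotated])
qed

lemma tensor_class_eqI:
  assumes "keys c \<subseteq> carrier X \<times> carrier X" "keys d \<subseteq> carrier X \<times> carrier X"
    and "\<And>j. j \<in> J \<Longrightarrow> frag_eval X (\<lambda>(x, y). bm_r V x (l j y)) c = frag_eval X (\<lambda>(x, y). bm_r V x (l j y)) d"
  shows "tensor_class V c = tensor_class V d"
proof -
  have "(\<Sum>j\<in>J. frag_of (frag_eval X (\<lambda>(x, y). bm_r V x (l j y)) c, e j)) =
      (\<Sum>j\<in>J. frag_of (frag_eval X (\<lambda>(x, y). bm_r V x (l j y)) d, e j))"
    using assms(3) by simp
  then show ?thesis
    unfolding tensor_class_eq_iff
    using T2.rel_trans[OF tensor_normal_form[OF assms(1)] T2.rel_sym, of d] tensor_normal_form[OF assms(2)] by simp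
qed

lemma tensor3_expand:
  assumes x: "x \<in> carrier X" and y: "y \<in> carrier X" and z: "z \<in> carrier X"
  shows "frag_of (x, y, z) - (\<Sum>j\<in>J. \<Sum>k\<in>J. frag_of (bm_r V x (l k (bm_r V y (l j z))), e k, e j)) \<in> T3.rel"
proof -
  have *: "frag_of (x, y, w) - (\<Sum>k\<in>J. frag_of (bm_r V x (l k y), e k, w)) \<in> T3.rel"
    if y: "y \<in> carrier X" and w: "w \<in> carrier X" for y w
  proof -
    have "frag_of (x, \<Oplus>\<^bsub>X\<^esub>j\<in>J. bm_l V (l j y) (e j), w) - (\<Sum>j\<in>J. frag_of (x, bm_l V (l j y) (e j), w)) \<in> T3.rel"
      by (rule T3.additive_finsum[OF abelian, where \<phi> = "\<lambda>y. frag_of (x, y, w)"])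
        (use J x y w l e in \<open>auto simp: rel3_add_2 bm_closed\<close>)
    moreover have "(\<Sum>j\<in>J. frag_of (bm_r V x (l j y), e j, w)) - (\<Sum>j\<in>J. frag_of (x, bm_l V (l j y) (e j), w)) \<in> T3.rel"
      using x y l e w by (intro T3.rel_sum_cong rel3_middle_1) auto
    ultimately show ?thesis
      unfolding expand[OF y] by (rule T3.rel_trans[OF _ T3.rel_sym])
  qed
  have "frag_of (x, y, \<Oplus>\<^bsub>X\<^esub>j\<in>J. bm_l V (l j z) (e j)) - (\<Sum>j\<in>J. frag_of (x, y, bm_l V (l j z) (e j))) \<in> T3.rel"
    by (rule T3.additive_finsum[OF abelian, where \<phi> = "\<lambda>z. frag_of (x, y, z)"])
      (use J x y z l e in \<open>auto simp: rel3_add_3 bm_closed\<close>)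
  moreover have "(\<Sum>j\<in>J. frag_of (x, bm_r V y (l j z), e j)) - (\<Sum>j\<in>J. frag_of (x, y, bm_l V (l j z) (e j))) \<in> T3.rel"
    using x y z l e by (intro T3.rel_sum_cong rel3_middle_2) auto
  ultimately have "frag_of (x, y, z) - (\<Sum>j\<in>J. frag_of (x, bm_r V y (l j z), e j)) \<in> T3.rel"
    unfolding expand[OF z] by (rule T3.rel_trans[OF _ T3.rel_sym])
  moreover have "(\<Sum>j\<in>J. frag_of (x, bm_r V y (l j z), e j)) -
      (\<Sum>j\<in>J. \<Sum>k\<in>J. frag_of (bm_r V x (l k (bm_r V y (l j z))), e k, e j)) \<in> T3.rel"
    using x y z l e by (intro T3.rel_sum_cong *) (auto simp: bm_closed)
  ultimately show ?thesis by (rule T3.rel_trans)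
qed

lemma tensor3_normal_form:
  assumes c: "keys c \<subseteq> carrier X \<times> carrier X \<times> carrier X"
  shows "c - (\<Sum>j\<in>J. \<Sum>k\<in>J. frag_of
    (frag_eval X (\<lambda>(x, y, z). bm_r V x (l k (bm_r V y (l j z)))) c, e k, e j)) \<in> T3.rel"
proof -
  let ?g = "\<lambda>j k (x, y, z). bm_r V x (l k (bm_r V y (l j z)))"
  have "frag_of (frag_eval X (?g j k) c, e k, e j) - frag_extend (\<lambda>p. frag_of (?g j k p, e k, e j)) c \<in> T3.rel"
    if "j \<in> J" "k \<in> J" for j k
    by (rule T3.additive_frag_eval[OF abelian, where \<phi> = "\<lambda>x. frag_of (x, e k, e j)", OF _ c])
      (use that e l in \<open>auto simp: rel3_add_1 bm_closed\<close>)
  then have "(\<Sum>j\<in>J. \<Sum>k\<in>J. frag_of (frag_eval X (?g j k) c, e k, e j)) -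
      (\<Sum>j\<in>J. \<Sum>k\<in>J. frag_extend (\<lambda>p. frag_of (?g j k p, e k, e j)) c) \<in> T3.rel"
    by (intro T3.rel_sum_cong)
  moreover have "c - (\<Sum>j\<in>J. \<Sum>k\<in>J. frag_extend (\<lambda>p. frag_of (?g j k p, e k, e j)) c) \<in> T3.rel"
    using c
  proof (induction c rule: free_Abelian_group_induct[consumes 1, case_names zero diff one])
    case (diff c d)
    from T3.rel_diff_cong[OF diff(3,4)] show ?case
      by (simp add: frag_extend_diff sum_subtractf)
  next
    case (one p)
    then show ?case using tensor3_expand[of "fst p" "fst (snd p)" "snd (snd p)"] by (auto simp: split_beta)
  qed simp
  ultimately show ?thesis by (rule T3.rel_trans[OF _ T3.rel_sym, rotated])
qed

lemma tensor3_class_eqI: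
  assumes "keys c \<subseteq> carrier X \<times> carrier X \<times> carrier X"
    and "keys d \<subseteq> carrier X \<times> carrier X \<times> carrier X"
    and "\<And>j k. j \<in> J \<Longrightarrow> k \<in> J \<Longrightarrow>
      frag_eval X (\<lambda>(x, y, z). bm_r V x (l k (bm_r V y (l j z)))) c =
      frag_eval X (\<lambda>(x, y, z). bm_r V x (l k (bm_r V y (l j z)))) d"
  shows "tensor3_class V c = tensor3_class V d"
proof -
  have "(\<Sum>j\<in>J. \<Sum>k\<in>J. frag_of (frag_eval X (\<lambda>(x, y, z). bm_r V x (l k (bm_r V y (l j z)))) c, e k, e j)) =
      (\<Sum>j\<in>J. \<Sum>k\<in>J. frag_of (frag_eval X (\<lambda>(x, y, z). bm_r V x (l k (bm_r V y (l j z)))) d, e k, e j))"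
    using assms(3) by simp
  then show ?thesis
    unfolding tensor3_class_eq_iff
    using T3.rel_trans[OF tensor3_normal_form[OF assms(1)] T3.rel_sym, of d] tensor3_normal_form[OF assms(2)] by simp
qed

end

end

section \<open>Depth two\<close>

lemma (in additive_group) sum_minus_summands:
  "a \<in> carrier G \<Longrightarrow> b \<in> carrier G \<Longrightarrow> a \<oplus> b \<ominus> a \<ominus> b = \<zero>"
  using r_neg[of a] r_neg[of b] a_lcomm[of b "\<ominus> a" "\<ominus> b"] by (simp add: a_minus_def a_assoc)

lemma (in additive_group) minus_self: "a \<in> carrier G \<Longrightarrow> a \<ominus> a = \<zero>"
  by (simp add: a_minus_def r_neg)

lemma (in additive_group) minus_eq_zeroD:
  assumes "a \<in> carrier G" "b \<in> carrier G" "a \<ominus> b = \<zero>" shows "a = b"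
proof -
  have "a = a \<ominus> b \<oplus> b" using assms(1,2) by (simp add: a_minus_def a_assoc l_neg)
  with assms show ?thesis by simp
qed

context frobenius_extension
begin

abbreviation "VE \<equiv> ext_bimod N M h"

lemma bimod_VE: "bimod VE"
  unfolding bimod_def bimodule_def Let_def ext_bimod_def bimod.simps
  using N.ring_axioms is_abelian_group
  by (intro conjI ballI; simp add: h_simps m_assoc l_distr r_distr)

sublocale VE: bimod VE by (rule bimod_VE)

lemma VE_simps [simp]:
  "bm_scal VE = N" "bm_grp VE = M" "bm_l VE n m = h n \<otimes> m" "bm_r VE m n = m \<otimes> h n"
  by (simp_all add: ext_bimod_def)

abbreviation "MM \<equiv> carrier M \<times> carrier M"

lemma VE_rel_eval:
  assumes F: "\<And>p q. p \<in> carrier M \<Longrightarrow> q \<in> carrier M \<Longrightarrow> F p q \<in> carrier M"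
    and add_left: "\<And>p p' q. p \<in> carrier M \<Longrightarrow> p' \<in> carrier M \<Longrightarrow> q \<in> carrier M \<Longrightarrow>
      F (p \<oplus> p') q = F p q \<oplus> F p' q"
    and add_right: "\<And>p q q'. p \<in> carrier M \<Longrightarrow> q \<in> carrier M \<Longrightarrow> q' \<in> carrier M \<Longrightarrow>
      F p (q \<oplus> q') = F p q \<oplus> F p q'"
    and bal: "\<And>p n q. p \<in> carrier M \<Longrightarrow> n \<in> carrier N \<Longrightarrow> q \<in> carrier M \<Longrightarrow>
      F (p \<otimes> h n) q = F p (h n \<otimes> q)"
    and c: "keys c \<subseteq> MM"
    and d: "keys d \<subseteq> MM"
    and cd: "tensor_class VE c = tensor_class VE d"
  shows "frag_eval M (\<lambda>(p, q). F p q) c = frag_eval M (\<lambda>(p, q). F p q) d"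
proof -
  have Fm: "(\<lambda>(p, q). F p q) \<in> MM \<rightarrow> carrier M" using F by auto
  have "frag_eval M (\<lambda>(p, q). F p q) (c - d) = \<zero>"
  proof (rule VE.T2.rel_eval_0)
    show "c - d \<in> VE.T2.rel" using cd by (simp add: VE.tensor_class_eq_iff)
    fix g assume "g \<in> tensor_gens VE"
    then show "frag_eval M (\<lambda>(p, q). F p q) g = \<zero>"
      by (induction rule: VE.tensor_gens_elim)
        (simp_all add: frag_eval_diff[where S = "MM"] keys_diff_subset Fm frag_eval_of
          F add_left add_right bal sum_minus_summands minus_self)
  qed (use Fm is_abelian_group in simp_all)
  then have "frag_eval M (\<lambda>(p, q). F p q) c \<ominus> frag_eval M (\<lambda>(p, q). F p q) d = \<zero>"
    using c d Fm by (simp add: frag_eval_diff[where S = "MM"])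
  then show ?thesis
    by (rule minus_eq_zeroD[OF frag_eval_closed[OF c Fm] frag_eval_closed[OF d Fm]])
qed

lemma induced_map_VE_left:
  assumes "x \<in> carrier M"
  shows "induced_map VE (\<lambda>(p, q). (x \<otimes> p, q)) (tensor_class VE c) =
    tensor_class VE (frag_map (\<lambda>(p, q). (x \<otimes> p, q)) c)"
proof (rule induced_map_tensor_class[OF bimod_VE bimod_VE])
  fix g assume "g \<in> tensor_gens VE"
  then have "frag_map (\<lambda>(p, q). (x \<otimes> p, q)) g \<in> VE.T2.rel"
    by (induction rule: VE.tensor_gens_elim)
      (use assms(1) VE.rel_add_left[unfolded VE_simps] VE.rel_add_right[unfolded VE_simps]
        VE.rel_middle[unfolded VE_simps] in \<open>simp_all add: frag_map_diff r_distr m_assoc[symmetric]\<close>)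
  then show "tensor_class VE (frag_map (\<lambda>(p, q). (x \<otimes> p, q)) g) = tensor_class VE 0"
    by (simp add: VE.tensor_class_eq_iff)
qed

lemma induced_map_VE_right:
  assumes "x \<in> carrier M"
  shows "induced_map VE (\<lambda>(p, q). (p, q \<otimes> x)) (tensor_class VE c) =
    tensor_class VE (frag_map (\<lambda>(p, q). (p, q \<otimes> x)) c)"
proof (rule induced_map_tensor_class[OF bimod_VE bimod_VE])
  fix g assume "g \<in> tensor_gens VE"
  then have "frag_map (\<lambda>(p, q). (p, q \<otimes> x)) g \<in> VE.T2.rel"
    by (induction rule: VE.tensor_gens_elim)
      (use assms(1) VE.rel_add_left[unfolded VE_simps] VE.rel_add_right[unfolded VE_simps]
        VE.rel_middle[unfolded VE_simps] in \<open>simp_all add: frag_map_diff l_distr m_assoc\<close>)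
  then show "tensor_class VE (frag_map (\<lambda>(p, q). (p, q \<otimes> x)) g) = tensor_class VE 0"
    by (simp add: VE.tensor_class_eq_iff)
qed

lemma VE_class_eq_iff:
  assumes c: "keys c \<subseteq> MM"
    and d: "keys d \<subseteq> MM"
  shows "tensor_class VE c = tensor_class VE d \<longleftrightarrow> (\<forall>m\<in>carrier M.
    frag_eval M (\<lambda>(x, y). x \<otimes> E (y \<otimes> m)) c = frag_eval M (\<lambda>(x, y). x \<otimes> E (y \<otimes> m)) d)"
proof
  assume "tensor_class VE c = tensor_class VE d"
  then show "\<forall>m\<in>carrier M. frag_eval M (\<lambda>(x, y). x \<otimes> E (y \<otimes> m)) c = frag_eval M (\<lambda>(x, y). x \<otimes> E (y \<otimes> m)) d"
    by (intro ballI VE_rel_eval[OF _ _ _ _ c d])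
      (simp_all add: l_distr r_distr E_add E_left m_assoc)
next
  assume *: "\<forall>m\<in>carrier M. frag_eval M (\<lambda>(x, y). x \<otimes> E (y \<otimes> m)) c = frag_eval M (\<lambda>(x, y). x \<otimes> E (y \<otimes> m)) d"
  show "tensor_class VE c = tensor_class VE d"
    by (rule VE.tensor_class_eqI[of I v "\<lambda>i y. \<psi> (y \<otimes> u i)"])
      (use c d * in \<open>simp_all add: quasibasis_left\<close>)
qed

lemma central_tensor_map:
  assumes X: "X \<in> central_tensors N M h"
  obtains c where "keys c \<subseteq> MM" "X = tensor_class VE c"
    "restrict (\<lambda>m. frag_eval M (\<lambda>(p, q). E (m \<otimes> p) \<otimes> q) c) (carrier M) \<in> carrier A"
proof -
  obtain c where c: "keys c \<subseteq> MM" and Xc: "X = tensor_class VE c"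
    using X by (auto simp: central_tensors_def VE.carrier_tensor)
  have central: "tensor_class VE (frag_map (\<lambda>(p, q). (h n \<otimes> p, q)) c) =
      tensor_class VE (frag_map (\<lambda>(p, q). (p, q \<otimes> h n)) c)" if "n \<in> carrier N" for n
    using X that by (simp add: central_tensors_def Xc induced_map_VE_left induced_map_VE_right)
  let ?F = "\<lambda>m (p, q). E (m \<otimes> p) \<otimes> q"
  have F: "?F m \<in> MM \<rightarrow> carrier M" if "m \<in> carrier M" for m
    using that by auto
  have split_hom: "G (frag_eval M f c) = frag_eval M (\<lambda>p. G (f p)) c"
    if "\<And>x. x \<in> carrier M \<Longrightarrow> G x \<in> carrier M"
      "\<And>x y. x \<in> carrier M \<Longrightarrow> y \<in> carrier M \<Longrightarrow> G (x \<oplus> y) = G x \<oplus> G y"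
      "f \<in> MM \<rightarrow> carrier M" for G f
    by (rule hom_eval_M[OF that(1,2) c that(3)])
  have "restrict (\<lambda>m. frag_eval M (?F m) c) (carrier M) \<in> carrier A"
  proof (rule A_I)
    fix m m' assume m: "m \<in> carrier M" "m' \<in> carrier M"
    show "frag_eval M (?F m) c \<in> carrier M" using frag_eval_closed[OF c F] m by simp
    show "frag_eval M (?F (m \<oplus> m')) c = frag_eval M (?F m) c \<oplus> frag_eval M (?F m') c"
      by (rule frag_eval_unique[OF c, symmetric])
        (use m F in \<open>auto simp: frag_eval_of l_distr E_add frag_eval_diff[where S = "MM"]
          frag_eval_closed[where S = "MM"] diff_add_diff\<close>)
  next
    fix n m assume m: "n \<in> carrier N" "m \<in> carrier M"
    have "h n \<otimes> frag_eval M (?F m) c = frag_eval M (\<lambda>p. h n \<otimes> ?F m p) c"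
      by (rule split_hom[where G = "\<lambda>x. h n \<otimes> x"]) (use m F in \<open>simp_all add: r_distr\<close>)
    also have "\<dots> = frag_eval M (?F (h n \<otimes> m)) c"
      by (rule frag_eval_cong) (use m c in \<open>auto simp: m_assoc E_left\<close>)
    finally show "frag_eval M (?F (h n \<otimes> m)) c = h n \<otimes> frag_eval M (?F m) c" by simp
    have "frag_eval M (?F (m \<otimes> h n)) c = frag_eval M (\<lambda>p. ?F m (case p of (p, q) \<Rightarrow> (h n \<otimes> p, q))) c"
      by (rule frag_eval_cong) (use m c in \<open>auto simp: m_assoc\<close>)
    also have "\<dots> = frag_eval M (?F m) (frag_map (\<lambda>(p, q). (h n \<otimes> p, q)) c)"
      by (rule frag_eval_map[OF c _ F, symmetric]) (use m in auto)
    also have "\<dots> = frag_eval M (?F m) (frag_map (\<lambda>(p, q). (p, q \<otimes> h n)) c)"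
      by (rule VE_rel_eval)
        (use m central in \<open>auto intro!: keys_map_subset[OF c] simp: l_distr r_distr E_add E_right m_assoc[symmetric]\<close>)
    also have "\<dots> = frag_eval M (\<lambda>p. ?F m (case p of (p, q) \<Rightarrow> (p, q \<otimes> h n))) c"
      by (rule frag_eval_map[OF c _ F]) (use m in auto)
    also have "\<dots> = frag_eval M (\<lambda>p. ?F m p \<otimes> h n) c"
      by (rule frag_eval_cong) (use m c in \<open>auto simp: m_assoc\<close>)
    also have "\<dots> = frag_eval M (?F m) c \<otimes> h n"
      by (rule split_hom[where G = "\<lambda>x. x \<otimes> h n", symmetric]) (use m F in \<open>simp_all add: l_distr\<close>)
    finally show "frag_eval M (?F (m \<otimes> h n)) c = frag_eval M (?F m) c \<otimes> h n" .
  qed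
  with c Xc show ?thesis by (rule that)
qed

lemma depth_two_dual_bases:
  assumes "depth_two N M h"
  obtains k :: nat and gam bet where "\<And>j. j < k \<Longrightarrow> gam j \<in> carrier A" "\<And>j. j < k \<Longrightarrow> bet j \<in> carrier A"
    "\<And>m m'. m \<in> carrier M \<Longrightarrow> m' \<in> carrier M \<Longrightarrow> (\<Oplus>j\<in>{..<k}. gam j m \<otimes> bet j m') = E (m \<otimes> m')"
proof -
  let ?Q = "\<lambda>(k :: nat) b bet.
    (\<forall>i<k. b i \<in> central_tensors N M h \<and> bet i \<in> carrier A) \<and>
    (\<forall>m\<in>carrier M. finprod (tensor VE) (\<lambda>i. induced_map VE (\<lambda>(p, q). (p, q \<otimes> bet i m)) (b i)) {..<k} =
      pure_tensor VE m \<one>)"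
  have "\<exists>k b bet. ?Q k b bet"
    using assms unfolding depth_two_def Let_def by (rule conjunct1)
  then obtain k b bet where Q: "?Q k b bet"
    by (elim exE)
  then have b: "\<And>j. j < k \<Longrightarrow> b j \<in> central_tensors N M h"
    and bet: "\<And>j. j < k \<Longrightarrow> bet j \<in> carrier A"
    and eq: "\<And>m. m \<in> carrier M \<Longrightarrow>
      finprod (tensor VE) (\<lambda>j. induced_map VE (\<lambda>(p, q). (p, q \<otimes> bet j m)) (b j)) {..<k} = pure_tensor VE m \<one>"
    by simp_all
  let ?P = "\<lambda>j c. keys c \<subseteq> MM \<and> b j = tensor_class VE c \<and>
    restrict (\<lambda>m. frag_eval M (\<lambda>(p, q). E (m \<otimes> p) \<otimes> q) c) (carrier M) \<in> carrier A"
  have ex: "\<exists>c. ?P j c" if j: "j < k" for j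
  proof (rule central_tensor_map[OF b[OF j]])
    fix c assume "keys c \<subseteq> MM" "b j = tensor_class VE c"
      "restrict (\<lambda>m. frag_eval M (\<lambda>(p, q). E (m \<otimes> p) \<otimes> q) c) (carrier M) \<in> carrier A"
    then show ?thesis by (intro exI[of _ c] conjI)
  qed
  define c where "c j = (SOME c. ?P j c)" for j
  have "?P j (c j)" if "j < k" for j
    unfolding c_def by (rule someI_ex[OF ex[OF that]])
  then have c: "\<And>j. j < k \<Longrightarrow> keys (c j) \<subseteq> MM"
    "\<And>j. j < k \<Longrightarrow> b j = tensor_class VE (c j)"
    "\<And>j. j < k \<Longrightarrow> restrict (\<lambda>m. frag_eval M (\<lambda>(p, q). E (m \<otimes> p) \<otimes> q) (c j)) (carrier M) \<in> carrier A"
    by simp_all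
  define gam where "gam j = restrict (\<lambda>m. frag_eval M (\<lambda>(p, q). E (m \<otimes> p) \<otimes> q) (c j)) (carrier M)" for j
  have "(\<Oplus>j\<in>{..<k}. gam j m \<otimes> bet j m') = E (m \<otimes> m')" if m: "m \<in> carrier M" "m' \<in> carrier M" for m m'
  proof -
    let ?F = "\<lambda>(p, q). E (m \<otimes> p) \<otimes> q"
    let ?f = "\<lambda>j (p, q). (p, q \<otimes> bet j m')"
    have F: "?F \<in> MM \<rightarrow> carrier M" using m by auto
    have f: "?f j \<in> MM \<rightarrow> MM" if "j < k" for j
      using m bet that by auto
    have keys: "keys (frag_map (?f j) (c j)) \<subseteq> MM" if "j < k" for j
      using keys_map_subset[OF c(1)[OF that] f[OF that]] .
    have keys_sum: "keys (\<Sum>j<k. frag_map (?f j) (c j)) \<subseteq> MM"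
      using keys by (intro keys_sum_subset) simp
    have "tensor_class VE (frag_of (m', \<one>)) =
        finprod (tensor VE) (\<lambda>j. induced_map VE (?f j) (b j)) {..<k}"
      using eq[OF m(2)] by (simp add: pure_tensor_def)
    also have "\<dots> = finprod (tensor VE) (\<lambda>j. tensor_class VE (frag_map (?f j) (c j))) {..<k}"
    proof (rule comm_monoid.finprod_cong'[OF comm_group.axioms(1)[OF VE.comm_group_tensor] refl])
      show "(\<lambda>j. tensor_class VE (frag_map (?f j) (c j))) \<in> {..<k} \<rightarrow> carrier (tensor VE)"
        using keys by (auto simp: VE.carrier_tensor)
      show "induced_map VE (?f j) (b j) = tensor_class VE (frag_map (?f j) (c j))" if "j \<in> {..<k}" for j
        using that m bet c(2) by (simp add: induced_map_VE_right)
    qed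
    also have "\<dots> = tensor_class VE (\<Sum>j<k. frag_map (?f j) (c j))"
      using keys by (intro VE.tensor_finprod) simp_all
    finally have "frag_eval M ?F (frag_of (m', \<one>)) = frag_eval M ?F (\<Sum>j<k. frag_map (?f j) (c j))"
      by (intro VE_rel_eval)
        (use m keys_sum in \<open>simp_all add: l_distr r_distr E_add E_right m_assoc[symmetric]\<close>)
    also have "\<dots> = (\<Oplus>j\<in>{..<k}. frag_eval M ?F (frag_map (?f j) (c j)))"
      using keys F by (intro frag_eval_sum) simp_all
    also have "\<dots> = (\<Oplus>j\<in>{..<k}. gam j m \<otimes> bet j m')"
    proof (rule finsum_congI)
      fix j assume j: "j \<in> {..<k}"
      have "frag_eval M ?F (frag_map (?f j) (c j)) = frag_eval M (\<lambda>p. ?F (?f j p)) (c j)"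
        by (rule frag_eval_map[OF c(1) f F]) (use j in simp_all)
      also have "\<dots> = frag_eval M (\<lambda>p. ?F p \<otimes> bet j m') (c j)"
        by (rule frag_eval_cong) (use c(1)[of j] j m bet[of j] in \<open>auto simp: m_assoc\<close>)
      also have "\<dots> = frag_eval M ?F (c j) \<otimes> bet j m'"
        by (rule hom_eval_M[ where F = "\<lambda>x. x \<otimes> bet j m'", symmetric])
          (use c(1)[of j] j m bet[of j] F in \<open>simp_all add: l_distr\<close>)
      finally show "frag_eval M ?F (frag_map (?f j) (c j)) = gam j m \<otimes> bet j m'"
        using m by (simp add: gam_def)
      show "gam j m \<otimes> bet j m' \<in> carrier M" using j m bet c(3) by (simp add: gam_def[symmetric])
    qed
    finally show ?thesis using m by (simp add: frag_eval_of)
  qed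
  with c(3) bet show ?thesis using that[of k gam bet] by (simp add: gam_def)
qed

end

section \<open>The left bialgebroid\<close>

locale dual_bases = frobenius_extension N M h \<psi> I u v
  for N :: "'n ring" and M :: "'m ring" (structure) and h :: "'n \<Rightarrow> 'm" and \<psi> :: "'m \<Rightarrow> 'n"
    and I :: "'i set" and u v :: "'i \<Rightarrow> 'm" +
  fixes k :: nat and gam bet :: "nat \<Rightarrow> 'm \<Rightarrow> 'm"
  assumes gam [simp]: "j < k \<Longrightarrow> gam j \<in> carrier (end_ring N M h)"
    and bet [simp]: "j < k \<Longrightarrow> bet j \<in> carrier (end_ring N M h)"
    and gam_bet: "m \<in> carrier M \<Longrightarrow> m' \<in> carrier M \<Longrightarrow> (\<Oplus>j\<in>{..<k}. gam j m \<otimes> bet j m') = h (\<psi> (m \<otimes> m'))"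
begin

abbreviation "VL \<equiv> bimod_L N M h"

lemma bimod_VL: "bimod VL"
  unfolding bimod_L_def
  by (rule bimod_left_bimod[OF ring_A ring_L lmul_hom rmul_hom lmul_rmul_commute])

sublocale VL: bimod VL by (rule bimod_VL)

lemma VL_simps [simp]:
  "bm_scal VL = L" "bm_grp VL = A" "bm_l VL l a = lmul M l \<otimes>\<^bsub>A\<^esub> a" "bm_r VL a l = rmul M l \<otimes>\<^bsub>A\<^esub> a"
  by (simp_all add: bimod_L_def left_bimod_def)

lemma A_finsum_apply:
  assumes "finite J" "\<And>j. j \<in> J \<Longrightarrow> f j \<in> carrier A" "m \<in> carrier M"
  shows "(\<Oplus>\<^bsub>A\<^esub>j\<in>J. f j) m = (\<Oplus>j\<in>J. f j m)"
  using assms(1,2)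
  by (induction J rule: finite_induct) (simp_all add: assms(3) Pi_iff)

lemma frag_eval_A_apply:
  assumes "keys c \<subseteq> U" "f \<in> U \<rightarrow> carrier A" "m \<in> carrier M"
  shows "frag_eval A f c m = frag_eval M (\<lambda>p. f p m) c"
  by (rule hom_frag_eval[OF A.is_abelian_group is_abelian_group _ _ assms(1,2), where F = "\<lambda>a. a m"])
    (use assms(3) in simp_all)

lemma casimir_product:
  assumes y: "\<And>p. p \<in> carrier M \<Longrightarrow> y p \<in> carrier M"
    and add: "\<And>p q. p \<in> carrier M \<Longrightarrow> q \<in> carrier M \<Longrightarrow> y (p \<oplus> q) = y p \<oplus> y q"
    and right: "\<And>p n. p \<in> carrier M \<Longrightarrow> n \<in> carrier N \<Longrightarrow> y (p \<otimes> h n) = y p \<otimes> h n"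
    and j: "j < k" and n: "n \<in> carrier N"
  shows "(\<Oplus>i\<in>I. y (h n \<otimes> u i) \<otimes> gam j (v i)) = (\<Oplus>i\<in>I. y (u i) \<otimes> gam j (v i)) \<otimes> h n"
proof -
  have "(\<Oplus>i\<in>I. y (h n \<otimes> u i) \<otimes> gam j (v i)) = (\<Oplus>i\<in>I. y (u i) \<otimes> gam j (v i \<otimes> h n))"
    by (rule quasibasis_central[where F = "\<lambda>p q. y p \<otimes> gam j q"])
      (use y add right j n in \<open>simp_all add: l_distr r_distr A_add A_left m_assoc\<close>)
  also have "\<dots> = (\<Oplus>i\<in>I. y (u i) \<otimes> gam j (v i) \<otimes> h n)"
    using y j n by (intro finsum_congI) (simp_all add: A_right m_assoc)
  also have "\<dots> = (\<Oplus>i\<in>I. y (u i) \<otimes> gam j (v i)) \<otimes> h n"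
    using y j n by (intro finsum_ldistr[symmetric]) auto
  finally show ?thesis .
qed

definition coef :: "nat \<Rightarrow> ('m \<Rightarrow> 'm) \<Rightarrow> 'm" where
  "coef j y = (\<Oplus>i\<in>I. y (u i) \<otimes> gam j (v i))"

lemma coef_in_L [simp]:
  assumes j: "j < k" and y: "y \<in> carrier A" shows "coef j y \<in> carrier L"
proof (rule L_I)
  show "coef j y \<in> carrier M" using j y by (simp add: coef_def finsum_closed)
  fix n assume n: "n \<in> carrier N"
  have "coef j y \<otimes> h n = (\<Oplus>i\<in>I. y (h n \<otimes> u i) \<otimes> gam j (v i))"
    unfolding coef_def by (rule casimir_product[symmetric]) (use j y n in \<open>simp_all add: A_add A_right\<close>)
  also have "\<dots> = (\<Oplus>i\<in>I. h n \<otimes> (y (u i) \<otimes> gam j (v i)))"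
    using j y n by (intro finsum_congI) (simp_all add: A_left m_assoc)
  also have "\<dots> = h n \<otimes> coef j y"
    unfolding coef_def using j y n by (intro finsum_rdistr[symmetric]) auto
  finally show "coef j y \<otimes> h n = h n \<otimes> coef j y" .
qed

lemma gam_bet_expand:
  assumes y: "\<And>p. p \<in> carrier M \<Longrightarrow> y p \<in> carrier M"
    and add: "\<And>p q. p \<in> carrier M \<Longrightarrow> q \<in> carrier M \<Longrightarrow> y (p \<oplus> q) = y p \<oplus> y q"
    and right: "\<And>p n. p \<in> carrier M \<Longrightarrow> n \<in> carrier N \<Longrightarrow> y (p \<otimes> h n) = y p \<otimes> h n"
    and m: "m \<in> carrier M"
  shows "(\<Oplus>j\<in>{..<k}. (\<Oplus>i\<in>I. y (u i) \<otimes> gam j (v i)) \<otimes> bet j m) = y m"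
proof -
  have "(\<Oplus>j\<in>{..<k}. (\<Oplus>i\<in>I. y (u i) \<otimes> gam j (v i)) \<otimes> bet j m) =
      (\<Oplus>j\<in>{..<k}. \<Oplus>i\<in>I. y (u i) \<otimes> (gam j (v i) \<otimes> bet j m))"
  proof (rule finsum_congI)
    fix j assume j: "j \<in> {..<k}"
    have "(\<Oplus>i\<in>I. y (u i) \<otimes> gam j (v i)) \<otimes> bet j m = (\<Oplus>i\<in>I. y (u i) \<otimes> gam j (v i) \<otimes> bet j m)"
      using y j m by (intro finsum_ldistr) auto
    also have "\<dots> = (\<Oplus>i\<in>I. y (u i) \<otimes> (gam j (v i) \<otimes> bet j m))"
      using y j m by (intro finsum_congI) (simp_all add: m_assoc)
    finally show "(\<Oplus>i\<in>I. y (u i) \<otimes> gam j (v i)) \<otimes> bet j m = (\<Oplus>i\<in>I. y (u i) \<otimes> (gam j (v i) \<otimes> bet j m))" .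
    show "(\<Oplus>i\<in>I. y (u i) \<otimes> (gam j (v i) \<otimes> bet j m)) \<in> carrier M"
      using y j m by (intro finsum_closed) simp
  qed
  also have "\<dots> = (\<Oplus>i\<in>I. \<Oplus>j\<in>{..<k}. y (u i) \<otimes> (gam j (v i) \<otimes> bet j m))"
    using y m by (intro finsum_swap) simp_all
  also have "\<dots> = (\<Oplus>i\<in>I. y (u i \<otimes> E (v i \<otimes> m)))"
  proof (rule finsum_congI)
    fix i assume i: "i \<in> I"
    have "(\<Oplus>j\<in>{..<k}. y (u i) \<otimes> (gam j (v i) \<otimes> bet j m)) = y (u i) \<otimes> (\<Oplus>j\<in>{..<k}. gam j (v i) \<otimes> bet j m)"
      using y i m by (intro finsum_rdistr[symmetric]) auto
    then show "(\<Oplus>j\<in>{..<k}. y (u i) \<otimes> (gam j (v i) \<otimes> bet j m)) = y (u i \<otimes> E (v i \<otimes> m))"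
      using i m by (simp add: gam_bet right)
    show "y (u i \<otimes> E (v i \<otimes> m)) \<in> carrier M" using i m y by simp
  qed
  also have "\<dots> = y (\<Oplus>i\<in>I. u i \<otimes> E (v i \<otimes> m))"
    using y add m by (intro additive_finsum_map[symmetric]) simp_all
  finally show ?thesis using m by (simp add: quasibasis_right)
qed

lemma coef_expand:
  assumes y: "y \<in> carrier A"
  shows "(\<Oplus>\<^bsub>A\<^esub>j\<in>{..<k}. lmul M (coef j y) \<otimes>\<^bsub>A\<^esub> bet j) = y"
proof (rule A_eqI)
  show "(\<Oplus>\<^bsub>A\<^esub>j\<in>{..<k}. lmul M (coef j y) \<otimes>\<^bsub>A\<^esub> bet j) \<in> carrier A"
    using y by (intro A.finsum_closed) simp
  fix m assume m: "m \<in> carrier M"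
  have "(\<Oplus>\<^bsub>A\<^esub>j\<in>{..<k}. lmul M (coef j y) \<otimes>\<^bsub>A\<^esub> bet j) m = (\<Oplus>j\<in>{..<k}. (lmul M (coef j y) \<otimes>\<^bsub>A\<^esub> bet j) m)"
    using y m by (intro A_finsum_apply) simp_all
  also have "\<dots> = (\<Oplus>j\<in>{..<k}. coef j y \<otimes> bet j m)"
    using y m by (intro finsum_congI) simp_all
  also have "\<dots> = y m"
    unfolding coef_def by (rule gam_bet_expand) (use y m in \<open>simp_all add: A_add A_right\<close>)
  finally show "(\<Oplus>\<^bsub>A\<^esub>j\<in>{..<k}. lmul M (coef j y) \<otimes>\<^bsub>A\<^esub> bet j) m = y m" .
qed (rule y)

abbreviation ev :: "(('m \<Rightarrow> 'm) \<times> ('m \<Rightarrow> 'm) \<Rightarrow>\<^sub>0 int) \<Rightarrow> 'm \<Rightarrow> 'm \<Rightarrow> 'm" where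
  "ev c m m' \<equiv> frag_eval M (\<lambda>(x, y). x m \<otimes> y m') c"

abbreviation ev3 :: "(('m \<Rightarrow> 'm) \<times> ('m \<Rightarrow> 'm) \<times> ('m \<Rightarrow> 'm) \<Rightarrow>\<^sub>0 int) \<Rightarrow> 'm \<Rightarrow> 'm \<Rightarrow> 'm \<Rightarrow> 'm" where
  "ev3 c m m' m'' \<equiv> frag_eval M (\<lambda>(x, y, z). x m \<otimes> (y m' \<otimes> z m'')) c"

abbreviation "AA \<equiv> carrier A \<times> carrier A"
abbreviation "AAA \<equiv> carrier A \<times> carrier A \<times> carrier A"

lemma ev_fun:
  "m \<in> carrier M \<Longrightarrow> m' \<in> carrier M \<Longrightarrow> (\<lambda>(x, y). x m \<otimes> y m') \<in> AA \<rightarrow> carrier M"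
  by auto

lemma ev3_fun:
  "m \<in> carrier M \<Longrightarrow> m' \<in> carrier M \<Longrightarrow> m'' \<in> carrier M \<Longrightarrow>
    (\<lambda>(x, y, z). x m \<otimes> (y m' \<otimes> z m'')) \<in> AAA \<rightarrow> carrier M"
  by auto

lemma ev_diff: "keys c \<subseteq> AA \<Longrightarrow> keys d \<subseteq> AA \<Longrightarrow> m \<in> carrier M \<Longrightarrow>
    m' \<in> carrier M \<Longrightarrow> ev (c - d) m m' = ev c m m' \<ominus> ev d m m'"
  by (rule frag_eval_diff[OF _ _ ev_fun])

lemma ev_closed: "keys c \<subseteq> AA \<Longrightarrow> m \<in> carrier M \<Longrightarrow> m' \<in> carrier M \<Longrightarrow> ev c m m' \<in> carrier M"
  by (rule frag_eval_closed[OF _ ev_fun])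

lemma ev_of [simp]: "x \<in> carrier A \<Longrightarrow> y \<in> carrier A \<Longrightarrow> m \<in> carrier M \<Longrightarrow> m' \<in> carrier M \<Longrightarrow>
    ev (frag_of (x, y)) m m' = x m \<otimes> y m'"
  by (simp add: frag_eval_of)

lemma frag_eval_coef:
  assumes c: "keys c \<subseteq> AA" and j: "j < k" and m: "m \<in> carrier M"
  shows "frag_eval A (\<lambda>(x, y). rmul M (coef j y) \<otimes>\<^bsub>A\<^esub> x) c m = (\<Oplus>i\<in>I. ev c m (u i) \<otimes> gam j (v i))"
proof -
  have "frag_eval A (\<lambda>(x, y). rmul M (coef j y) \<otimes>\<^bsub>A\<^esub> x) c m =
      frag_eval M (\<lambda>p. (case p of (x, y) \<Rightarrow> rmul M (coef j y) \<otimes>\<^bsub>A\<^esub> x) m) c"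
    using j m by (intro frag_eval_A_apply[OF c]) auto
  also have "\<dots> = frag_eval M (\<lambda>p. \<Oplus>i\<in>I. (case p of (x, y) \<Rightarrow> x m \<otimes> y (u i)) \<otimes> gam j (v i)) c"
  proof (rule frag_eval_cong)
    fix p assume "p \<in> keys c"
    then obtain x y where p: "p = (x, y)" "x \<in> carrier A" "y \<in> carrier A" using c by auto
    have "x m \<otimes> coef j y = (\<Oplus>i\<in>I. x m \<otimes> (y (u i) \<otimes> gam j (v i)))"
      unfolding coef_def using p m j by (intro finsum_rdistr) auto
    also have "\<dots> = (\<Oplus>i\<in>I. x m \<otimes> y (u i) \<otimes> gam j (v i))"
      using p m j by (intro finsum_congI) (simp_all add: m_assoc)
    finally show "(case p of (x, y) \<Rightarrow> rmul M (coef j y) \<otimes>\<^bsub>A\<^esub> x) m =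
        (\<Oplus>i\<in>I. (case p of (x, y) \<Rightarrow> x m \<otimes> y (u i)) \<otimes> gam j (v i))"
      using p m j by simp
  qed (use c m j in \<open>auto intro!: finsum_closed\<close>)
  also have "\<dots> = (\<Oplus>i\<in>I. frag_eval M (\<lambda>p. (case p of (x, y) \<Rightarrow> x m \<otimes> y (u i)) \<otimes> gam j (v i)) c)"
    by (rule frag_eval_finsum[OF c]) (use m j in auto)
  also have "\<dots> = (\<Oplus>i\<in>I. ev c m (u i) \<otimes> gam j (v i))"
  proof (rule finsum_congI)
    fix i assume i: "i \<in> I"
    show "frag_eval M (\<lambda>p. (case p of (x, y) \<Rightarrow> x m \<otimes> y (u i)) \<otimes> gam j (v i)) c = ev c m (u i) \<otimes> gam j (v i)"
      by (rule hom_eval_M[OF _ _ c, where F = "\<lambda>x. x \<otimes> gam j (v i)", symmetric])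
        (use i j m ev_fun[OF m, of "u i"] in \<open>simp_all add: l_distr\<close>)
    show "ev c m (u i) \<otimes> gam j (v i) \<in> carrier M" using ev_closed[OF c m, of "u i"] i j by simp
  qed
  finally show ?thesis .
qed

lemma VL_class_eqI:
  assumes c: "keys c \<subseteq> AA" and d: "keys d \<subseteq> AA"
    and ev: "\<And>m m'. m \<in> carrier M \<Longrightarrow> m' \<in> carrier M \<Longrightarrow> ev c m m' = ev d m m'"
  shows "tensor_class VL c = tensor_class VL d"
proof (rule VL.tensor_class_eqI[of "{..<k}" bet coef])
  fix j assume "j \<in> {..<k}"
  then have j: "j < k" by simp
  have fA: "(\<lambda>(x, y). rmul M (coef j y) \<otimes>\<^bsub>A\<^esub> x) \<in> AA \<rightarrow> carrier A" using j by auto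
  have "frag_eval A (\<lambda>(x, y). rmul M (coef j y) \<otimes>\<^bsub>A\<^esub> x) c = frag_eval A (\<lambda>(x, y). rmul M (coef j y) \<otimes>\<^bsub>A\<^esub> x) d"
  proof (rule A_eqI)
    show "frag_eval A (\<lambda>(x, y). rmul M (coef j y) \<otimes>\<^bsub>A\<^esub> x) c \<in> carrier A"
      and "frag_eval A (\<lambda>(x, y). rmul M (coef j y) \<otimes>\<^bsub>A\<^esub> x) d \<in> carrier A"
      using VL.frag_eval_closed[OF _ fA[folded VL_simps(2)]] c d by simp_all
    fix m assume m: "m \<in> carrier M"
    have "(\<Oplus>i\<in>I. ev c m (u i) \<otimes> gam j (v i)) = (\<Oplus>i\<in>I. ev d m (u i) \<otimes> gam j (v i))"
      using ev m j ev_closed[OF d m] by (intro finsum_congI) simp_all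
    then show "frag_eval A (\<lambda>(x, y). rmul M (coef j y) \<otimes>\<^bsub>A\<^esub> x) c m = frag_eval A (\<lambda>(x, y). rmul M (coef j y) \<otimes>\<^bsub>A\<^esub> x) d m"
      by (simp add: frag_eval_coef[OF c j m] frag_eval_coef[OF d j m])
  qed
  then show "frag_eval (bm_grp VL) (\<lambda>(x, y). bm_r VL x (coef j y)) c = frag_eval (bm_grp VL) (\<lambda>(x, y). bm_r VL x (coef j y)) d"
    by simp
qed (use c d in \<open>simp_all add: coef_expand\<close>)

lemma VL_rel_ev:
  assumes c: "keys c \<subseteq> AA" and d: "keys d \<subseteq> AA"
    and cd: "tensor_class VL c = tensor_class VL d" and m: "m \<in> carrier M" "m' \<in> carrier M"
  shows "ev c m m' = ev d m m'"
proof -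
  have "ev (c - d) m m' = \<zero>"
  proof (rule VL.T2.rel_eval_0)
    show "c - d \<in> VL.T2.rel" using cd by (simp add: VL.tensor_class_eq_iff)
    fix g assume "g \<in> tensor_gens VL"
    then show "ev g m m' = \<zero>"
    proof (induction rule: VL.tensor_gens_elim)
      case (middle x l y)
      then show ?case
        using m by (simp add: ev_diff m_assoc minus_self)
    qed (use m in \<open>simp_all add: ev_diff keys_diff_subset l_distr r_distr sum_minus_summands\<close>)
  qed (use is_abelian_group ev_fun[OF m] in simp_all)
  then show ?thesis
    using minus_eq_zeroD[OF ev_closed[OF c m] ev_closed[OF d m]] ev_diff[OF c d m] by simp
qed

end

context additive_group
begin

lemma frag_eval_zero: "frag_eval G (\<lambda>p. \<zero>) c = \<zero>"
  by (rule frag_eval_unique[of c UNIV, symmetric]) (simp_all add: minus_self)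

lemma frag_eval_minus_fun:
  assumes c: "keys c \<subseteq> U" and f: "f \<in> U \<rightarrow> carrier G" and g: "g \<in> U \<rightarrow> carrier G"
  shows "frag_eval G (\<lambda>p. f p \<ominus> g p) c = frag_eval G f c \<ominus> frag_eval G g c"
proof (rule frag_eval_unique[OF c, symmetric])
  fix c d :: "'b \<Rightarrow>\<^sub>0 int" assume cd: "keys c \<subseteq> U" "keys d \<subseteq> U"
  note closed = frag_eval_closed[OF _ f] frag_eval_closed[OF _ g]
  show "frag_eval G f (c - d) \<ominus> frag_eval G g (c - d) =
      (frag_eval G f c \<ominus> frag_eval G g c) \<ominus> (frag_eval G f d \<ominus> frag_eval G g d)"
    using cd closed[OF cd(1)] closed[OF cd(2)]
    by (simp add: frag_eval_diff[OF _ _ f] frag_eval_diff[OF _ _ g] a_minus_def minus_add a_ac)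
qed (use f g in \<open>simp_all add: Pi_iff frag_eval_of minus_self\<close>)

lemma frag_eval_swap:
  assumes c: "keys c \<subseteq> U" and d: "keys d \<subseteq> W"
    and f: "\<And>p q. p \<in> U \<Longrightarrow> q \<in> W \<Longrightarrow> f p q \<in> carrier G"
  shows "frag_eval G (\<lambda>p. frag_eval G (f p) d) c = frag_eval G (\<lambda>q. frag_eval G (\<lambda>p. f p q) c) d"
proof (rule frag_eval_unique[OF c, symmetric])
  show "(\<lambda>p. frag_eval G (f p) d) \<in> U \<rightarrow> carrier G"
    using f by (intro funcsetI frag_eval_closed[OF d]) auto
  show "frag_eval G (\<lambda>q. frag_eval G (\<lambda>p. f p q) 0) d = \<zero>"
    by (simp add: frag_eval_zero)
  show "frag_eval G (\<lambda>q. frag_eval G (\<lambda>p. f p q) (frag_of p)) d = frag_eval G (f p) d" if "p \<in> U" for p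
    using that d f by (intro frag_eval_cong) (auto simp: frag_eval_of)
  fix c c' :: "'b \<Rightarrow>\<^sub>0 int" assume cc': "keys c \<subseteq> U" "keys c' \<subseteq> U"
  have fU: "(\<lambda>p. f p q) \<in> U \<rightarrow> carrier G" if "q \<in> W" for q using that f by auto
  have "frag_eval G (\<lambda>q. frag_eval G (\<lambda>p. f p q) (c - c')) d =
      frag_eval G (\<lambda>q. frag_eval G (\<lambda>p. f p q) c \<ominus> frag_eval G (\<lambda>p. f p q) c') d"
  proof (rule frag_eval_cong)
    fix q assume "q \<in> keys d"
    then show "frag_eval G (\<lambda>p. f p q) (c - c') = frag_eval G (\<lambda>p. f p q) c \<ominus> frag_eval G (\<lambda>p. f p q) c'"
      using d by (intro frag_eval_diff[OF cc' fU]) auto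
  qed (use d cc' in \<open>auto intro!: frag_eval_closed[OF _ fU]\<close>)
  also have "\<dots> = frag_eval G (\<lambda>q. frag_eval G (\<lambda>p. f p q) c) d \<ominus> frag_eval G (\<lambda>q. frag_eval G (\<lambda>p. f p q) c') d"
    using cc' by (intro frag_eval_minus_fun[OF d] funcsetI frag_eval_closed[OF _ fU])
  finally show "frag_eval G (\<lambda>q. frag_eval G (\<lambda>p. f p q) (c - c')) d =
      frag_eval G (\<lambda>q. frag_eval G (\<lambda>p. f p q) c) d \<ominus> frag_eval G (\<lambda>q. frag_eval G (\<lambda>p. f p q) c') d" .
qed

end

lemma (in bimod) self_in_tensor_class: "c \<in> tensor_class V c"
  by (simp add: mem_tensor_class_iff)

lemma (in bimod) mem_carrier_tensor:
  assumes "T \<in> carrier (tensor V)" "c \<in> T"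
  shows "keys c \<subseteq> carrier X \<times> carrier X" "T = tensor_class V c"
proof -
  obtain d where d: "keys d \<subseteq> carrier X \<times> carrier X" "T = tensor_class V d"
    using assms(1) by (auto simp: carrier_tensor)
  have r: "c - d \<in> T2.rel" using assms(2) d(2) by (simp add: mem_tensor_class_iff)
  show "T = tensor_class V c"
    using T2.rel_sym[OF r] d(2) by (simp add: tensor_class_eq_iff)
  show "keys c \<subseteq> carrier X \<times> carrier X"
    using keys_add_subset[OF T2.rel_keys[OF r] d(1)] by simp
qed

context dual_bases
begin

lemma frag_eval_coef3:
  assumes c: "keys c \<subseteq> AAA" and j: "j < k" and l: "l < k" and m: "m \<in> carrier M"
  shows "frag_eval A (\<lambda>(x, y, z). rmul M (coef l (rmul M (coef j z) \<otimes>\<^bsub>A\<^esub> y)) \<otimes>\<^bsub>A\<^esub> x) c m =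
    (\<Oplus>i\<in>I. \<Oplus>i'\<in>I. ev3 c m (u i) (u i') \<otimes> (gam j (v i') \<otimes> gam l (v i)))"
proof -
  let ?f = "\<lambda>(x, y, z). rmul M (coef l (rmul M (coef j z) \<otimes>\<^bsub>A\<^esub> y)) \<otimes>\<^bsub>A\<^esub> x"
    and ?e = "\<lambda>i i' (x, y, z). x m \<otimes> (y (u i) \<otimes> z (u i'))"
    and ?g = "\<lambda>i i'. gam j (v i') \<otimes> gam l (v i)"
  have "frag_eval A ?f c m = frag_eval M (\<lambda>p. ?f p m) c"
    using j l m by (intro frag_eval_A_apply[OF c]) auto
  also have "\<dots> = frag_eval M (\<lambda>p. \<Oplus>i\<in>I. \<Oplus>i'\<in>I. ?e i i' p \<otimes> ?g i i') c"
  proof (rule frag_eval_cong)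
    fix p assume "p \<in> keys c"
    then obtain x y z where p: "p = (x, y, z)" "x \<in> carrier A" "y \<in> carrier A" "z \<in> carrier A" using c by auto
    have "x m \<otimes> coef l (rmul M (coef j z) \<otimes>\<^bsub>A\<^esub> y) = (\<Oplus>i\<in>I. x m \<otimes> (y (u i) \<otimes> coef j z \<otimes> gam l (v i)))"
    proof -
      have "coef l (rmul M (coef j z) \<otimes>\<^bsub>A\<^esub> y) = (\<Oplus>i\<in>I. y (u i) \<otimes> coef j z \<otimes> gam l (v i))"
        unfolding coef_def[of l] using p j l by (intro finsum_congI) simp_all
      then show ?thesis using p m j l finsum_rdistr[of I "x m" "\<lambda>i. y (u i) \<otimes> coef j z \<otimes> gam l (v i)"] by auto
    qed
    also have "\<dots> = (\<Oplus>i\<in>I. \<Oplus>i'\<in>I. (x m \<otimes> (y (u i) \<otimes> z (u i'))) \<otimes> ?g i i')"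
    proof (rule finsum_congI)
      fix i assume i: "i \<in> I"
      have "x m \<otimes> (y (u i) \<otimes> coef j z \<otimes> gam l (v i)) =
          (\<Oplus>i'\<in>I. x m \<otimes> (y (u i) \<otimes> (z (u i') \<otimes> gam j (v i')) \<otimes> gam l (v i)))"
        unfolding coef_def
        by (rule additive_finsum_map[where F = "\<lambda>w. x m \<otimes> (y (u i) \<otimes> w \<otimes> gam l (v i))"])
          (use p i j l m in \<open>simp_all add: l_distr r_distr\<close>)
      also have "\<dots> = (\<Oplus>i'\<in>I. (x m \<otimes> (y (u i) \<otimes> z (u i'))) \<otimes> ?g i i')"
        using p i j l m by (intro finsum_congI) (simp_all add: m_assoc)
      finally show "x m \<otimes> (y (u i) \<otimes> coef j z \<otimes> gam l (v i)) =
        (\<Oplus>i'\<in>I. (x m \<otimes> (y (u i) \<otimes> z (u i'))) \<otimes> ?g i i')" .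
    qed (use p j l m in \<open>auto intro!: finsum_closed\<close>)
    finally show "?f p m =
        (\<Oplus>i\<in>I. \<Oplus>i'\<in>I. ?e i i' p \<otimes> ?g i i')"
      using p m j l by simp
  qed (use c m j l in \<open>auto intro!: finsum_closed\<close>)
  also have "\<dots> = (\<Oplus>i\<in>I. frag_eval M (\<lambda>p. \<Oplus>i'\<in>I. ?e i i' p \<otimes> ?g i i') c)"
    by (rule frag_eval_finsum[OF c]) (use m j l in \<open>auto intro!: finsum_closed\<close>)
  also have "\<dots> = (\<Oplus>i\<in>I. \<Oplus>i'\<in>I. ev3 c m (u i) (u i') \<otimes> ?g i i')"
  proof (rule finsum_congI)
    fix i assume i: "i \<in> I"
    have "frag_eval M (\<lambda>p. \<Oplus>i'\<in>I. ?e i i' p \<otimes> ?g i i') c =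
      (\<Oplus>i'\<in>I. frag_eval M (\<lambda>p. ?e i i' p \<otimes> ?g i i') c)"
      by (rule frag_eval_finsum[OF c]) (use i m j l in auto)
    also have "\<dots> = (\<Oplus>i'\<in>I. ev3 c m (u i) (u i') \<otimes> ?g i i')"
    proof (rule finsum_congI)
      fix i' assume i': "i' \<in> I"
      note f = ev3_fun[OF m u_closed[OF i] u_closed[OF i']]
      show "frag_eval M (\<lambda>p. ?e i i' p \<otimes> ?g i i') c = ev3 c m (u i) (u i') \<otimes> ?g i i'"
        by (rule hom_eval_M[OF _ _ c f,
            where F = "\<lambda>x. x \<otimes> ?g i i'", symmetric])
          (use i i' j l m in \<open>simp_all add: l_distr\<close>)
      show "ev3 c m (u i) (u i') \<otimes> ?g i i' \<in> carrier M"
        using frag_eval_closed[OF c f] i i' j l by simp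
    qed
    finally show "frag_eval M (\<lambda>p. \<Oplus>i'\<in>I. ?e i i' p \<otimes> ?g i i') c =
      (\<Oplus>i'\<in>I. ev3 c m (u i) (u i') \<otimes> ?g i i')" .
  qed (use j l m frag_eval_closed[OF c ev3_fun[OF m]] in \<open>auto intro!: finsum_closed\<close>)
  finally show ?thesis .
qed

lemma VL_class3_eqI:
  assumes c: "keys c \<subseteq> AAA" and d: "keys d \<subseteq> AAA"
    and ev: "\<And>m m' m''. m \<in> carrier M \<Longrightarrow> m' \<in> carrier M \<Longrightarrow> m'' \<in> carrier M \<Longrightarrow> ev3 c m m' m'' = ev3 d m m' m''"
  shows "tensor3_class VL c = tensor3_class VL d"
proof (rule VL.tensor3_class_eqI[of "{..<k}" bet coef])
  fix j l assume "j \<in> {..<k}" "l \<in> {..<k}"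
  then have jl: "j < k" "l < k" by simp_all
  let ?f = "\<lambda>(x, y, z). rmul M (coef l (rmul M (coef j z) \<otimes>\<^bsub>A\<^esub> y)) \<otimes>\<^bsub>A\<^esub> x"
  have fA: "?f \<in> AAA \<rightarrow> carrier A" using jl by auto
  have "frag_eval A ?f c = frag_eval A ?f d"
  proof (rule A_eqI)
    show "frag_eval A ?f c \<in> carrier A" and "frag_eval A ?f d \<in> carrier A"
      using VL.frag_eval_closed[OF _ fA[folded VL_simps(2)]] c d by simp_all
    fix m assume m: "m \<in> carrier M"
    show "frag_eval A ?f c m = frag_eval A ?f d m"
      unfolding frag_eval_coef3[OF c jl m] frag_eval_coef3[OF d jl m]
      by (intro finsum_congI finsum_closed funcsetI)
        (use ev m jl frag_eval_closed[OF d ev3_fun[OF m]] in simp_all)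
  qed
  then show "frag_eval (bm_grp VL) (\<lambda>(x, y, z). bm_r VL x (coef l (bm_r VL y (coef j z)))) c =
      frag_eval (bm_grp VL) (\<lambda>(x, y, z). bm_r VL x (coef l (bm_r VL y (coef j z)))) d"
    by simp
qed (use c d in \<open>simp_all add: coef_expand\<close>)

definition coproduct_frag :: "('m \<Rightarrow> 'm) \<Rightarrow> ('m \<Rightarrow> 'm) \<times> ('m \<Rightarrow> 'm) \<Rightarrow>\<^sub>0 int" where
  "coproduct_frag a =
    (\<Sum>j<k. frag_of (restrict (\<lambda>m. \<Oplus>i\<in>I. a (m \<otimes> u i) \<otimes> gam j (v i)) (carrier M), bet j))"

lemma coproduct_frag:
  assumes a: "a \<in> carrier A"
  shows "keys (coproduct_frag a) \<subseteq> AA"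
    and "m \<in> carrier M \<Longrightarrow> m' \<in> carrier M \<Longrightarrow> ev (coproduct_frag a) m m' = a (m \<otimes> m')"
proof -
  let ?f = "\<lambda>j m. \<Oplus>i\<in>I. a (m \<otimes> u i) \<otimes> gam j (v i)"
  have f: "restrict (?f j) (carrier M) \<in> carrier A" if j: "j < k" for j
  proof (rule A_I)
    fix m m' assume m: "m \<in> carrier M" "m' \<in> carrier M"
    show "?f j m \<in> carrier M" using m a j by (intro finsum_closed) simp
    have "?f j (m \<oplus> m') = (\<Oplus>i\<in>I. a (m \<otimes> u i) \<otimes> gam j (v i) \<oplus> a (m' \<otimes> u i) \<otimes> gam j (v i))"
      using m a j by (intro finsum_congI) (simp_all add: l_distr A_add)
    also have "\<dots> = ?f j m \<oplus> ?f j m'"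
      using m a j by (intro finsum_addf) auto
    finally show "?f j (m \<oplus> m') = ?f j m \<oplus> ?f j m'" .
  next
    fix n m assume m: "n \<in> carrier N" "m \<in> carrier M"
    have "?f j (h n \<otimes> m) = (\<Oplus>i\<in>I. h n \<otimes> (a (m \<otimes> u i) \<otimes> gam j (v i)))"
      using m a j by (intro finsum_congI) (simp_all add: A_left m_assoc)
    also have "\<dots> = h n \<otimes> ?f j m"
      using m a j by (intro finsum_rdistr[symmetric]) auto
    finally show "?f j (h n \<otimes> m) = h n \<otimes> ?f j m" .
    have "?f j (m \<otimes> h n) = (\<Oplus>i\<in>I. a (m \<otimes> (h n \<otimes> u i)) \<otimes> gam j (v i))"
      using m a j by (intro finsum_congI) (simp_all add: m_assoc)
    also have "\<dots> = ?f j m \<otimes> h n"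
      by (rule casimir_product[where y = "\<lambda>p. a (m \<otimes> p)"])
        (use m a j in \<open>simp_all add: r_distr A_add A_right m_assoc[symmetric]\<close>)
    finally show "?f j (m \<otimes> h n) = ?f j m \<otimes> h n" .
  qed
  have keys: "keys (frag_of (restrict (?f j) (carrier M), bet j)) \<subseteq> AA" if "j \<in> {..<k}" for j
    using that f by simp
  then show "keys (coproduct_frag a) \<subseteq> AA"
    unfolding coproduct_frag_def by (rule keys_sum_subset)
  assume m: "m \<in> carrier M" "m' \<in> carrier M"
  have "ev (coproduct_frag a) m m' = (\<Oplus>j\<in>{..<k}. ev (frag_of (restrict (?f j) (carrier M), bet j)) m m')"
    unfolding coproduct_frag_def by (rule frag_eval_sum[OF keys ev_fun[OF m]]) simp_all
  also have "\<dots> = (\<Oplus>j\<in>{..<k}. ?f j m \<otimes> bet j m')"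
  proof (rule finsum_congI)
    fix j assume j: "j \<in> {..<k}"
    then show "ev (frag_of (restrict (?f j) (carrier M), bet j)) m m' = ?f j m \<otimes> bet j m'"
      using m f by simp
    show "?f j m \<otimes> bet j m' \<in> carrier M"
      using j m a by (intro m_closed finsum_closed funcsetI) simp_all
  qed
  also have "\<dots> = a (m \<otimes> m')"
    by (rule gam_bet_expand[where y = "\<lambda>p. a (m \<otimes> p)"])
      (use m a in \<open>simp_all add: r_distr A_add A_right m_assoc[symmetric]\<close>)
  finally show "ev (coproduct_frag a) m m' = a (m \<otimes> m')" .
qed

abbreviation "copL \<equiv> coproduct_L N M h"

lemma coproduct_L_eq:
  assumes c: "keys c \<subseteq> AA"
    and ev: "\<And>m m'. m \<in> carrier M \<Longrightarrow> m' \<in> carrier M \<Longrightarrow> ev c m m' = a (m \<otimes> m')"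
  shows "copL a = tensor_class VL c"
  unfolding coproduct_L_def
proof (rule the_equality)
  have "tensor_class VL c \<in> carrier (tensor VL)" using c by (auto simp: VL.carrier_tensor)
  moreover have "a (m \<otimes> m') = ev d m m'"
    if d: "d \<in> tensor_class VL c" and m: "m \<in> carrier M" "m' \<in> carrier M" for d m m'
    using VL_rel_ev[OF c VL.mem_carrier_tensor(1)[OF calculation d, unfolded VL_simps]
      VL.mem_carrier_tensor(2)[OF calculation d] m] ev[OF m] by simp
  ultimately show "tensor_class VL c \<in> carrier (tensor VL) \<and>
      (\<forall>d\<in>tensor_class VL c. \<forall>m\<in>carrier M. \<forall>m'\<in>carrier M. a (m \<otimes> m') = ev d m m')"
    by simp
  fix T assume T: "T \<in> carrier (tensor VL) \<and>
      (\<forall>d\<in>T. \<forall>m\<in>carrier M. \<forall>m'\<in>carrier M. a (m \<otimes> m') = ev d m m')"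
  then obtain d where d: "keys d \<subseteq> AA" "T = tensor_class VL d"
    by (auto simp: VL.carrier_tensor)
  have "d \<in> T" unfolding d(2) by (rule VL.self_in_tensor_class)
  with T have "ev d m m' = ev c m m'" if "m \<in> carrier M" "m' \<in> carrier M" for m m'
    using ev[OF that] that by simp
  then show "T = tensor_class VL c"
    unfolding d(2) by (rule VL_class_eqI[OF d(1) c])
qed

lemma coproduct_L_in_tensor:
  assumes a: "a \<in> carrier A" shows "copL a \<in> carrier (tensor VL)"
  using coproduct_L_eq[of _ a, OF coproduct_frag[OF a]] coproduct_frag(1)[OF a]
  by (auto simp: VL.carrier_tensor)

lemma coproduct_L_D:
  assumes a: "a \<in> carrier A" and c: "c \<in> copL a"
  shows "keys c \<subseteq> AA" "copL a = tensor_class VL c"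
    and "m \<in> carrier M \<Longrightarrow> m' \<in> carrier M \<Longrightarrow> ev c m m' = a (m \<otimes> m')"
proof -
  note T = VL.mem_carrier_tensor[OF coproduct_L_in_tensor[OF a] c]
  show keys: "keys c \<subseteq> AA" using T(1) by simp
  show "copL a = tensor_class VL c" by (rule T(2))
  then have eq: "tensor_class VL c = tensor_class VL (coproduct_frag a)"
    using coproduct_L_eq[of _ a, OF coproduct_frag[OF a]] by simp
  assume "m \<in> carrier M" "m' \<in> carrier M"
  then show "ev c m m' = a (m \<otimes> m')"
    using VL_rel_ev[OF keys coproduct_frag(1)[OF a] eq] coproduct_frag(2)[OF a] by simp
qed

lemma coproduct_L_I:
  assumes "keys c \<subseteq> AA"
    and "\<And>m m'. m \<in> carrier M \<Longrightarrow> m' \<in> carrier M \<Longrightarrow> ev c m m' = a (m \<otimes> m')"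
  shows "c \<in> copL a"
proof -
  have "copL a = tensor_class VL c" by (rule coproduct_L_eq[OF assms])
  with VL.self_in_tensor_class show ?thesis by simp
qed

abbreviation "BL \<equiv> left_bialgebroid_of N M h"

lemma ev_frag_map:
  assumes c: "keys c \<subseteq> AA" and f: "f \<in> AA \<rightarrow> AA"
    and F: "\<And>x. x \<in> carrier M \<Longrightarrow> F x \<in> carrier M"
    and add: "\<And>x y. x \<in> carrier M \<Longrightarrow> y \<in> carrier M \<Longrightarrow> F (x \<oplus> y) = F x \<oplus> F y"
    and m: "m \<in> carrier M" "m' \<in> carrier M" and p: "p \<in> carrier M" "p' \<in> carrier M"
    and eq: "\<And>x y. x \<in> carrier A \<Longrightarrow> y \<in> carrier A \<Longrightarrow> fst (f (x, y)) m \<otimes> snd (f (x, y)) m' = F (x p \<otimes> y p')"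
  shows "ev (frag_map f c) m m' = F (ev c p p')"
proof -
  have "ev (frag_map f c) m m' = frag_eval M (\<lambda>z. case f z of (x, y) \<Rightarrow> x m \<otimes> y m') c"
    by (rule frag_eval_map[OF c f ev_fun[OF m]])
  also have "\<dots> = frag_eval M (\<lambda>z. F (case z of (x, y) \<Rightarrow> x p \<otimes> y p')) c"
    by (rule frag_eval_cong) (use c eq F p in \<open>auto simp: split_beta\<close>)
  also have "\<dots> = F (ev c p p')"
    by (rule hom_eval_M[OF F add c ev_fun[OF p], symmetric])
  finally show ?thesis .
qed

lemma coproduct_L_add:
  assumes a: "a \<in> carrier A" and b: "b \<in> carrier A"
    and c: "c \<in> copL a" and d: "d \<in> copL b"
  shows "c + d \<in> copL (a \<oplus>\<^bsub>A\<^esub> b)"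
proof (rule coproduct_L_I)
  note k = coproduct_L_D(1)[OF a c] coproduct_L_D(1)[OF b d]
  show "keys (c + d) \<subseteq> AA" using k by (rule keys_add_subset)
  show "ev (c + d) m m' = (a \<oplus>\<^bsub>A\<^esub> b) (m \<otimes> m')" if m: "m \<in> carrier M" "m' \<in> carrier M" for m m'
    using frag_eval_add[OF k ev_fun[OF m]] coproduct_L_D(3)[OF a c m] coproduct_L_D(3)[OF b d m] m
    by simp
qed

lemma coproduct_L_hom: "copL \<in> hom (add_monoid A) (tensor VL)"
proof (rule homI; simp only: monoid_record_simps)
  fix a b assume ab: "a \<in> carrier A" "b \<in> carrier A"
  have c: "coproduct_frag a \<in> copL a" by (rule coproduct_L_I[OF coproduct_frag[OF ab(1)]])
  have d: "coproduct_frag b \<in> copL b" by (rule coproduct_L_I[OF coproduct_frag[OF ab(2)]])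
  show "copL (a \<oplus>\<^bsub>A\<^esub> b) = copL a \<otimes>\<^bsub>tensor VL\<^esub> copL b"
    using coproduct_L_D(2)[OF A.a_closed[OF ab] coproduct_L_add[OF ab c d]]
      coproduct_L_D(2)[OF ab(1) c] coproduct_L_D(2)[OF ab(2) d] coproduct_frag(1)[OF ab(1)]
      coproduct_frag(1)[OF ab(2)] by (simp add: VL.tensor_mult)
qed (rule coproduct_L_in_tensor)

lemma coproduct_L_bimodule:
  assumes l: "l \<in> carrier L" and a: "a \<in> carrier A" and c: "c \<in> copL a"
  shows "frag_map (\<lambda>(x, y). (lmul M l \<otimes>\<^bsub>A\<^esub> x, y)) c \<in> copL (lmul M l \<otimes>\<^bsub>A\<^esub> a)"
    and "frag_map (\<lambda>(x, y). (x, rmul M l \<otimes>\<^bsub>A\<^esub> y)) c \<in> copL (rmul M l \<otimes>\<^bsub>A\<^esub> a)"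
proof -
  let ?f = "\<lambda>(x, y). (lmul M l \<otimes>\<^bsub>A\<^esub> x, y)"
    and ?g = "\<lambda>(x, y). (x, rmul M l \<otimes>\<^bsub>A\<^esub> y)"
  note keys = coproduct_L_D(1)[OF a c]
  have f: "?f \<in> AA \<rightarrow> AA" "?g \<in> AA \<rightarrow> AA"
    using l by auto
  show "frag_map ?f c \<in> copL (lmul M l \<otimes>\<^bsub>A\<^esub> a)"
  proof (rule coproduct_L_I[OF keys_map_subset[OF keys f(1)]])
    fix m m' assume m: "m \<in> carrier M" "m' \<in> carrier M"
    have "ev (frag_map ?f c) m m' = l \<otimes> ev c m m'"
      by (rule ev_frag_map[OF keys f(1) _ _ m m]) (use l m in \<open>simp_all add: r_distr m_assoc\<close>)
    then show "ev (frag_map ?f c) m m' = (lmul M l \<otimes>\<^bsub>A\<^esub> a) (m \<otimes> m')"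
      using coproduct_L_D(3)[OF a c m] m a by simp
  qed
  show "frag_map ?g c \<in> copL (rmul M l \<otimes>\<^bsub>A\<^esub> a)"
  proof (rule coproduct_L_I[OF keys_map_subset[OF keys f(2)]])
    fix m m' assume m: "m \<in> carrier M" "m' \<in> carrier M"
    have "ev (frag_map ?g c) m m' = ev c m m' \<otimes> l"
      by (rule ev_frag_map[OF keys f(2) _ _ m m]) (use l m in \<open>simp_all add: l_distr m_assoc\<close>)
    then show "ev (frag_map ?g c) m m' = (rmul M l \<otimes>\<^bsub>A\<^esub> a) (m \<otimes> m')"
      using coproduct_L_D(3)[OF a c m] m a by simp
  qed
qed

lemma coproduct_L_takeuchi:
  assumes l: "l \<in> carrier L" and a: "a \<in> carrier A" and c: "c \<in> copL a"
  shows "tensor_class VL (frag_map (\<lambda>(x, y). (x \<otimes>\<^bsub>A\<^esub> rmul M l, y)) c) =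
    tensor_class VL (frag_map (\<lambda>(x, y). (x, y \<otimes>\<^bsub>A\<^esub> lmul M l)) c)"
proof -
  let ?f = "\<lambda>(x, y). (x \<otimes>\<^bsub>A\<^esub> rmul M l, y)"
    and ?g = "\<lambda>(x, y). (x, y \<otimes>\<^bsub>A\<^esub> lmul M l)"
  note keys = coproduct_L_D(1)[OF a c]
  have f: "?f \<in> AA \<rightarrow> AA" "?g \<in> AA \<rightarrow> AA"
    using l by auto
  show ?thesis
  proof (rule VL_class_eqI[OF keys_map_subset[OF keys f(1)] keys_map_subset[OF keys f(2)]])
    fix m m' assume m: "m \<in> carrier M" "m' \<in> carrier M"
    have "ev (frag_map ?f c) m m' = ev c (m \<otimes> l) m'"
      by (rule ev_frag_map[OF keys f(1), where F = "\<lambda>x. x"]) (use l m in simp_all)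
    moreover have "ev (frag_map ?g c) m m' = ev c m (l \<otimes> m')"
      by (rule ev_frag_map[OF keys f(2), where F = "\<lambda>x. x"]) (use l m in simp_all)
    ultimately show "ev (frag_map ?f c) m m' =
        ev (frag_map ?g c) m m'"
      using coproduct_L_D(3)[OF a c] m l by (simp add: m_assoc)
  qed
qed

lemma coproduct_L_mult:
  assumes a: "a \<in> carrier A" and b: "b \<in> carrier A"
    and c: "c \<in> copL a" and d: "d \<in> copL b"
  shows "frag_extend (\<lambda>(x, y). frag_map (\<lambda>(x', y'). (x \<otimes>\<^bsub>A\<^esub> x', y \<otimes>\<^bsub>A\<^esub> y')) d) c \<in> copL (a \<otimes>\<^bsub>A\<^esub> b)"
proof -
  note kc = coproduct_L_D(1)[OF a c] and kd = coproduct_L_D(1)[OF b d]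
  let ?g = "\<lambda>(x, y). frag_map (\<lambda>(x', y'). (x \<otimes>\<^bsub>A\<^esub> x', y \<otimes>\<^bsub>A\<^esub> y')) d"
  have inner: "(\<lambda>(x', y'). (x \<otimes>\<^bsub>A\<^esub> x', y \<otimes>\<^bsub>A\<^esub> y')) \<in> AA \<rightarrow> AA" if "x \<in> carrier A" "y \<in> carrier A" for x y
    using that by auto
  have kg: "keys (?g z) \<subseteq> AA" if "z \<in> AA" for z
    using that keys_map_subset[OF kd inner] by (cases z) simp
  show ?thesis
  proof (rule coproduct_L_I[OF keys_extend_subset[OF kc kg]])
    fix m m' assume m: "m \<in> carrier M" "m' \<in> carrier M"
    have "ev (frag_extend ?g c) m m' = frag_eval M (\<lambda>z. ev (?g z) m m') c"
      by (rule frag_eval_extend[OF kc kg ev_fun[OF m]])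
    also have "\<dots> = frag_eval M (\<lambda>z. frag_eval M (\<lambda>w. fst z (fst w m) \<otimes> snd z (snd w m')) d) c"
    proof (rule frag_eval_cong)
      fix z assume "z \<in> keys c"
      then obtain x y where z: "z = (x, y)" "x \<in> carrier A" "y \<in> carrier A" using kc by auto
      have "ev (?g z) m m' = frag_eval M (\<lambda>w. case (case w of (x', y') \<Rightarrow> (x \<otimes>\<^bsub>A\<^esub> x', y \<otimes>\<^bsub>A\<^esub> y')) of (x, y) \<Rightarrow> x m \<otimes> y m') d"
        unfolding z(1) prod.case by (rule frag_eval_map[OF kd inner[OF z(2,3)] ev_fun[OF m]])
      also have "\<dots> = frag_eval M (\<lambda>w. x (fst w m) \<otimes> y (snd w m')) d"
        by (rule frag_eval_cong) (use kd z m in \<open>auto simp: split_beta\<close>)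
      finally show "ev (?g z) m m' = frag_eval M (\<lambda>w. fst z (fst w m) \<otimes> snd z (snd w m')) d"
        by (simp add: z(1))
    qed (use kc kd m in \<open>auto intro!: frag_eval_closed[OF kd]\<close>)
    also have "\<dots> = frag_eval M (\<lambda>w. frag_eval M (\<lambda>z. fst z (fst w m) \<otimes> snd z (snd w m')) c) d"
      by (rule frag_eval_swap[OF kc kd]) (use m in auto)
    also have "\<dots> = frag_eval M (\<lambda>w. a (case w of (x', y') \<Rightarrow> x' m \<otimes> y' m')) d"
    proof (rule frag_eval_cong)
      fix w assume "w \<in> keys d"
      then obtain x' y' where w: "w = (x', y')" "x' \<in> carrier A" "y' \<in> carrier A" using kd by auto
      show "frag_eval M (\<lambda>z. fst z (fst w m) \<otimes> snd z (snd w m')) c = a (case w of (x', y') \<Rightarrow> x' m \<otimes> y' m')"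
        using coproduct_L_D(3)[OF a c, of "x' m" "y' m'"] w m by (simp add: case_prod_unfold)
    qed (use a kd m in auto)
    also have "\<dots> = a (ev d m m')"
      by (rule hom_eval_M[OF _ _ kd ev_fun[OF m], symmetric])
        (use a in \<open>simp_all add: A_add\<close>)
    also have "\<dots> = (a \<otimes>\<^bsub>A\<^esub> b) (m \<otimes> m')"
      using coproduct_L_D(3)[OF b d m] m by simp
    finally show "ev (frag_extend ?g c) m m' = (a \<otimes>\<^bsub>A\<^esub> b) (m \<otimes> m')" .
  qed
qed

lemma coproduct_L_coassoc:
  assumes g: "\<And>a. a \<in> carrier A \<Longrightarrow> g a \<in> copL a"
    and a: "a \<in> carrier A" and c: "c \<in> copL a"
  shows "tensor3_class VL (frag_extend (\<lambda>(x, y). frag_map (\<lambda>(p, q). (p, q, y)) (g x)) c) =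
    tensor3_class VL (frag_extend (\<lambda>(x, y). frag_map (\<lambda>(p, q). (x, p, q)) (g y)) c)"
proof -
  note kc = coproduct_L_D(1)[OF a c] and kg = coproduct_L_D(1)[OF _ g]
  let ?l = "\<lambda>(x, y). frag_map (\<lambda>(p, q). (p, q, y)) (g x)"
  let ?r = "\<lambda>(x, y). frag_map (\<lambda>(p, q). (x, p, q)) (g y)"
  have il: "(\<lambda>(p, q). (p, q, y)) \<in> AA \<rightarrow> AAA" and ir: "(\<lambda>(p, q). (y, p, q)) \<in> AA \<rightarrow> AAA" if "y \<in> carrier A" for y
    using that by auto
  have kl: "keys (?l z) \<subseteq> AAA" if "z \<in> AA" for z
    using that keys_map_subset[OF kg il] by (cases z) simp
  have kr: "keys (?r z) \<subseteq> AAA" if "z \<in> AA" for z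
    using that keys_map_subset[OF kg ir] by (cases z) simp
  show ?thesis
  proof (rule VL_class3_eqI[OF keys_extend_subset[OF kc kl] keys_extend_subset[OF kc kr]])
    fix m m' m'' assume m: "m \<in> carrier M" "m' \<in> carrier M" "m'' \<in> carrier M"
    have "ev3 (frag_extend ?l c) m m' m'' = frag_eval M (\<lambda>z. ev3 (?l z) m m' m'') c"
      by (rule frag_eval_extend[OF kc kl ev3_fun[OF m]])
    also have "\<dots> = ev c (m \<otimes> m') m''"
    proof (rule frag_eval_cong)
      fix z assume "z \<in> keys c"
      then obtain x y where z: "z = (x, y)" "x \<in> carrier A" "y \<in> carrier A" using kc by auto
      have "ev3 (?l z) m m' m'' = frag_eval M (\<lambda>w. case (case w of (p, q) \<Rightarrow> (p, q, y)) of (x, y, z) \<Rightarrow> x m \<otimes> (y m' \<otimes> z m'')) (g x)"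
        unfolding z(1) prod.case by (rule frag_eval_map[OF kg[OF z(2) z(2)] il[OF z(3)] ev3_fun[OF m]])
      also have "\<dots> = frag_eval M (\<lambda>w. (case w of (p, q) \<Rightarrow> p m \<otimes> q m') \<otimes> y m'') (g x)"
        by (rule frag_eval_cong) (use kg[OF z(2) z(2)] z m in \<open>auto simp: m_assoc\<close>)
      also have "\<dots> = ev (g x) m m' \<otimes> y m''"
        by (rule hom_eval_M[OF _ _ kg[OF z(2) z(2)] ev_fun[OF m(1,2)],
            where F = "\<lambda>w. w \<otimes> y m''", symmetric]) (use z m in \<open>simp_all add: l_distr\<close>)
      finally show "ev3 (?l z) m m' m'' = (case z of (x, y) \<Rightarrow> x (m \<otimes> m') \<otimes> y m'')"
        using coproduct_L_D(3)[OF z(2) g[OF z(2)] m(1,2)] by (simp add: z(1))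
    qed (use kc m in auto)
    also have "\<dots> = ev c m (m' \<otimes> m'')"
      using coproduct_L_D(3)[OF a c] m by (simp add: m_assoc)
    also have "\<dots> = frag_eval M (\<lambda>z. ev3 (?r z) m m' m'') c"
    proof (rule frag_eval_cong[symmetric])
      fix z assume "z \<in> keys c"
      then obtain x y where z: "z = (x, y)" "x \<in> carrier A" "y \<in> carrier A" using kc by auto
      have "ev3 (?r z) m m' m'' = frag_eval M (\<lambda>w. case (case w of (p, q) \<Rightarrow> (x, p, q)) of (x, y, z) \<Rightarrow> x m \<otimes> (y m' \<otimes> z m'')) (g y)"
        unfolding z(1) prod.case by (rule frag_eval_map[OF kg[OF z(3) z(3)] ir[OF z(2)] ev3_fun[OF m]])
      also have "\<dots> = frag_eval M (\<lambda>w. x m \<otimes> (case w of (p, q) \<Rightarrow> p m' \<otimes> q m'')) (g y)"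
        by (rule frag_eval_cong) (use kg[OF z(3) z(3)] z m in auto)
      also have "\<dots> = x m \<otimes> ev (g y) m' m''"
        by (rule hom_eval_M[OF _ _ kg[OF z(3) z(3)] ev_fun[OF m(2,3)],
            where F = "\<lambda>w. x m \<otimes> w", symmetric]) (use z m in \<open>simp_all add: r_distr\<close>)
      finally show "ev3 (?r z) m m' m'' = (case z of (x, y) \<Rightarrow> x m \<otimes> y (m' \<otimes> m''))"
        using coproduct_L_D(3)[OF z(3) g[OF z(3)] m(2,3)] by (simp add: z(1))
    qed (use kc m in auto)
    also have "\<dots> = ev3 (frag_extend ?r c) m m' m''"
      by (rule frag_eval_extend[OF kc kr ev3_fun[OF m], symmetric])
    finally show "ev3 (frag_extend ?l c) m m' m'' = ev3 (frag_extend ?r c) m m' m''" .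
  qed
qed

lemma A_one_in_L [simp]: "a \<in> carrier A \<Longrightarrow> a \<one> \<in> carrier L"
  by (rule L_I) (simp_all add: A_left[symmetric] A_right[symmetric])

lemma coproduct_L_counit:
  assumes a: "a \<in> carrier A" and c: "c \<in> copL a"
  shows "frag_eval A (\<lambda>(x, y). lmul M (x \<one>) \<otimes>\<^bsub>A\<^esub> y) c = a"
    and "frag_eval A (\<lambda>(x, y). rmul M (y \<one>) \<otimes>\<^bsub>A\<^esub> x) c = a"
proof -
  let ?f = "\<lambda>(x, y). lmul M (x \<one>) \<otimes>\<^bsub>A\<^esub> y"
    and ?g = "\<lambda>(x, y). rmul M (y \<one>) \<otimes>\<^bsub>A\<^esub> x"
  note kc = coproduct_L_D(1)[OF a c]
  have f: "?f \<in> AA \<rightarrow> carrier A" "?g \<in> AA \<rightarrow> carrier A"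
    by auto
  show "frag_eval A ?f c = a"
  proof (rule A_eqI[OF VL.frag_eval_closed[OF _ f(1)[folded VL_simps(2)], unfolded VL_simps] a])
    fix m assume m: "m \<in> carrier M"
    have "frag_eval A ?f c m = frag_eval M (\<lambda>p. ?f p m) c"
      by (rule frag_eval_A_apply[OF kc f(1) m])
    also have "\<dots> = ev c \<one> m"
      by (rule frag_eval_cong) (use kc m in auto)
    finally show "frag_eval A ?f c m = a m"
      using coproduct_L_D(3)[OF a c, of \<one> m] m by simp
  qed (use kc in simp)
  show "frag_eval A ?g c = a"
  proof (rule A_eqI[OF VL.frag_eval_closed[OF _ f(2)[folded VL_simps(2)], unfolded VL_simps] a])
    fix m assume m: "m \<in> carrier M"
    have "frag_eval A ?g c m = frag_eval M (\<lambda>p. ?g p m) c"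
      by (rule frag_eval_A_apply[OF kc f(2) m])
    also have "\<dots> = ev c m \<one>"
      by (rule frag_eval_cong) (use kc m in auto)
    finally show "frag_eval A ?g c m = a m"
      using coproduct_L_D(3)[OF a c, of m \<one>] m by simp
  qed (use kc in simp)
qed

lemma coproduct_L_one: "frag_of (\<one>\<^bsub>A\<^esub>, \<one>\<^bsub>A\<^esub>) \<in> copL \<one>\<^bsub>A\<^esub>"
  by (rule coproduct_L_I) simp_all

lemma counit_L_hom: "(\<lambda>a. a \<one>) \<in> bimod_homs VL (regular_bimod L)"
  unfolding bimod_homs_def regular_bimod_def
  by (simp add: hom_def)

lemma comonoid_L: "comonoid_bimod VL (copL) (\<lambda>a. a \<one>)"
  unfolding comonoid_bimod_def Let_def VL_simps
  using VL.bimodule coproduct_L_hom counit_L_hom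
  by (intro conjI ballI allI impI)
    (simp_all add: coproduct_L_bimodule coproduct_L_counit coproduct_L_coassoc)

lemma core_L: "bialgebroid_core BL"
  unfolding bialgebroid_core_def left_bialgebroid_of_def Let_def bialgebroid.simps
  using ring_A ring_L lmul_hom rmul_hom
  by (intro conjI ballI)
    (simp_all add: lmul_rmul_commute coproduct_L_one coproduct_L_mult)

lemma left_bialgebroid_L: "left_bialgebroid BL"
  unfolding left_bialgebroid_def Let_def
proof (intro conjI ballI)
  show "bialgebroid_core BL" by (rule core_L)
qed (use comonoid_L coproduct_L_takeuchi in
    \<open>simp_all add: left_bialgebroid_of_def bimod_L_def\<close>)

end

section \<open>The right bialgebroid\<close>

context
  fixes V :: "('k, 'x) bimod" and W :: "('l, 'y) bimod" and f :: "'x \<Rightarrow> 'y" and \<phi> :: "'k \<Rightarrow> 'l"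
  assumes V: "bimod V" and W: "bimod W"
    and f: "\<And>x. x \<in> carrier (bm_grp V) \<Longrightarrow> f x \<in> carrier (bm_grp W)"
    and f_add: "\<And>x y. x \<in> carrier (bm_grp V) \<Longrightarrow> y \<in> carrier (bm_grp V) \<Longrightarrow>
      f (x \<oplus>\<^bsub>bm_grp V\<^esub> y) = f x \<oplus>\<^bsub>bm_grp W\<^esub> f y"
    and \<phi>: "\<And>k. k \<in> carrier (bm_scal V) \<Longrightarrow> \<phi> k \<in> carrier (bm_scal W)"
    and f_l: "\<And>k x. k \<in> carrier (bm_scal V) \<Longrightarrow> x \<in> carrier (bm_grp V) \<Longrightarrow> f (bm_l V k x) = bm_r W (f x) (\<phi> k)"
    and f_r: "\<And>k x. k \<in> carrier (bm_scal V) \<Longrightarrow> x \<in> carrier (bm_grp V) \<Longrightarrow> f (bm_r V x k) = bm_l W (\<phi> k) (f x)"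
begin

interpretation V: bimod V by (rule V)
interpretation W: bimod W by (rule W)

lemma flip_gens:
  "g \<in> tensor_gens V \<Longrightarrow> tensor_class W (frag_map (\<lambda>(x, y). (f y, f x)) g) = tensor_class W 0"
  unfolding W.tensor_class_eq_iff diff_0_right
proof (induction rule: V.tensor_gens_elim)
  case (add_left x x' y)
  then show ?case
    using W.rel_add_right[of "f y" "f x" "f x'"] by (simp add: frag_map_diff f_add f)
next
  case (add_right x y y')
  then show ?case
    using W.rel_add_left[of "f y" "f y'" "f x"] by (simp add: frag_map_diff f_add f)
next
  case (middle x k y)
  then show ?case
    using W.T2.rel_sym[OF W.rel_middle[of "f y" "\<phi> k" "f x"]] by (simp add: frag_map_diff f_l f_r f \<phi>)
qed

lemma flip_class:
  "tensor_class V c = tensor_class V d \<Longrightarrow>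
    tensor_class W (frag_map (\<lambda>(x, y). (f y, f x)) c) = tensor_class W (frag_map (\<lambda>(x, y). (f y, f x)) d)"
  using induced_map_tensor_class[OF V W flip_gens, of c] induced_map_tensor_class[OF V W flip_gens, of d]
  by simp

lemma flip3_class:
  assumes "tensor3_class V c = tensor3_class V d"
  shows "tensor3_class W (frag_map (\<lambda>(x, y, z). (f z, f y, f x)) c) =
    tensor3_class W (frag_map (\<lambda>(x, y, z). (f z, f y, f x)) d)"
proof -
  have "frag_map (\<lambda>(x, y, z). (f z, f y, f x)) (c - d) \<in> W.T3.rel"
  proof (rule rel_frag_map[OF V.T3.frag_quotient_axioms W.T3.frag_quotient_axioms])
    show "c - d \<in> V.T3.rel" using assms by (simp add: V.tensor3_class_eq_iff)
    show "frag_map (\<lambda>(x, y, z). (f z, f y, f x)) g \<in> W.T3.rel" if "g \<in> tensor3_gens V" for g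
      using that
    proof (induction rule: V.tensor3_gens_elim)
      case (add_1 x x' y z)
      then show ?case
        using W.rel3_add_3[of "f z" "f y" "f x" "f x'"] by (simp add: frag_map_diff f_add f)
    next
      case (add_2 x y y' z)
      then show ?case
        using W.rel3_add_2[of "f z" "f y" "f y'" "f x"] by (simp add: frag_map_diff f_add f)
    next
      case (add_3 x y z z')
      then show ?case
        using W.rel3_add_1[of "f z" "f z'" "f y" "f x"] by (simp add: frag_map_diff f_add f)
    next
      case (middle_1 x k y z)
      then show ?case
        using W.T3.rel_sym[OF W.rel3_middle_2[of "f z" "\<phi> k" "f y" "f x"]]
        by (simp add: frag_map_diff f_l f_r f \<phi>)
    next
      case (middle_2 x k y z)
      then show ?case
        using W.T3.rel_sym[OF W.rel3_middle_1[of "f z" "\<phi> k" "f y" "f x"]]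
        by (simp add: frag_map_diff f_l f_r f \<phi>)
    qed
  qed
  then show ?thesis by (simp add: W.tensor3_class_eq_iff frag_map_diff)
qed

end

lemma frag_extend_swap:
  fixes c :: "'p \<Rightarrow>\<^sub>0 int" and d :: "'q \<Rightarrow>\<^sub>0 int" and f :: "'p \<Rightarrow> 'q \<Rightarrow> 'r"
  shows "frag_extend (\<lambda>p. frag_map (f p) d) c = frag_extend (\<lambda>q. frag_map (\<lambda>p. f p q) c) d"
proof -
  have *: "frag_extend (\<lambda>q. A q - B q) d = frag_extend A d - frag_extend B d" for A B :: "'q \<Rightarrow> 'r \<Rightarrow>\<^sub>0 int"
    using subset_UNIV by (induction d rule: frag_induction) (simp_all add: frag_extend_diff)
  show ?thesis
    using subset_UNIV
  proof (induction c rule: frag_induction)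
    case zero
    then show ?case by (simp add: frag_extend_eq_0)
  next
    case (one p)
    then show ?case by (simp add: frag_map_def)
  next
    case (diff a b)
    then show ?case by (simp add: frag_extend_diff frag_map_diff *)
  qed
qed

context dual_bases
begin

abbreviation "VR \<equiv> bimod_R N M h \<psi> I u v"

lemma bimod_VR: "bimod VR"
  unfolding bimod_R_def
  by (rule bimod_right_bimod[OF ring_A ring_op_ring[OF ring_L] rmul_hom])
    (simp_all add: lmul_nakayama_hom lmul_rmul_commute)

sublocale VR: bimod VR by (rule bimod_VR)

lemma VR_simps [simp]:
  "bm_scal VR = op_ring L" "bm_grp VR = A" "bm_l VR l a = a \<otimes>\<^bsub>A\<^esub> lmul M (\<nu> l)" "bm_r VR a l = a \<otimes>\<^bsub>A\<^esub> rmul M l"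
  by (simp_all add: bimod_R_def right_bimod_def)

definition S_inv :: "('m \<Rightarrow> 'm) \<Rightarrow> 'm \<Rightarrow> 'm" where
  "S_inv = inv_into (carrier A) S"

lemma S_inv_in_A [simp]: "a \<in> carrier A \<Longrightarrow> S_inv a \<in> carrier A"
  and S_S_inv [simp]: "a \<in> carrier A \<Longrightarrow> S (S_inv a) = a"
  and S_inv_S [simp]: "a \<in> carrier A \<Longrightarrow> S_inv (S a) = a"
  unfolding S_inv_def using S_surj S_inj by (simp_all add: inv_into_into f_inv_into_f)

lemma S_inv_eqI: "a \<in> carrier A \<Longrightarrow> S a = b \<Longrightarrow> S_inv b = a"
  by auto

lemma S_inv_add: "a \<in> carrier A \<Longrightarrow> b \<in> carrier A \<Longrightarrow> S_inv (a \<oplus>\<^bsub>A\<^esub> b) = S_inv a \<oplus>\<^bsub>A\<^esub> S_inv b"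
  by (rule S_inv_eqI) (simp_all add: S_add)

lemma S_inv_mult: "a \<in> carrier A \<Longrightarrow> b \<in> carrier A \<Longrightarrow> S_inv (a \<otimes>\<^bsub>A\<^esub> b) = S_inv b \<otimes>\<^bsub>A\<^esub> S_inv a"
  by (rule S_inv_eqI) (simp_all add: S_mult)

lemma S_inv_lmul: "l \<in> carrier L \<Longrightarrow> S_inv (lmul M l) = rmul M l"
  by (rule S_inv_eqI) (simp_all add: S_rmul)

lemma S_inv_rmul: "l \<in> carrier L \<Longrightarrow> S_inv (rmul M l) = lmul M (\<nu> l)"
  by (rule S_inv_eqI) (simp_all add: S_lmul_nakayama)

abbreviation "flip \<equiv> \<lambda>(x, y). (S y, S x)"
abbreviation "flip3 \<equiv> \<lambda>(x, y, z). (S z, S y, S x)"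

lemma flip_fun: "flip \<in> AA \<rightarrow> AA"
  by auto

lemma keys_flip: "keys c \<subseteq> AA \<Longrightarrow> keys (frag_map flip c) \<subseteq> AA"
  by (rule keys_map_subset[OF _ flip_fun])

lemma flip_gens_RL:
  "g \<in> tensor_gens VR \<Longrightarrow> tensor_class VL (frag_map flip g) = tensor_class VL 0"
  by (rule flip_gens[OF bimod_VR bimod_VL, where \<phi> = "\<lambda>k. k"])
    (simp_all add: S_add S_mult S_lmul_nakayama S_rmul)

lemma flip_gens_LR:
  "g \<in> tensor_gens VL \<Longrightarrow> tensor_class VR (frag_map flip g) = tensor_class VR 0"
  by (rule flip_gens[OF bimod_VL bimod_VR, where \<phi> = \<theta>])
    (simp_all add: S_add S_mult S_lmul S_rmul)

lemma flip_class_RL: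
  "tensor_class VR c = tensor_class VR d \<Longrightarrow> tensor_class VL (frag_map flip c) = tensor_class VL (frag_map flip d)"
  by (rule flip_class[OF bimod_VR bimod_VL, where \<phi> = "\<lambda>k. k"])
    (simp_all add: S_add S_mult S_lmul_nakayama S_rmul)

lemma VR_class_eqI:
  assumes c: "keys c \<subseteq> AA" and d: "keys d \<subseteq> AA"
    and cd: "tensor_class VL (frag_map flip c) = tensor_class VL (frag_map flip d)"
  shows "tensor_class VR c = tensor_class VR d"
proof -
  let ?f = "\<lambda>(x, y). (S_inv y, S_inv x)"
  have "tensor_class VR (frag_map ?f (frag_map flip c)) = tensor_class VR (frag_map ?f (frag_map flip d))"
    by (rule flip_class[OF bimod_VL bimod_VR, where \<phi> = "\<lambda>k. k", OF _ _ _ _ _ cd])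
      (simp_all add: S_inv_add S_inv_mult S_inv_lmul S_inv_rmul)
  moreover have "frag_map ?f (frag_map flip c) = c" if "keys c \<subseteq> AA" for c
    unfolding frag_map_map by (rule frag_map_ident) (use that in auto)
  ultimately show ?thesis using c d by simp
qed

lemma VR_class3_eqI:
  assumes c: "keys c \<subseteq> AAA" and d: "keys d \<subseteq> AAA"
    and cd: "tensor3_class VL (frag_map flip3 c) = tensor3_class VL (frag_map flip3 d)"
  shows "tensor3_class VR c = tensor3_class VR d"
proof -
  let ?f = "\<lambda>(x, y, z). (S_inv z, S_inv y, S_inv x)"
  have "tensor3_class VR (frag_map ?f (frag_map flip3 c)) = tensor3_class VR (frag_map ?f (frag_map flip3 d))"
    by (rule flip3_class[OF bimod_VL bimod_VR, where \<phi> = "\<lambda>k. k", OF _ _ _ _ _ cd])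
      (simp_all add: S_inv_add S_inv_mult S_inv_lmul S_inv_rmul)
  moreover have "frag_map ?f (frag_map flip3 c) = c" if "keys c \<subseteq> AAA" for c
    unfolding frag_map_map by (rule frag_map_ident) (use that in auto)
  ultimately show ?thesis using c d by simp
qed

text \<open>
  The condition that defines the right coproduct says \<open>\<alpha>(m) m' = \<Sum> \<beta>(m S(\<delta>)(m'))\<close>; taking adjoints
  with respect to \<open>\<psi>\<close> turns it into the condition that defines the left coproduct of \<open>S(\<alpha>)\<close>.
\<close>

lemma right_condition_iff:
  assumes a: "a \<in> carrier A" and c: "keys c \<subseteq> AA" and m: "m \<in> carrier M"
  shows "tensor_class VE (\<Sum>i\<in>I. frag_of (a m \<otimes> u i, v i)) =
      tensor_class VE (\<Sum>i\<in>I. frag_map (\<lambda>(x, y). (x (m \<otimes> u i), y (v i))) c) \<longleftrightarrow>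
    (\<forall>m'\<in>carrier M. a m \<otimes> m' = frag_eval M (\<lambda>(x, y). x (m \<otimes> S y m')) c)"
proof -
  let ?f = "\<lambda>i (x, y). (x (m \<otimes> u i), y (v i))"
  have f: "?f i \<in> AA \<rightarrow> MM" if "i \<in> I" for i using that m by auto
  have k1: "keys (frag_of (a m \<otimes> u i, v i)) \<subseteq> MM"
    and k2: "keys (frag_map (?f i) c) \<subseteq> MM" if "i \<in> I" for i
    using that a m keys_map_subset[OF c f] by simp_all
  have g: "(\<lambda>(x, y). x \<otimes> E (y \<otimes> m')) \<in> MM \<rightarrow> carrier M" if "m' \<in> carrier M" for m'
    using that by auto
  have e1: "frag_eval M (\<lambda>(x, y). x \<otimes> E (y \<otimes> m')) (\<Sum>i\<in>I. frag_of (a m \<otimes> u i, v i)) = a m \<otimes> m'"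
    if m': "m' \<in> carrier M" for m'
  proof -
    have "frag_eval M (\<lambda>(x, y). x \<otimes> E (y \<otimes> m')) (\<Sum>i\<in>I. frag_of (a m \<otimes> u i, v i)) =
        (\<Oplus>i\<in>I. frag_eval M (\<lambda>(x, y). x \<otimes> E (y \<otimes> m')) (frag_of (a m \<otimes> u i, v i)))"
      by (rule frag_eval_sum[OF k1 g[OF m']]) simp_all
    also have "\<dots> = (\<Oplus>i\<in>I. a m \<otimes> (u i \<otimes> E (v i \<otimes> m')))"
      using a m m' by (intro finsum_congI) (simp_all add: frag_eval_of m_assoc)
    also have "\<dots> = a m \<otimes> (\<Oplus>i\<in>I. u i \<otimes> E (v i \<otimes> m'))"
      using a m m' by (intro finsum_rdistr[symmetric]) auto
    finally show ?thesis using m' by (simp add: quasibasis_right)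
  qed
  have e2: "frag_eval M (\<lambda>(x, y). x \<otimes> E (y \<otimes> m')) (\<Sum>i\<in>I. frag_map (?f i) c) =
      frag_eval M (\<lambda>(x, y). x (m \<otimes> S y m')) c"
    if m': "m' \<in> carrier M" for m'
  proof -
    have "frag_eval M (\<lambda>(x, y). x \<otimes> E (y \<otimes> m')) (\<Sum>i\<in>I. frag_map (?f i) c) =
        (\<Oplus>i\<in>I. frag_eval M (\<lambda>(x, y). x \<otimes> E (y \<otimes> m')) (frag_map (?f i) c))"
      by (rule frag_eval_sum[OF k2 g[OF m']]) simp_all
    also have "\<dots> = (\<Oplus>i\<in>I. frag_eval M (\<lambda>p. case ?f i p of (x, y) \<Rightarrow> x \<otimes> E (y \<otimes> m')) c)"
    proof (rule finsum_congI)
      fix i assume i: "i \<in> I"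
      show "frag_eval M (\<lambda>(x, y). x \<otimes> E (y \<otimes> m')) (frag_map (?f i) c) =
          frag_eval M (\<lambda>p. case ?f i p of (x, y) \<Rightarrow> x \<otimes> E (y \<otimes> m')) c"
        by (rule frag_eval_map[OF c f[OF i] g[OF m']])
      show "frag_eval M (\<lambda>p. case ?f i p of (x, y) \<Rightarrow> x \<otimes> E (y \<otimes> m')) c \<in> carrier M"
        using i m m' by (intro frag_eval_closed[OF c]) auto
    qed
    also have "\<dots> = frag_eval M (\<lambda>p. \<Oplus>i\<in>I. case ?f i p of (x, y) \<Rightarrow> x \<otimes> E (y \<otimes> m')) c"
      by (rule frag_eval_finsum[OF c, symmetric]) (use m m' in auto)
    also have "\<dots> = frag_eval M (\<lambda>(x, y). x (m \<otimes> S y m')) c"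
    proof (rule frag_eval_cong)
      fix p assume "p \<in> keys c"
      then obtain x y where p: "p = (x, y)" "x \<in> carrier A" "y \<in> carrier A" using c by auto
      have "(\<Oplus>i\<in>I. x (m \<otimes> u i) \<otimes> E (y (v i) \<otimes> m')) = (\<Oplus>i\<in>I. x (m \<otimes> (u i \<otimes> E (y (v i) \<otimes> m'))))"
        using p m m' by (intro finsum_congI) (simp_all add: A_right[symmetric] m_assoc)
      also have "\<dots> = x (m \<otimes> S y m')"
        unfolding S_apply[OF m'] using p m m'
        by (intro additive_finsum_map[where F = "\<lambda>w. x (m \<otimes> w)", symmetric]) (simp_all add: r_distr A_add)
      finally show "(\<Oplus>i\<in>I. case ?f i p of (x, y) \<Rightarrow> x \<otimes> E (y \<otimes> m')) = (case p of (x, y) \<Rightarrow> x (m \<otimes> S y m'))"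
        by (simp add: p(1))
    qed (use c m m' in auto)
    finally show ?thesis .
  qed
  have "keys (\<Sum>i\<in>I. frag_of (a m \<otimes> u i, v i)) \<subseteq> MM"
    and "keys (\<Sum>i\<in>I. frag_map (?f i) c) \<subseteq> MM"
    by (rule keys_sum_subset, erule k1, rule keys_sum_subset, erule k2)
  from VE_class_eq_iff[OF this] show ?thesis by (simp add: e1 e2)
qed

lemma right_condition_flip_iff:
  assumes a: "a \<in> carrier A" and c: "keys c \<subseteq> AA"
  shows "(\<forall>m\<in>carrier M. \<forall>m'\<in>carrier M. a m \<otimes> m' = frag_eval M (\<lambda>(x, y). x (m \<otimes> S y m')) c) \<longleftrightarrow>
    frag_map flip c \<in> copL (S a)"
proof -
  let ?r = "\<lambda>m m'. frag_eval M (\<lambda>(x, y). x (m \<otimes> S y m')) c"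
  have r: "(\<lambda>(x, y). x (m \<otimes> S y m')) \<in> AA \<rightarrow> carrier M" if "m \<in> carrier M" "m' \<in> carrier M" for m m'
    using that by auto
  have r_closed: "?r m m' \<in> carrier M" if "m \<in> carrier M" "m' \<in> carrier M" for m m'
    by (rule frag_eval_closed[OF c r[OF that]])
  have adj: "E (w \<otimes> ev (frag_map flip c) m m') = E (?r w m \<otimes> m')"
    if m: "m \<in> carrier M" "m' \<in> carrier M" and w: "w \<in> carrier M" for m m' w
  proof -
    have f: "(\<lambda>p. case flip p of (x, y) \<Rightarrow> x m \<otimes> y m') \<in> AA \<rightarrow> carrier M" using m by auto
    have "ev (frag_map flip c) m m' = frag_eval M (\<lambda>p. case flip p of (x, y) \<Rightarrow> x m \<otimes> y m') c"
      by (rule frag_eval_map[OF c flip_fun ev_fun[OF m]])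
    then have "E (w \<otimes> ev (frag_map flip c) m m') =
        frag_eval M (\<lambda>p. E (w \<otimes> (case flip p of (x, y) \<Rightarrow> x m \<otimes> y m'))) c"
      using hom_eval_M[OF _ _ c f, of "\<lambda>x. E (w \<otimes> x)"] w
      by (simp add: r_distr E_add)
    also have "\<dots> = frag_eval M (\<lambda>p. E ((case p of (x, y) \<Rightarrow> x (w \<otimes> S y m)) \<otimes> m')) c"
    proof (rule frag_eval_cong)
      fix p assume "p \<in> keys c"
      then obtain x y where p: "p = (x, y)" "x \<in> carrier A" "y \<in> carrier A" using c by auto
      have "E (w \<otimes> (S y m \<otimes> S x m')) = E ((w \<otimes> S y m) \<otimes> S x m')"
        using p m w by (simp add: m_assoc)
      also have "\<dots> = E (x (w \<otimes> S y m) \<otimes> m')"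
        using p m w by (intro S_adjoint) simp_all
      finally show "E (w \<otimes> (case flip p of (x, y) \<Rightarrow> x m \<otimes> y m')) = E ((case p of (x, y) \<Rightarrow> x (w \<otimes> S y m)) \<otimes> m')"
        by (simp add: p(1))
    qed (use c m w in auto)
    also have "\<dots> = E (?r w m \<otimes> m')"
      by (rule hom_eval_M[OF _ _ c r[OF w m(1)],
          where F = "\<lambda>x. E (x \<otimes> m')", symmetric]) (use m in \<open>simp_all add: l_distr E_add\<close>)
    finally show ?thesis .
  qed
  have Sa: "E (w \<otimes> S a (m \<otimes> m')) = E ((a w \<otimes> m) \<otimes> m')"
    if "m \<in> carrier M" "m' \<in> carrier M" "w \<in> carrier M" for m m' w
    using that a by (simp add: S_adjoint m_assoc)
  note closed = ev_closed[OF keys_flip[OF c]]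
  show ?thesis
  proof
    assume *: "\<forall>m\<in>carrier M. \<forall>m'\<in>carrier M. a m \<otimes> m' = ?r m m'"
    show "frag_map flip c \<in> copL (S a)"
    proof (rule coproduct_L_I[OF keys_flip[OF c]])
      fix m m' assume m: "m \<in> carrier M" "m' \<in> carrier M"
      have "E (w \<otimes> ev (frag_map flip c) m m') = E (w \<otimes> S a (m \<otimes> m'))" if w: "w \<in> carrier M" for w
        using adj[OF m w] Sa[OF m w] * w m by simp
      then show "ev (frag_map flip c) m m' = S a (m \<otimes> m')"
        using E_nondeg_right[OF closed[OF m], of "S a (m \<otimes> m')"] m a by simp
    qed
  next
    assume *: "frag_map flip c \<in> copL (S a)"
    show "\<forall>m\<in>carrier M. \<forall>m'\<in>carrier M. a m \<otimes> m' = ?r m m'"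
    proof (intro ballI)
      fix w m assume m: "w \<in> carrier M" "m \<in> carrier M"
      have "E ((a w \<otimes> m) \<otimes> m') = E (?r w m \<otimes> m')" if m': "m' \<in> carrier M" for m'
        using adj[OF m(2) m' m(1)] Sa[OF m(2) m' m(1)] coproduct_L_D(3)[OF S_in_A[OF a] * m(2) m'] by simp
      then show "a w \<otimes> m = ?r w m"
        using E_nondeg_left[OF _ r_closed[OF m], of "a w \<otimes> m"] m a by simp
    qed
  qed
qed

abbreviation "copR \<equiv> coproduct_R N M h \<psi> I u v"

lemma coproduct_R_eq:
  assumes a: "a \<in> carrier A" and c: "keys c \<subseteq> AA"
    and flip: "frag_map flip c \<in> copL (S a)"
  shows "copR a = tensor_class VR c"
  unfolding coproduct_R_def
proof (rule the_equality)
  let ?P = "\<lambda>c m. tensor_class VE (\<Sum>i\<in>I. frag_of (a m \<otimes> u i, v i)) =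
      tensor_class VE (\<Sum>i\<in>I. frag_map (\<lambda>(\<beta>, \<delta>). (\<beta> (m \<otimes> u i), \<delta> (v i))) c)"
  have P_iff: "(\<forall>m\<in>carrier M. ?P d m) \<longleftrightarrow> frag_map flip d \<in> copL (S a)"
    if d: "keys d \<subseteq> AA" for d
    using right_condition_iff[OF a d] right_condition_flip_iff[OF a d] by simp
  have T: "tensor_class VR c \<in> carrier (tensor VR)" using c by (auto simp: VR.carrier_tensor)
  have eq: "copL (S a) = tensor_class VL (frag_map flip c)"
    by (rule coproduct_L_D(2)[OF S_in_A[OF a] flip])
  have "\<forall>m\<in>carrier M. ?P d m" if d: "d \<in> tensor_class VR c" for d
  proof -
    have kd: "keys d \<subseteq> AA" using VR.mem_carrier_tensor(1)[OF T d] by simp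
    have "tensor_class VL (frag_map flip c) = tensor_class VL (frag_map flip d)"
      by (rule flip_class_RL[OF VR.mem_carrier_tensor(2)[OF T d]])
    then have "frag_map flip d \<in> copL (S a)"
      unfolding eq using VL.self_in_tensor_class[of "frag_map flip d"] by simp
    with P_iff[OF kd] show ?thesis by simp
  qed
  with T show "tensor_class VR c \<in> carrier (tensor VR) \<and> (\<forall>d\<in>tensor_class VR c. \<forall>m\<in>carrier M. ?P d m)"
    by simp
  fix X assume X: "X \<in> carrier (tensor VR) \<and> (\<forall>d\<in>X. \<forall>m\<in>carrier M. ?P d m)"
  then obtain d where d: "keys d \<subseteq> AA" "X = tensor_class VR d"
    by (auto simp: VR.carrier_tensor)
  have "d \<in> X" unfolding d(2) by (rule VR.self_in_tensor_class)
  with X have "frag_map flip d \<in> copL (S a)"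
    using P_iff[OF d(1)] by simp
  then have "tensor_class VL (frag_map flip d) = tensor_class VL (frag_map flip c)"
    using coproduct_L_D(2)[OF S_in_A[OF a]] eq by simp
  then show "X = tensor_class VR c"
    unfolding d(2) by (rule VR_class_eqI[OF d(1) c])
qed

lemma coproduct_R_I:
  assumes "a \<in> carrier A" "keys c \<subseteq> AA" "frag_map flip c \<in> copL (S a)"
  shows "c \<in> copR a"
proof -
  have "copR a = tensor_class VR c" by (rule coproduct_R_eq[OF assms])
  with VR.self_in_tensor_class show ?thesis by simp
qed

lemma coproduct_R_ex:
  assumes a: "a \<in> carrier A"
  obtains c where "keys c \<subseteq> AA" "frag_map flip c \<in> copL (S a)"
proof
  let ?c = "frag_map (\<lambda>(x, y). (S_inv y, S_inv x)) (coproduct_frag (S a))"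
  note k = coproduct_frag[OF S_in_A[OF a]]
  show "keys ?c \<subseteq> AA"
    by (rule keys_map_subset[OF k(1)]) auto
  have "frag_map flip ?c = coproduct_frag (S a)"
    unfolding frag_map_map by (rule frag_map_ident) (use k(1) in auto)
  then show "frag_map flip ?c \<in> copL (S a)"
    using coproduct_L_I[OF k] by simp
qed

lemma coproduct_R_in_tensor:
  assumes a: "a \<in> carrier A" shows "copR a \<in> carrier (tensor VR)"
proof (rule coproduct_R_ex[OF a])
  fix c assume c: "keys c \<subseteq> AA" "frag_map flip c \<in> copL (S a)"
  show ?thesis
    unfolding coproduct_R_eq[OF a c] using c(1) by (auto simp: VR.carrier_tensor)
qed

lemma coproduct_R_D:
  assumes a: "a \<in> carrier A" and c: "c \<in> copR a"
  shows "keys c \<subseteq> AA" "copR a = tensor_class VR c"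
    and "frag_map flip c \<in> copL (S a)"
proof -
  note T = VR.mem_carrier_tensor[OF coproduct_R_in_tensor[OF a] c]
  show "keys c \<subseteq> AA" using T(1) by simp
  show "copR a = tensor_class VR c" by (rule T(2))
  show "frag_map flip c \<in> copL (S a)"
  proof (rule coproduct_R_ex[OF a])
    fix d assume d: "keys d \<subseteq> AA" "frag_map flip d \<in> copL (S a)"
    have "tensor_class VR d = tensor_class VR c"
      using coproduct_R_eq[OF a d] T(2) by simp
    from flip_class_RL[OF this] coproduct_L_D(2)[OF S_in_A[OF a] d(2)]
    show ?thesis using VL.self_in_tensor_class[of "frag_map flip c"] by simp
  qed
qed

abbreviation "BR \<equiv> right_bialgebroid_of N M h \<psi> I u v"
abbreviation "piR \<equiv> (\<lambda>a. \<Oplus>i\<in>I. u i \<otimes> E (a (v i)))"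

lemma counit_R: "a \<in> carrier A \<Longrightarrow> piR a = S a \<one>"
  by (simp add: S_apply) (intro finsum_congI; simp)

lemma coproduct_R_hom: "copR \<in> hom (add_monoid A) (tensor VR)"
proof (rule homI; simp only: monoid_record_simps)
  fix a b assume ab: "a \<in> carrier A" "b \<in> carrier A"
  show "copR (a \<oplus>\<^bsub>A\<^esub> b) = copR a \<otimes>\<^bsub>tensor VR\<^esub> copR b"
  proof (rule coproduct_R_ex[OF ab(1)], rule coproduct_R_ex[OF ab(2)])
    fix c d assume c: "keys c \<subseteq> AA" "frag_map flip c \<in> copL (S a)"
      and d: "keys d \<subseteq> AA" "frag_map flip d \<in> copL (S b)"
    have "copR (a \<oplus>\<^bsub>A\<^esub> b) = tensor_class VR (c + d)"
      using coproduct_L_add[OF _ _ c(2) d(2)] ab keys_add_subset[OF c(1) d(1)]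
      by (intro coproduct_R_eq) (simp_all add: frag_map_add S_add)
    also have "\<dots> = tensor_class VR c \<otimes>\<^bsub>tensor VR\<^esub> tensor_class VR d"
      using c(1) d(1) by (intro VR.tensor_mult[symmetric]) simp_all
    finally show ?thesis
      unfolding coproduct_R_eq[OF ab(1) c] coproduct_R_eq[OF ab(2) d] .
  qed
qed (rule coproduct_R_in_tensor)

lemma coproduct_R_bimodule:
  assumes l: "l \<in> carrier L" and a: "a \<in> carrier A" and c: "c \<in> copR a"
  shows "frag_map (\<lambda>(x, y). (x \<otimes>\<^bsub>A\<^esub> lmul M (\<nu> l), y)) c \<in> copR (a \<otimes>\<^bsub>A\<^esub> lmul M (\<nu> l))"
    and "frag_map (\<lambda>(x, y). (x, y \<otimes>\<^bsub>A\<^esub> rmul M l)) c \<in> copR (a \<otimes>\<^bsub>A\<^esub> rmul M l)"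
proof -
  let ?f = "\<lambda>(x, y). (x \<otimes>\<^bsub>A\<^esub> lmul M (\<nu> l), y)"
    and ?g = "\<lambda>(x, y). (x, y \<otimes>\<^bsub>A\<^esub> rmul M l)"
  note k = coproduct_R_D(1)[OF a c] and flip_c = coproduct_R_D(3)[OF a c]
  show "frag_map ?f c \<in> copR (a \<otimes>\<^bsub>A\<^esub> lmul M (\<nu> l))"
  proof (rule coproduct_R_I)
    show "a \<otimes>\<^bsub>A\<^esub> lmul M (\<nu> l) \<in> carrier A" using a l by simp
    show "keys (frag_map ?f c) \<subseteq> AA"
      by (rule keys_map_subset[OF k]) (use l in auto)
    have "frag_map flip (frag_map ?f c) =
        frag_map (\<lambda>(x, y). (x, rmul M l \<otimes>\<^bsub>A\<^esub> y)) (frag_map flip c)"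
      unfolding frag_map_map
      by (rule frag_map_cong) (use k l in \<open>auto simp: S_mult S_lmul_nakayama\<close>)
    then show "frag_map flip (frag_map ?f c)
        \<in> copL (S (a \<otimes>\<^bsub>A\<^esub> lmul M (\<nu> l)))"
      using coproduct_L_bimodule(2)[OF l _ flip_c] a l by (simp add: S_mult S_lmul_nakayama)
  qed
  show "frag_map ?g c \<in> copR (a \<otimes>\<^bsub>A\<^esub> rmul M l)"
  proof (rule coproduct_R_I)
    show "a \<otimes>\<^bsub>A\<^esub> rmul M l \<in> carrier A" using a l by simp
    show "keys (frag_map ?g c) \<subseteq> AA"
      by (rule keys_map_subset[OF k]) (use l in auto)
    have "frag_map flip (frag_map ?g c) =
        frag_map (\<lambda>(x, y). (lmul M l \<otimes>\<^bsub>A\<^esub> x, y)) (frag_map flip c)"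
      unfolding frag_map_map
      by (rule frag_map_cong) (use k l in \<open>auto simp: S_mult S_rmul\<close>)
    then show "frag_map flip (frag_map ?g c)
        \<in> copL (S (a \<otimes>\<^bsub>A\<^esub> rmul M l))"
      using coproduct_L_bimodule(1)[OF l _ flip_c] a l by (simp add: S_mult S_rmul)
  qed
qed

lemma coproduct_R_takeuchi:
  assumes l: "l \<in> carrier L" and a: "a \<in> carrier A" and c: "c \<in> copR a"
  shows "tensor_class VR (frag_map (\<lambda>(x, y). (rmul M l \<otimes>\<^bsub>A\<^esub> x, y)) c) =
    tensor_class VR (frag_map (\<lambda>(x, y). (x, lmul M (\<nu> l) \<otimes>\<^bsub>A\<^esub> y)) c)"
proof (rule VR_class_eqI)
  let ?f = "\<lambda>(x, y). (rmul M l \<otimes>\<^bsub>A\<^esub> x, y)" and ?g = "\<lambda>(x, y). (x, lmul M (\<nu> l) \<otimes>\<^bsub>A\<^esub> y)"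
  note k = coproduct_R_D(1)[OF a c] and flip_c = coproduct_R_D(3)[OF a c]
  show "keys (frag_map ?f c) \<subseteq> AA"
    and "keys (frag_map ?g c) \<subseteq> AA"
    by (rule keys_map_subset[OF k]; use l in auto)+
  have "frag_map flip (frag_map ?f c) =
      frag_map (\<lambda>(x, y). (x, y \<otimes>\<^bsub>A\<^esub> lmul M l)) (frag_map flip c)"
    and "frag_map flip (frag_map ?g c) =
      frag_map (\<lambda>(x, y). (x \<otimes>\<^bsub>A\<^esub> rmul M l, y)) (frag_map flip c)"
    unfolding frag_map_map
    by (rule frag_map_cong; use k l in \<open>auto simp: S_mult S_lmul_nakayama S_rmul\<close>)+
  then show "tensor_class VL (frag_map flip (frag_map ?f c)) =
      tensor_class VL (frag_map flip (frag_map ?g c))"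
    using coproduct_L_takeuchi[OF l S_in_A[OF a] flip_c] by simp
qed

lemma coproduct_R_mult:
  assumes a: "a \<in> carrier A" and b: "b \<in> carrier A" and c: "c \<in> copR a" and d: "d \<in> copR b"
  shows "frag_extend (\<lambda>(x, y). frag_map (\<lambda>(x', y'). (x \<otimes>\<^bsub>A\<^esub> x', y \<otimes>\<^bsub>A\<^esub> y')) d) c \<in> copR (a \<otimes>\<^bsub>A\<^esub> b)"
    (is "?e \<in> _")
proof (rule coproduct_R_I)
  note kc = coproduct_R_D(1)[OF a c] and kd = coproduct_R_D(1)[OF b d]
  show "a \<otimes>\<^bsub>A\<^esub> b \<in> carrier A" using a b by simp
  have inner: "(\<lambda>(x', y'). (x \<otimes>\<^bsub>A\<^esub> x', y \<otimes>\<^bsub>A\<^esub> y')) \<in> AA \<rightarrow> AA" if "x \<in> carrier A" "y \<in> carrier A" for x y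
    using that by auto
  have "keys (case z of (x, y) \<Rightarrow> frag_map (\<lambda>(x', y'). (x \<otimes>\<^bsub>A\<^esub> x', y \<otimes>\<^bsub>A\<^esub> y')) d) \<subseteq> AA"
    if "z \<in> AA" for z
    using that keys_map_subset[OF kd inner] by (cases z) simp
  then show "keys ?e \<subseteq> AA"
    by (rule keys_extend_subset[OF kc])
  let ?f = "\<lambda>(x, y) (x', y'). (S y' \<otimes>\<^bsub>A\<^esub> S y, S x' \<otimes>\<^bsub>A\<^esub> S x)"
  have "frag_map flip ?e = frag_extend (\<lambda>p. frag_map (?f p) d) c"
    unfolding frag_map_frag_extend
  proof (rule frag_extend_eq)
    fix p assume "p \<in> keys c"
    then obtain x y where p: "p = (x, y)" "x \<in> carrier A" "y \<in> carrier A" using kc by auto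
    show "frag_map flip (case p of (x, y) \<Rightarrow> frag_map (\<lambda>(x', y'). (x \<otimes>\<^bsub>A\<^esub> x', y \<otimes>\<^bsub>A\<^esub> y')) d) = frag_map (?f p) d"
      unfolding p(1) prod.case frag_map_map
      by (rule frag_map_cong) (use kd p in \<open>auto simp: S_mult\<close>)
  qed
  also have "\<dots> = frag_extend (\<lambda>q. frag_map (\<lambda>p. ?f p q) c) d"
    by (rule frag_extend_swap)
  also have "\<dots> = frag_extend (\<lambda>(x, y). frag_map (\<lambda>(x', y'). (x \<otimes>\<^bsub>A\<^esub> x', y \<otimes>\<^bsub>A\<^esub> y')) (frag_map flip c)) (frag_map flip d)"
    by (simp add: frag_extend_frag_map frag_map_map case_prod_unfold)
  finally show "frag_map flip ?e \<in> copL (S (a \<otimes>\<^bsub>A\<^esub> b))"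
    using coproduct_L_mult[OF S_in_A[OF b] S_in_A[OF a] coproduct_R_D(3)[OF b d] coproduct_R_D(3)[OF a c]] a b
    by (simp add: S_mult)
qed

lemma coproduct_R_coassoc:
  assumes g: "\<And>a. a \<in> carrier A \<Longrightarrow> g a \<in> copR a"
    and a: "a \<in> carrier A" and c: "c \<in> copR a"
  shows "tensor3_class VR (frag_extend (\<lambda>(x, y). frag_map (\<lambda>(p, q). (p, q, y)) (g x)) c) =
    tensor3_class VR (frag_extend (\<lambda>(x, y). frag_map (\<lambda>(p, q). (x, p, q)) (g y)) c)"
proof (rule VR_class3_eqI)
  note kc = coproduct_R_D(1)[OF a c] and kg = coproduct_R_D(1)[OF _ g]
  let ?l = "\<lambda>(x, y). frag_map (\<lambda>(p, q). (p, q, y)) (g x)"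
  let ?r = "\<lambda>(x, y). frag_map (\<lambda>(p, q). (x, p, q)) (g y)"
  have il: "(\<lambda>(p, q). (p, q, y)) \<in> AA \<rightarrow> AAA" and ir: "(\<lambda>(p, q). (y, p, q)) \<in> AA \<rightarrow> AAA" if "y \<in> carrier A" for y
    using that by auto
  have kl: "keys (?l z) \<subseteq> AAA" if "z \<in> AA" for z
    using that keys_map_subset[OF kg il] by (cases z) simp
  have kr: "keys (?r z) \<subseteq> AAA" if "z \<in> AA" for z
    using that keys_map_subset[OF kg ir] by (cases z) simp
  show "keys (frag_extend ?l c) \<subseteq> AAA" by (rule keys_extend_subset[OF kc kl])
  show "keys (frag_extend ?r c) \<subseteq> AAA" by (rule keys_extend_subset[OF kc kr])
  define g' where "g' b = frag_map flip (g (S_inv b))" for b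
  have g': "g' b \<in> copL b" if "b \<in> carrier A" for b
    using coproduct_R_D(3)[OF _ g, of "S_inv b"] that by (simp add: g'_def)
  have "frag_map flip3 (frag_extend ?l c) =
      frag_extend (\<lambda>(x, y). frag_map (\<lambda>(p, q). (x, p, q)) (g' y)) (frag_map flip c)"
    unfolding frag_map_frag_extend frag_extend_frag_map
  proof (rule frag_extend_eq)
    fix z assume "z \<in> keys c"
    then obtain x y where z: "z = (x, y)" "x \<in> carrier A" "y \<in> carrier A" using kc by auto
    show "frag_map flip3 (?l z) = (case flip z of (x, y) \<Rightarrow> frag_map (\<lambda>(p, q). (x, p, q)) (g' y))"
      using z by (simp add: g'_def frag_map_map case_prod_unfold)
  qed
  moreover have "frag_map flip3 (frag_extend ?r c) =
      frag_extend (\<lambda>(x, y). frag_map (\<lambda>(p, q). (p, q, y)) (g' x)) (frag_map flip c)"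
    unfolding frag_map_frag_extend frag_extend_frag_map
  proof (rule frag_extend_eq)
    fix z assume "z \<in> keys c"
    then obtain x y where z: "z = (x, y)" "x \<in> carrier A" "y \<in> carrier A" using kc by auto
    show "frag_map flip3 (?r z) = (case flip z of (x, y) \<Rightarrow> frag_map (\<lambda>(p, q). (p, q, y)) (g' x))"
      using z by (simp add: g'_def frag_map_map case_prod_unfold)
  qed
  ultimately show "tensor3_class VL (frag_map flip3 (frag_extend ?l c)) =
      tensor3_class VL (frag_map flip3 (frag_extend ?r c))"
    using coproduct_L_coassoc[OF g' S_in_A[OF a] coproduct_R_D(3)[OF a c]] by simp
qed

lemma frag_eval_A_S:
  assumes "keys c \<subseteq> U" "f \<in> U \<rightarrow> carrier A"
  shows "S (frag_eval A f c) = frag_eval A (\<lambda>p. S (f p)) c"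
  by (rule hom_frag_eval[OF A.is_abelian_group A.is_abelian_group S_in_A S_add assms])

lemma coproduct_R_counit:
  assumes a: "a \<in> carrier A" and c: "c \<in> copR a"
  shows "frag_eval A (\<lambda>(x, y). y \<otimes>\<^bsub>A\<^esub> lmul M (\<nu> (piR x))) c = a"
    and "frag_eval A (\<lambda>(x, y). x \<otimes>\<^bsub>A\<^esub> rmul M (piR y)) c = a"
proof -
  let ?p = "\<lambda>(x, y). y \<otimes>\<^bsub>A\<^esub> lmul M (\<nu> (piR x))"
    and ?q = "\<lambda>(x, y). x \<otimes>\<^bsub>A\<^esub> rmul M (piR y)"
    and ?f = "\<lambda>(x, y). lmul M (x \<one>) \<otimes>\<^bsub>A\<^esub> y"
    and ?g = "\<lambda>(x, y). rmul M (y \<one>) \<otimes>\<^bsub>A\<^esub> x"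
  note k = coproduct_R_D(1)[OF a c] and flip_c = coproduct_R_D(3)[OF a c]
  have S_cancel: "b = a" if "b \<in> carrier A" "S b = S a" for b
    using inj_onD[OF S_inj that(2,1) a] .
  have f: "?f \<in> AA \<rightarrow> carrier A" "?g \<in> AA \<rightarrow> carrier A"
    by auto
  have g: "?p \<in> AA \<rightarrow> carrier A" "?q \<in> AA \<rightarrow> carrier A"
    by (auto simp: counit_R)
  show "frag_eval A ?p c = a"
  proof (rule S_cancel)
    show "frag_eval A ?p c \<in> carrier A"
      using VL.frag_eval_closed[of c AA, unfolded VL_simps, OF k g(1)] .
    have "S (frag_eval A ?p c) =
        frag_eval A (\<lambda>p. S (case p of (x, y) \<Rightarrow> y \<otimes>\<^bsub>A\<^esub> lmul M (\<nu> (piR x)))) c"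
      by (rule frag_eval_A_S[OF k g(1)])
    also have "\<dots> = frag_eval A (\<lambda>p. case flip p of (x, y) \<Rightarrow> rmul M (y \<one>) \<otimes>\<^bsub>A\<^esub> x) c"
      by (rule VL.frag_eval_cong[unfolded VL_simps])
        (use k in \<open>auto simp: counit_R S_mult S_lmul_nakayama\<close>)
    also have "\<dots> = frag_eval A ?g (frag_map flip c)"
      by (rule VL.frag_eval_map[unfolded VL_simps, OF k flip_fun f(2), symmetric])
    also have "\<dots> = S a"
      by (rule coproduct_L_counit(2)[OF S_in_A[OF a] flip_c])
    finally show "S (frag_eval A ?p c) = S a" .
  qed
  show "frag_eval A ?q c = a"
  proof (rule S_cancel)
    show "frag_eval A ?q c \<in> carrier A"
      using VL.frag_eval_closed[of c AA, unfolded VL_simps, OF k g(2)] .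
    have "S (frag_eval A ?q c) =
        frag_eval A (\<lambda>p. S (case p of (x, y) \<Rightarrow> x \<otimes>\<^bsub>A\<^esub> rmul M (piR y))) c"
      by (rule frag_eval_A_S[OF k g(2)])
    also have "\<dots> = frag_eval A (\<lambda>p. case flip p of (x, y) \<Rightarrow> lmul M (x \<one>) \<otimes>\<^bsub>A\<^esub> y) c"
      by (rule VL.frag_eval_cong[unfolded VL_simps])
        (use k in \<open>auto simp: counit_R S_mult S_rmul\<close>)
    also have "\<dots> = frag_eval A ?f (frag_map flip c)"
      by (rule VL.frag_eval_map[unfolded VL_simps, OF k flip_fun f(1), symmetric])
    also have "\<dots> = S a"
      by (rule coproduct_L_counit(1)[OF S_in_A[OF a] flip_c])
    finally show "S (frag_eval A ?q c) = S a" .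
  qed
qed

lemma coproduct_R_one: "frag_of (\<one>\<^bsub>A\<^esub>, \<one>\<^bsub>A\<^esub>) \<in> copR \<one>\<^bsub>A\<^esub>"
  by (rule coproduct_R_I) (simp_all add: S_one coproduct_L_one)

lemma counit_R_hom: "piR \<in> bimod_homs VR (regular_bimod (op_ring L))"
  unfolding bimod_homs_def regular_bimod_def
  by (simp add: hom_def counit_R S_add S_mult S_lmul_nakayama S_rmul)

lemma comonoid_R: "comonoid_bimod VR copR piR"
  unfolding comonoid_bimod_def Let_def VR_simps
  using VR.bimodule coproduct_R_hom counit_R_hom
  by (intro conjI ballI allI impI)
    (simp_all add: coproduct_R_bimodule coproduct_R_counit coproduct_R_coassoc)

lemma core_R: "bialgebroid_core BR"
  unfolding bialgebroid_core_def right_bialgebroid_of_def Let_def bialgebroid.simps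
  using ring_A ring_op_ring[OF ring_L] rmul_hom lmul_nakayama_hom
  by (intro conjI ballI)
    (simp_all add: lmul_rmul_commute coproduct_R_one coproduct_R_mult counit_R S_one)

lemma right_bialgebroid_R: "right_bialgebroid BR"
  unfolding right_bialgebroid_def Let_def
proof (intro conjI ballI)
  show "bialgebroid_core BR" by (rule core_R)
qed (use comonoid_R coproduct_R_takeuchi in
    \<open>simp_all add: right_bialgebroid_of_def bimod_R_def counit_R S_mult S_rmul S_lmul_nakayama\<close>)

section \<open>The antipode\<close>

lemma flip_coproduct_L:
  assumes a: "a \<in> carrier A" and c: "c \<in> copL a"
  shows "frag_map flip c \<in> copR (S a)"
proof (rule coproduct_R_I[OF S_in_A[OF a] keys_flip])
  note k = coproduct_L_D(1)[OF a c]
  show "keys c \<subseteq> AA" by (rule k)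
  have "S a m \<otimes> m' = frag_eval M (\<lambda>(x, y). x (m \<otimes> S y m')) (frag_map flip c)"
    if m: "m \<in> carrier M" "m' \<in> carrier M" for m m'
  proof -
    let ?f = "\<lambda>(x, y). x (m \<otimes> S y m')"
    have f: "?f \<in> AA \<rightarrow> carrier M" using m by auto
    have "E (w \<otimes> (S a m \<otimes> m')) = E (w \<otimes> frag_eval M ?f (frag_map flip c))" if w: "w \<in> carrier M" for w
    proof -
      let ?g = "\<lambda>(x, y). S x (y w \<otimes> m)"
      have g: "?g \<in> AA \<rightarrow> carrier M" using m w by auto
      have g_eval: "frag_eval M ?g c = w \<otimes> S a m"
      proof (rule E_nondeg_right[OF frag_eval_closed[OF k g]])
        show "w \<otimes> S a m \<in> carrier M" using w m a by simp
        fix p assume p: "p \<in> carrier M"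
        have "E (p \<otimes> frag_eval M ?g c) = frag_eval M (\<lambda>z. E (p \<otimes> ?g z)) c"
          by (rule hom_eval_M[OF _ _ k g, where F = "\<lambda>x. E (p \<otimes> x)"])
            (use p in \<open>simp_all add: r_distr E_add\<close>)
        also have "\<dots> = frag_eval M (\<lambda>z. E ((case z of (x, y) \<Rightarrow> x p \<otimes> y w) \<otimes> m)) c"
          by (rule frag_eval_cong) (use k p m w in \<open>auto simp: S_adjoint m_assoc\<close>)
        also have "\<dots> = E (ev c p w \<otimes> m)"
          by (rule hom_eval_M[OF _ _ k ev_fun[OF p w],
              where F = "\<lambda>x. E (x \<otimes> m)", symmetric]) (use m in \<open>simp_all add: l_distr E_add\<close>)
        also have "\<dots> = E ((p \<otimes> w) \<otimes> S a m)"
          using coproduct_L_D(3)[OF a c p w] p w m a by (simp add: S_adjoint)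
        also have "\<dots> = E (p \<otimes> (w \<otimes> S a m))"
          using p w m a by (simp add: m_assoc)
        finally show "E (p \<otimes> frag_eval M ?g c) = E (p \<otimes> (w \<otimes> S a m))" .
      qed
      have "frag_eval M ?f (frag_map flip c) = frag_eval M (\<lambda>z. ?f (flip z)) c"
        by (rule frag_eval_map[OF k flip_fun f])
      moreover have "(\<lambda>z. ?f (flip z)) \<in> AA \<rightarrow> carrier M" using m by auto
      ultimately have "E (w \<otimes> frag_eval M ?f (frag_map flip c)) = frag_eval M (\<lambda>z. E (w \<otimes> ?f (flip z))) c"
        using hom_eval_M[OF _ _ k, of "\<lambda>x. E (w \<otimes> x)" "\<lambda>z. ?f (flip z)"] w
        by (simp add: r_distr E_add)
      also have "\<dots> = frag_eval M (\<lambda>z. E (?g z \<otimes> m')) c"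
      proof (rule frag_eval_cong)
        fix z assume "z \<in> keys c"
        then obtain x y where z: "z = (x, y)" "x \<in> carrier A" "y \<in> carrier A" using k by auto
        have "E (w \<otimes> S y (m \<otimes> S (S x) m')) = E ((y w \<otimes> m) \<otimes> S (S x) m')"
          using z w m by (simp add: S_adjoint m_assoc)
        also have "\<dots> = E (S x (y w \<otimes> m) \<otimes> m')"
          using z w m by (intro S_adjoint) simp_all
        finally show "E (w \<otimes> ?f (flip z)) = E (?g z \<otimes> m')" by (simp add: z(1))
      qed (use k w m in auto)
      also have "\<dots> = E (frag_eval M ?g c \<otimes> m')"
        by (rule hom_eval_M[OF _ _ k g,
            where F = "\<lambda>x. E (x \<otimes> m')", symmetric]) (use m in \<open>simp_all add: l_distr E_add\<close>)
      also have "\<dots> = E (w \<otimes> (S a m \<otimes> m'))"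
        unfolding g_eval using w m a by (simp add: m_assoc)
      finally show ?thesis by simp
    qed
    then show ?thesis
      using E_nondeg_right[OF _ frag_eval_closed[OF keys_flip[OF k] f], of "S a m \<otimes> m'"] m a by simp
  qed
  then show "frag_map flip (frag_map flip c) \<in> copL (S (S a))"
    using right_condition_flip_iff[OF S_in_A[OF a] keys_flip[OF k]] by simp
qed

lemma S_S_one: "a \<in> carrier A \<Longrightarrow> S (S a) \<one> = \<theta> (a \<one>)"
proof -
  assume a: "a \<in> carrier A"
  have "E (w \<otimes> S (S a) \<one>) = E (w \<otimes> \<theta> (a \<one>))" if w: "w \<in> carrier M" for w
    using S_adjoint[OF S_in_A[OF a] w one_closed] S_adjoint[OF a one_closed w]
      theta_adjoint[OF A_one_in_L[OF a] w] a w by simp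
  with a show ?thesis using E_nondeg_right[of "S (S a) \<one>" "\<theta> (a \<one>)"] by simp
qed

lemma swap_flip: "frag_map (map_prod S S) c = frag_map prod.swap (frag_map flip c)"
  unfolding frag_map_map by (rule frag_map_cong) auto

lemma iso_RL: "bialgebroid_iso BR (op_cop BL) S (\<lambda>r. r)"
  unfolding bialgebroid_iso_def right_bialgebroid_of_def left_bialgebroid_of_def op_cop_def bialgebroid.simps
proof (intro conjI ballI)
  show "S \<in> ring_iso A (op_ring A)" by (rule S_iso)
  show "(\<lambda>r. r) \<in> ring_iso (op_ring L) (op_ring L)"
    by (simp add: ring_iso_def ring_hom_def bij_betw_def)
  show "frag_map (map_prod S S) c \<in> (\<lambda>a. frag_map prod.swap ` copL a) (S a)"
    if "a \<in> carrier A" "c \<in> copR a" for a c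
    unfolding swap_flip using coproduct_R_D(3)[OF that] by blast
qed (simp_all add: S_lmul_nakayama S_rmul counit_R)

lemma iso_LR: "bialgebroid_iso BL (op_cop BR) S \<theta>"
  unfolding bialgebroid_iso_def right_bialgebroid_of_def left_bialgebroid_of_def op_cop_def bialgebroid.simps
proof (intro conjI ballI)
  show "S \<in> ring_iso A (op_ring A)" by (rule S_iso)
  show "\<theta> \<in> ring_iso L (op_ring (op_ring L))" using theta_iso by simp
  show "frag_map (map_prod S S) c \<in> (\<lambda>a. frag_map prod.swap ` copR a) (S a)"
    if "a \<in> carrier A" "c \<in> copL a" for a c
    unfolding swap_flip using flip_coproduct_L[OF that] by blast
qed (simp_all add: S_lmul S_rmul counit_R S_S_one)

lemma induced_flip_L:
  "induced_map VR flip \<in> hom (tensor VL) (tensor VR)"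
  "induced_map VR flip (tensor_class VL c) = tensor_class VR (frag_map flip c)"
  by (rule induced_map_hom[OF bimod_VL bimod_VR flip_gens_LR] induced_map_tensor_class[OF bimod_VL bimod_VR flip_gens_LR];
      simp add: flip_fun)+

lemma induced_flip_R:
  "induced_map VL flip \<in> hom (tensor VR) (tensor VL)"
  "induced_map VL flip (tensor_class VR c) = tensor_class VL (frag_map flip c)"
  by (rule induced_map_hom[OF bimod_VR bimod_VL flip_gens_RL] induced_map_tensor_class[OF bimod_VR bimod_VL flip_gens_RL];
      simp add: flip_fun)+

lemma coproduct_L_S:
  assumes a: "a \<in> carrier A"
  shows "copL (S a) = induced_map VL flip (copR a)"
proof (rule coproduct_R_ex[OF a])
  fix c assume c: "keys c \<subseteq> AA" "frag_map flip c \<in> copL (S a)"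
  show ?thesis
    unfolding coproduct_R_eq[OF a c] induced_flip_R(2) by (rule coproduct_L_D(2)[OF S_in_A[OF a] c(2)])
qed

lemma coproduct_R_S:
  assumes a: "a \<in> carrier A"
  shows "copR (S a) = induced_map VR flip (copL a)"
proof -
  let ?c = "coproduct_frag a"
  have c: "?c \<in> copL a" by (rule coproduct_L_I[OF coproduct_frag[OF a]])
  show ?thesis
    unfolding coproduct_L_D(2)[OF a c] induced_flip_L(2)
    by (rule coproduct_R_D(2)[OF S_in_A[OF a] flip_coproduct_L[OF a c]])
qed

end

theorem theorem3p3:
  fixes N :: "'n ring" and M :: "'m ring" and h :: "'n \<Rightarrow> 'm" and \<psi> :: "'m \<Rightarrow> 'n"
    and I :: "'i set" and u v :: "'i \<Rightarrow> 'm"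
  defines "A \<equiv> end_ring N M h"
    and "L \<equiv> centralizer_ring N M h"
    and "R \<equiv> op_ring (centralizer_ring N M h)"
    and "S \<equiv> antipode M h \<psi> I u v"
    and "\<iota> \<equiv> (\<lambda>r::'m. r)"
    and "\<theta> \<equiv> nakayama_inv N M h \<psi> I u v"
    and "BL \<equiv> left_bialgebroid_of N M h"
    and "BR \<equiv> right_bialgebroid_of N M h \<psi> I u v"
    and "VL \<equiv> bimod_L N M h"
    and "VR \<equiv> bimod_R N M h \<psi> I u v"
    and "S_AL \<equiv> induced_map (bimod_R N M h \<psi> I u v)
                  (\<lambda>(\<alpha>, \<beta>). (antipode M h \<psi> I u v \<beta>, antipode M h \<psi> I u v \<alpha>))"
    and "S_AR \<equiv> induced_map (bimod_L N M h)
                  (\<lambda>(\<alpha>, \<beta>). (antipode M h \<psi> I u v \<beta>, antipode M h \<psi> I u v \<alpha>))"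
  assumes "ring N" and "ring M" and "h \<in> ring_hom N M"
    and "frobenius_system N M h \<psi> I u v"
    and "depth_two N M h"
  shows "left_bialgebroid BL \<and> right_bialgebroid BR \<and>
    bialgebroid_iso BR (op_cop BL) S \<iota> \<and>
    bialgebroid_iso BL (op_cop BR) S \<theta> \<and>
    S \<in> ring_iso A (op_ring A) \<and>
    (\<forall>r \<in> carrier R. S (src BR r) = src BL (\<iota> r)) \<and>
    (\<forall>r \<in> carrier R. S (tgt BR r) = tgt BL (\<iota> r)) \<and>
    (\<forall>l \<in> carrier L. S (src BL l) = src BR (\<theta> l)) \<and>
    (\<forall>l \<in> carrier L. S (tgt BL l) = tgt BR (\<theta> l)) \<and>
    S_AL \<in> hom (tensor VL) (tensor VR) \<and>
    (\<forall>\<alpha> \<in> carrier A. \<forall>\<beta> \<in> carrier A.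
       S_AL (pure_tensor VL \<alpha> \<beta>) = pure_tensor VR (S \<beta>) (S \<alpha>)) \<and>
    S_AR \<in> hom (tensor VR) (tensor VL) \<and>
    (\<forall>\<alpha> \<in> carrier A. \<forall>\<beta> \<in> carrier A.
       S_AR (pure_tensor VR \<alpha> \<beta>) = pure_tensor VL (S \<beta>) (S \<alpha>)) \<and>
    (\<forall>\<alpha> \<in> carrier A. cop BL (S \<alpha>) = S_AR (cop BR \<alpha>)) \<and>
    (\<forall>\<alpha> \<in> carrier A. cop BR (S \<alpha>) = S_AL (cop BL \<alpha>)) \<and>
    (\<forall>\<alpha> \<in> carrier A. cou BL (S \<alpha>) = \<iota> (cou BR \<alpha>)) \<and>
    (\<forall>\<alpha> \<in> carrier A. cou BR (S \<alpha>) = \<theta> (cou BL \<alpha>))"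
proof -
  interpret frobenius_extension N M h \<psi> I u v
    using assms(13-16) by (rule frobenius_extension.intro)
  show ?thesis
  proof (rule depth_two_dual_bases[OF assms(17)])
    fix k :: nat and gam bet
    assume "\<And>j. j < k \<Longrightarrow> gam j \<in> carrier (end_ring N M h)"
      and "\<And>j. j < k \<Longrightarrow> bet j \<in> carrier (end_ring N M h)"
      and "\<And>m m'. m \<in> carrier M \<Longrightarrow> m' \<in> carrier M \<Longrightarrow>
        (\<Oplus>\<^bsub>M\<^esub>j\<in>{..<k}. gam j m \<otimes>\<^bsub>M\<^esub> bet j m') = h (\<psi> (m \<otimes>\<^bsub>M\<^esub> m'))"
    then interpret dual_bases N M h \<psi> I u v k gam bet
      by unfold_locales
    show ?thesis
      unfolding assms(1-12)
    proof (intro conjI ballI)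
      show "antipode M h \<psi> I u v \<in> ring_iso (end_ring N M h) (op_ring (end_ring N M h))"
        by (rule S_iso)
      show "left_bialgebroid (left_bialgebroid_of N M h)"
        by (rule left_bialgebroid_L)
      show "right_bialgebroid (right_bialgebroid_of N M h \<psi> I u v)"
        by (rule right_bialgebroid_R)
      show "bialgebroid_iso (right_bialgebroid_of N M h \<psi> I u v) (op_cop (left_bialgebroid_of N M h))
          (antipode M h \<psi> I u v) (\<lambda>r. r)"
        by (rule iso_RL)
      show "bialgebroid_iso (left_bialgebroid_of N M h) (op_cop (right_bialgebroid_of N M h \<psi> I u v))
          (antipode M h \<psi> I u v) (nakayama_inv N M h \<psi> I u v)"
        by (rule iso_LR)
    qed (simp_all add: induced_flip_L induced_flip_R
        left_bialgebroid_of_def right_bialgebroid_of_def pure_tensor_def S_rmul S_lmul S_lmul_nakayama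
        coproduct_L_S coproduct_R_S counit_R S_S_one)
  qed
qed

end
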